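(* Let $d\ge 1$ and let $n > d+1$. Then: (i) the proper part $\overline{\mathcal S_1(n,d)}$ of the first higher Stasheff–Tamari poset $\mathcal S_1(n,d)$ is homotopy equivalent to a sphere of dimension $n-d-3$; (ii) the proper part $\overline{\mathcal S_2(n,d)}$ of the second higher Stasheff–Tamari poset $\mathcal S_2(n,d)$ is homotopy equivalent to a sphere of dimension $n-d-3$.
   Context: Let $[n]=\{1,\dots,n\}$. For $k\ge 1$, the label $i\in[n]$ is identified with the point $(i,i^2,\dots,i^k)\in\mathbb R^k$. For $V\subseteq[n]$, $C(V,k)$ is the convex hull in $\mathbb R^k$ of the points labelled by $V$, and $C(n,k)=C([n],k)$ is the cyclic $k$-polytope with $n$ vertices. Simplices are identified with their sets of vertex labels. Two simplices are admissible if they intersect in a common (possibly empty) face of each. A triangulation of $C(n,d)$ is a set of simplices with vertices among the points labelled by $[n]$ such that: the union of the simplices is $C(n,d)$; every face of a simplex in the set is in the set; any two simplices are admissible. A triangulation is often identified with the set of its inclusion-maximal simplices, which are $d$-simplices. A lower (resp. upper) facet of $C(V,d+1)\subset\mathbb R^{d+1}$ (where $|V|\ge d+2$) is a facet visible from points with very large negative (resp. very large positive) $x_{d+1}$-coordinate, i.e. a facet whose outer normal has negative (resp. positive) last coordinate. In particular this applies to a $(d+1)$-simplex $\tilde S$ in $C(n,d+1)$ (a $(d+2)$-subset of $[n]$). Each facet is a $(d+1)$-subset of $[n]$, hence also labels a $d$-simplex in $C(n,d)$. First poset: if $T$ is a triangulation of $C(n,d)$ and $\tilde S$ is a $(d+1)$-simplex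 in $C(n,d+1)$ all of whose lower facets lie in $T$, the increasing flip in $T$ at $\tilde S$ replaces in $T$ the lower facets of $\tilde S$ by its upper facets, giving a new triangulation of $C(n,d)$. $\mathcal S_1(n,d)$ is the set of all triangulations of $C(n,d)$ with the partial order $\le_1$ that is the reflexive-transitive closure of increasing flips. Second poset: the characteristic section of a triangulation $T$ of $C(n,d)$ is the map $T:C(n,d)\to C(n,d+1)\subset\mathbb R^{d+1}$ that is linear on each simplex of $T$ and sends each vertex of $T$ labelled $i$ to the point $(i,\dots,i^{d+1})$. $\mathcal S_2(n,d)$ is the set of all triangulations of $C(n,d)$ with the partial order: $T\le_2 T'$ iff $T(x)_{d+1}\le T'(x)_{d+1}$ for all $x\in C(n,d)$, where the subscript denotes the last coordinate. Both posets have the bottom element $\hat 0_{n,d}$ (the set of lower facets of $C(n,d+1)$) and the top element $\hat 1_{n,d}$ (the set of upper facets of $C(n,d+1)$). The proper part $\overline P$ of a poset $P$ with bottom $\hat 0$ and top $\hat 1$ is $P\setminus\{\hat0,\hat1\}$. The homotopy type of a poset is that of the geometric realization of its order complex (the simplicial complex of finite chains). The $(-1)$-sphere is the empty space. *)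

theory Defs
  imports "HOL-Analysis.Analysis" "HOL-Library.Function_Algebras"
begin

text \<open>
  The spaces \<open>\<real>\<^sup>k\<close>, for all \<open>k\<close> at once, are modelled as in \<^const>\<open>Euclidean_space\<close>: a point is a
  function \<open>nat \<Rightarrow> real\<close> whose coordinates \<open>0, \<dots>, k - 1\<close> are arbitrary and whose other coordinates
  vanish. The pointwise vector space structure below makes convex hulls, faces and affine
  dependence available for such points.
\<close>

instantiation "fun" :: (type, real_vector) real_vector
begin

definition scaleR_fun :: "real \<Rightarrow> ('a \<Rightarrow> 'b) \<Rightarrow> 'a \<Rightarrow> 'b" where
  "scaleR_fun r f = (\<lambda>x. r *\<^sub>R f x)"

instance
  by standard (auto simp: scaleR_fun_def plus_fun_def fun_eq_iff algebra_simps)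

end

definition moment_point :: "nat \<Rightarrow> nat \<Rightarrow> nat \<Rightarrow> real" where
  "moment_point k i = (\<lambda>j. if j < k then real i ^ Suc j else 0)"

definition cyc :: "nat set \<Rightarrow> nat \<Rightarrow> (nat \<Rightarrow> real) set" where
  "cyc V k = convex hull (moment_point k ` V)"

abbreviation cyclic_polytope :: "nat \<Rightarrow> nat \<Rightarrow> (nat \<Rightarrow> real) set" where
  "cyclic_polytope n k \<equiv> cyc {1..n} k"

text \<open>
  \<open>c\<close> is an outer normal of the facet of \<open>C(V,k)\<close> with vertex label set \<open>F\<close>. Any \<open>k\<close> distinct points
  of the moment curve in \<open>\<real>\<^sup>k\<close> are affinely independent, and the facets are simplices, so a face is a
  facet iff it has \<open>k\<close> vertices. This is only used for \<open>card V > k\<close>.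
\<close>

definition outer_normal :: "nat set \<Rightarrow> nat \<Rightarrow> nat set \<Rightarrow> (nat \<Rightarrow> real) \<Rightarrow> bool" where
  "outer_normal V k F c \<longleftrightarrow>
     F \<subseteq> V \<and> card F = k \<and>
     (\<exists>b. (\<forall>x\<in>cyc V k. (\<Sum>j<k. c j * x j) \<le> b) \<and>
          cyc F k = cyc V k \<inter> {x. (\<Sum>j<k. c j * x j) = b})"

definition lower_facets :: "nat set \<Rightarrow> nat \<Rightarrow> nat set set" where
  "lower_facets V k = {F. \<exists>c. outer_normal V k F c \<and> c (k - 1) < 0}"

definition upper_facets :: "nat set \<Rightarrow> nat \<Rightarrow> nat set set" where
  "upper_facets V k = {F. \<exists>c. outer_normal V k F c \<and> c (k - 1) > 0}"

definition simplex_labels :: "nat \<Rightarrow> nat \<Rightarrow> nat set \<Rightarrow> bool" where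
  "simplex_labels n d S \<longleftrightarrow> S \<subseteq> {1..n} \<and> \<not> affine_dependent (moment_point d ` S)"

definition admissible :: "nat \<Rightarrow> nat set \<Rightarrow> nat set \<Rightarrow> bool" where
  "admissible d S S' \<longleftrightarrow>
     (cyc S d \<inter> cyc S' d) face_of cyc S d \<and> (cyc S d \<inter> cyc S' d) face_of cyc S' d"

text \<open>A triangulation is the complex of all its simplices; the empty face is always a member.\<close>

definition triangulations :: "nat \<Rightarrow> nat \<Rightarrow> nat set set set" where
  "triangulations n d = {T.
     (\<forall>S\<in>T. simplex_labels n d S) \<and>
     (\<Union>S\<in>T. cyc S d) = cyclic_polytope n d \<and>
     (\<forall>S\<in>T. \<forall>F. F \<subseteq> S \<longrightarrow> F \<in> T) \<and>
     (\<forall>S\<in>T. \<forall>S'\<in>T. admissible d S S')}"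

lemma finite_triangulations: "finite (triangulations n d)"
proof (rule finite_subset)
  show "triangulations n d \<subseteq> Pow (Pow {1..n})"
    by (auto simp: triangulations_def simplex_labels_def)
qed simp

definition maximal_simplices :: "nat set set \<Rightarrow> nat set set" where
  "maximal_simplices T = {S\<in>T. \<forall>S'\<in>T. S \<subseteq> S' \<longrightarrow> S' = S}"

definition complex_of :: "nat set set \<Rightarrow> nat set set" where
  "complex_of M = {F. \<exists>S\<in>M. F \<subseteq> S}"

definition bot_triangulation :: "nat \<Rightarrow> nat \<Rightarrow> nat set set" where
  "bot_triangulation n d = complex_of (lower_facets {1..n} (d + 1))"

definition top_triangulation :: "nat \<Rightarrow> nat \<Rightarrow> nat set set" where
  "top_triangulation n d = complex_of (upper_facets {1..n} (d + 1))"

definition increasing_flips :: "nat \<Rightarrow> nat \<Rightarrow> nat set set rel" where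
  "increasing_flips n d = {(T, T').
     T \<in> triangulations n d \<and> T' \<in> triangulations n d \<and>
     (\<exists>R. R \<subseteq> {1..n} \<and> card R = d + 2 \<and> lower_facets R (d + 1) \<subseteq> T \<and>
          T' = complex_of ((maximal_simplices T - lower_facets R (d + 1)) \<union> upper_facets R (d + 1)))}"

text \<open>A poset is given by its order relation; its elements are the \<^const>\<open>Field\<close> of the relation.\<close>

definition HST1 :: "nat \<Rightarrow> nat \<Rightarrow> nat set set rel" where
  "HST1 n d = Restr ((increasing_flips n d)\<^sup>*) (triangulations n d)"

definition is_characteristic_section ::
    "nat \<Rightarrow> nat \<Rightarrow> nat set set \<Rightarrow> ((nat \<Rightarrow> real) \<Rightarrow> (nat \<Rightarrow> real)) \<Rightarrow> bool" where
  "is_characteristic_section n d T f \<longleftrightarrow>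
     f \<in> cyclic_polytope n d \<rightarrow>\<^sub>E cyclic_polytope n (d + 1) \<and>
     (\<forall>S\<in>T. \<forall>x\<in>cyc S d. \<forall>y\<in>cyc S d. \<forall>u\<in>{0..1}.
        f ((1 - u) *\<^sub>R x + u *\<^sub>R y) = (1 - u) *\<^sub>R f x + u *\<^sub>R f y) \<and>
     (\<forall>i. {i} \<in> T \<longrightarrow> f (moment_point d i) = moment_point (d + 1) i)"

text \<open>
  For a triangulation the section exists and is unique: barycentric coordinates in a simplex are
  unique, and those of two simplices agree on their common face.
\<close>

definition characteristic_section ::
    "nat \<Rightarrow> nat \<Rightarrow> nat set set \<Rightarrow> (nat \<Rightarrow> real) \<Rightarrow> (nat \<Rightarrow> real)" where
  "characteristic_section n d T = (THE f. is_characteristic_section n d T f)"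

text \<open>Coordinates are counted from 0, so the last coordinate of a point of \<open>\<real>\<^sup>d\<^sup>+\<^sup>1\<close> has index \<open>d\<close>.\<close>

definition HST2 :: "nat \<Rightarrow> nat \<Rightarrow> nat set set rel" where
  "HST2 n d = {(T, T'). T \<in> triangulations n d \<and> T' \<in> triangulations n d \<and>
     (\<forall>x\<in>cyclic_polytope n d.
        characteristic_section n d T x d \<le> characteristic_section n d T' x d)}"

definition proper_part :: "'a rel \<Rightarrow> 'a \<Rightarrow> 'a \<Rightarrow> 'a rel" where
  "proper_part r b t = Restr r (Field r - {b, t})"

definition order_complex :: "'a rel \<Rightarrow> 'a set set" where
  "order_complex r = {c. finite c \<and> c \<in> Chains r}"

text \<open>
  Points of the realization are given by barycentric coordinates. The topology is that of pointwise
  convergence, which is the usual one (the weak topology) when the complex is finite.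
\<close>

definition geometric_realization :: "'a set set \<Rightarrow> ('a \<Rightarrow> real) topology" where
  "geometric_realization K = subtopology (powertop_real UNIV)
     {w. (\<forall>v. w v \<ge> 0) \<and> {v. w v \<noteq> 0} \<in> K \<and> (\<Sum>v | w v \<noteq> 0. w v) = 1}"

definition sphere_space :: "int \<Rightarrow> (nat \<Rightarrow> real) topology" where
  "sphere_space m = (if m < 0 then discrete_topology {} else nsphere (nat m))"

end

theory Submission
  imports Defs
begin

text \<open>
  Send a triangulation of \<open>C(m + 1, d)\<close> to the triangulation of \<open>C(m, d)\<close> that arises when the vertex
  \<open>m + 1\<close> slides along the moment curve to \<open>m\<close>. For both orders this map is monotone and has a smallest
  and a largest section, and within each of its fibres every triangulation lies between the two
  sections by flips; the order in which to flip is read off from a lexicographic order on simplices.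
  Colour a triangulation according to whether the simplex on the last \<open>d + 1\<close> labels belongs to it, so
  that red triangulations form an upper set, the large section is red and the small one is not. The
  fibre over the bottom element is red apart from the bottom element itself, and the fibre over the top
  element contains no red triangulation except the top element. Up to homotopy of the proper part one
  may therefore replace the poset for \<open>m + 1\<close> by the product of the poset for \<open>m\<close> with a two-element
  chain. As \<open>C(d + 1, d)\<close> has only one triangulation, the poset for \<open>n\<close> becomes the Boolean lattice of
  rank \<open>n - d - 1\<close>, the order complex of whose proper part is a sphere.

  Geometry enters through sign patterns only: two simplices on the moment curve cross, and one lies
  above the other, iff they contain the two halves of an alternating sequence of \<open>d + 2\<close> labels.
\<close>

subsection \<open>Circuits of the moment curve\<close>

text \<open>Deletion by itself does not induce a map of proper parts: the fibres over the bottom and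
  the top element contain further triangulations, which would be sent to the removed elements. The
  colour repairs this, since the pair of deletion and colour reaches an extreme element of the
  product only at the corresponding extreme triangulation. The simplex on the last
  \<open>d + 1\<close> labels is suited to define the colour for two reasons: it is an extreme
  facet, so that in one direction nothing can lie beyond it, and every flip leaving the bottom or
  entering the top within its fibre exchanges it. Both orders share one induction. Relations between
  a triangulation and the two sections come from flips inside a fibre and so hold in both orders.
  Antisymmetry and monotonicity of the colour are shown for heights and pass to the flip order
  because that order is contained in the height order. Weights are not normalized, so that points
  form a cone and rescaling is free. Total weight 1 is imposed only when the combinatorial
  triangulations are matched with the geometric ones.\<close>

definition above :: "nat set \<Rightarrow> nat \<Rightarrow> nat" where
  "above Z z = card {w\<in>Z. z < w}"

text \<open>Finitely supported weights on the labels represent points of the cone over the moment curve.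
  Two of them represent the same point in dimension \<open>d\<close> iff their moments of order at most \<open>d\<close>
  agree, the moment of order 0 being the total weight.\<close>

definition supp :: "(nat \<Rightarrow> real) \<Rightarrow> nat set" where
  "supp c = {i. c i \<noteq> 0}"

definition moment_ev :: "(nat \<Rightarrow> real) \<Rightarrow> real poly \<Rightarrow> real" where
  "moment_ev c q = (\<Sum>i\<in>supp c. c i * poly q (real i))"

definition same_moments :: "nat \<Rightarrow> (nat \<Rightarrow> real) \<Rightarrow> (nat \<Rightarrow> real) \<Rightarrow> bool" where
  "same_moments d a b \<longleftrightarrow> (\<forall>q. degree q \<le> d \<longrightarrow> moment_ev a q = moment_ev b q)"

definition nonneg :: "nat set \<Rightarrow> (nat \<Rightarrow> real) \<Rightarrow> bool" where
  "nonneg S a \<longleftrightarrow> (\<forall>i. a i \<ge> 0) \<and> supp a \<subseteq> S"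

text \<open>\<open>over d S S'\<close> expresses that \<open>S\<close>, lifted to dimension \<open>d + 1\<close>, somewhere lies strictly above
  \<open>S'\<close>: the labels in \<open>Z\<close> alternate between \<open>S\<close> and \<open>S'\<close>, starting with \<open>S\<close> at the top.\<close>

definition over :: "nat \<Rightarrow> nat set \<Rightarrow> nat set \<Rightarrow> bool" where
  "over d S S' \<longleftrightarrow> (\<exists>Z. finite Z \<and> card Z = d + 2 \<and>
     (\<forall>z\<in>Z. if even (above Z z) then z \<in> S else z \<in> S'))"

text \<open>As a functional on weights this is the hyperplane through the points labelled by
  \<open>F\<close>, in the dimension equal to \<open>card F\<close>. Its sign at any other label is
  given by the parity of \<open>above F\<close>.\<close>

definition vanish_poly :: "nat set \<Rightarrow> real poly" where
  "vanish_poly F = (\<Prod>f\<in>F. [:- real f, 1:])"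

lemma above_remove:
  assumes "finite Z" "r \<in> Z"
  shows "above (Z - {r}) v = (if v < r then above Z v - 1 else above Z v)"
proof (cases "v < r")
  case True
  have "{w \<in> Z - {r}. v < w} = {w\<in>Z. v < w} - {r}" by auto
  then show ?thesis using True assms by (simp add: above_def)
next
  case False
  then have "{w \<in> Z - {r}. v < w} = {w\<in>Z. v < w}" by auto
  then show ?thesis using False by (simp add: above_def)
qed

lemma above_insert:
  assumes "finite Z" "r \<notin> Z"
  shows "above (insert r Z) v = (if v < r then Suc (above Z v) else above Z v)"
proof (cases "v < r")
  case True
  have "{w \<in> insert r Z. v < w} = insert r {w\<in>Z. v < w}" using True by auto
  then show ?thesis using True assms by (simp add: above_def)
next
  case False
  then have "{w \<in> insert r Z. v < w} = {w\<in>Z. v < w}" by auto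
  then show ?thesis using False by (simp add: above_def)
qed

lemma above_remove_self [simp]: "above (Z - {r}) r = above Z r"
proof -
  have "{w \<in> Z - {r}. r < w} = {w\<in>Z. r < w}" by auto
  then show ?thesis by (simp add: above_def)
qed

lemma above_insert_self [simp]: "above (insert r Z) r = above Z r"
proof -
  have "{w \<in> insert r Z. r < w} = {w\<in>Z. r < w}" by auto
  then show ?thesis by (simp add: above_def)
qed

lemma above_pos: "finite Z \<Longrightarrow> r \<in> Z \<Longrightarrow> v < r \<Longrightarrow> above Z v > 0"
  unfolding above_def by (subst card_gt_0_iff) auto

lemma above_empty [simp]: "above {} z = 0"
  by (simp add: above_def)

lemma above_Max [simp]: "finite Z \<Longrightarrow> (\<And>z. z \<in> Z \<Longrightarrow> z \<le> m) \<Longrightarrow> above Z m = 0"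
  unfolding above_def by (auto simp: not_less dest: leD)

lemma vanish_poly_props:
  assumes "finite F"
  shows "poly (vanish_poly F) t = (\<Prod>f\<in>F. t - real f)" "degree (vanish_poly F) = card F"
    "lead_coeff (vanish_poly F) = 1"
proof -
  show "poly (vanish_poly F) t = (\<Prod>f\<in>F. t - real f)" "degree (vanish_poly F) = card F"
    using assms by (auto simp: vanish_poly_def poly_prod degree_prod_sum_eq)
  show "lead_coeff (vanish_poly F) = 1" unfolding vanish_poly_def lead_coeff_prod by simp
qed

lemma vanish_poly_zero: "finite F \<Longrightarrow> f \<in> F \<Longrightarrow> poly (vanish_poly F) (real f) = 0"
  by (auto simp: vanish_poly_props)

lemma vanish_poly_sgn:
  assumes "finite F" "t \<notin> F"
  shows "if even (above F t) then poly (vanish_poly F) (real t) > 0 else poly (vanish_poly F) (real t) < 0"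
  using assms
proof (induction F rule: finite_induct)
  case empty
  then show ?case by (simp add: vanish_poly_def above_def)
next
  case (insert x F)
  have e: "poly (vanish_poly (insert x F)) (real t) =
    (real t - real x) * poly (vanish_poly F) (real t)"
    using insert by (simp add: vanish_poly_props)
  have ih: "if even (above F t) then poly (vanish_poly F) (real t) > 0 else poly (vanish_poly F) (real t) < 0"
    using insert by simp
  show ?case
  proof (cases "t < x")
    case True
    then show ?thesis using ih insert
      by (auto simp: e above_insert mult_neg_pos mult_neg_neg split: if_splits)
  next
    case False
    then have "t > x" using insert by auto
    then show ?thesis using ih insert
      by (auto simp: e above_insert mult_pos_pos mult_pos_neg split: if_splits)
  qed
qed

lemma vanish_poly_nonneg_iff:
  assumes "finite F" "t \<notin> F"
  shows "poly (vanish_poly F) (real t) > 0 \<longleftrightarrow> even (above F t)"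
    "poly (vanish_poly F) (real t) < 0 \<longleftrightarrow> odd (above F t)"
  using vanish_poly_sgn[OF assms] by (auto split: if_splits)

lemma moment_ev_superset: "finite A \<Longrightarrow> supp c \<subseteq> A \<Longrightarrow> moment_ev c q = (\<Sum>i\<in>A. c i * poly q (real i))"
  unfolding moment_ev_def by (rule sum.mono_neutral_left) (auto simp: supp_def)

lemma moment_ev_linear:
  assumes "finite (supp a)" "finite (supp b)"
  shows "moment_ev (\<lambda>i. x * a i + y * b i) q = x * moment_ev a q + y * moment_ev b q"
    and "finite (supp (\<lambda>i. x * a i + y * b i))"
proof -
  have s: "supp (\<lambda>i. x * a i + y * b i) \<subseteq> supp a \<union> supp b" by (auto simp: supp_def)
  then show "finite (supp (\<lambda>i. x * a i + y * b i))" using assms by (meson finite_Un finite_subset)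
  show "moment_ev (\<lambda>i. x * a i + y * b i) q = x * moment_ev a q + y * moment_ev b q"
    using assms s
      by (simp add: moment_ev_superset[of "supp a \<union>
      supp b"] sum_distrib_left sum.distrib algebra_simps)
qed

lemma moment_ev_diff:
  assumes "finite (supp a)" "finite (supp b)"
  shows "moment_ev (\<lambda>i. a i - b i) q = moment_ev a q - moment_ev b q"
  using moment_ev_linear(1)[OF assms, of 1 "-1"] by simp

lemma moment_ev_add_scaled:
  assumes "finite (supp a)" "finite (supp b)"
  shows "moment_ev (\<lambda>i. a i + y * b i) q = moment_ev a q + y * moment_ev b q"
  using moment_ev_linear(1)[OF assms, of 1] by simp

lemma finite_supp_diff: "finite (supp a) \<Longrightarrow> finite (supp b) \<Longrightarrow> finite (supp (\<lambda>i. a i - b i))"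
  using moment_ev_linear(2)[of a b 1 "-1"] by simp

lemma nonneg_mono: "nonneg S a \<Longrightarrow> S \<subseteq> S' \<Longrightarrow> nonneg S' a"
  by (auto simp: nonneg_def)

lemma nonneg_supp: "nonneg S a \<Longrightarrow> nonneg (supp a) a"
  by (auto simp: nonneg_def)

lemma nonneg_finite: "nonneg S a \<Longrightarrow> finite S \<Longrightarrow> finite (supp a)"
  by (auto simp: nonneg_def finite_subset)

lemma same_moments_refl [simp]: "same_moments d a a" by (simp add: same_moments_def)
lemma same_moments_sym: "same_moments d a b \<Longrightarrow> same_moments d b a" by (simp add: same_moments_def)
lemma same_moments_trans: "same_moments d a b \<Longrightarrow> same_moments d b c \<Longrightarrow> same_moments d a c"
  by (simp add: same_moments_def)

text \<open>If the signs of \<open>c\<close> alternate too rarely, a product of linear factors with roots between the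
  integers is opposite to \<open>c\<close> in sign everywhere.\<close>

lemma opposite_poly:
  assumes "finite (supp c)" "\<forall>i\<ge>N. c i = 0"
    and "\<nexists>Z. finite Z \<and> card Z = Suc m \<and> (\<forall>z\<in>Z. if even (above Z z) then c z > 0 else c z < 0)"
  shows "\<exists>q. degree q \<le> m \<and> lead_coeff q = 1 \<and>
    (\<forall>i. poly q (real i) \<noteq> 0 \<and> c i * poly q (real i) \<le> 0) \<and> (\<forall>i\<ge>N. poly q (real i) > 0)"
  using assms
proof (induction m arbitrary: c N)
  case 0
  have "c i \<le> 0" for i
  proof (rule ccontr)
    assume "\<not> c i \<le> 0"
    then have "finite {i} \<and> card {i} = Suc 0 \<and>
      (\<forall>z\<in>{i}. if even (above {i} z) then c z > 0 else c z < 0)"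
      by simp
    then show False using 0 by blast
  qed
  then show ?case by (intro exI[of _ 1]) auto
next
  case (Suc m)
  show ?case
  proof (cases "\<exists>i. c i > 0")
    case False
    then show ?thesis by (intro exI[of _ 1]) (auto simp: not_less)
  next
    case True
    define P where "P = {i. c i > 0}"
    have fP: "finite P" "P \<noteq> {}"
      using Suc.prems(1) True by (auto simp: P_def supp_def intro: rev_finite_subset)
    define M where "M = Max P"
    have M: "c M > 0" "\<And>i. i > M \<Longrightarrow> c i \<le> 0"
      using Max_in[OF fP] Max_ge[OF fP(1)] unfolding M_def[symmetric]
      by (auto simp: P_def not_less[symmetric])
    \<comment> \<open>\<open>M\<close> is the largest label with a positive entry. Below it the
      signs are exchanged, so that putting \<open>M\<close> on top of an alternating sequence for
      \<open>c'\<close> gives one for \<open>c\<close> that is longer by one.\<close>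
    define c' where "c' i = (if i < M then - c i else 0)" for i
    have "supp c' \<subseteq> supp c" by (auto simp: c'_def supp_def)
    then have f': "finite (supp c')" using Suc.prems(1) finite_subset by blast
    have no: "\<nexists>Z. finite Z \<and> card Z = Suc m \<and>
      (\<forall>z\<in>Z. if even (above Z z) then c' z > 0 else c' z < 0)"
    proof
      assume "\<exists>Z. finite Z \<and> card Z = Suc m \<and>
        (\<forall>z\<in>Z. if even (above Z z) then c' z > 0 else c' z < 0)"
      then obtain Z where Z: "finite Z" "card Z = Suc m"
        "\<And>z. z\<in>Z \<Longrightarrow> if even (above Z z) then c' z > 0 else c' z < 0" by blast
      have lt: "z < M" if "z \<in> Z" for z using Z(3)[OF that] by (auto simp: c'_def split: if_splits)
      then have nin: "M \<notin> Z" by blast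
      have "if even (above (insert M Z) z) then c z > 0 else c z < 0" if "z \<in> insert M Z" for z
      proof (cases "z = M")
        case True
        have "above Z M = 0" using Z(1) lt by (intro above_Max) (auto intro: less_imp_le)
        then show ?thesis using True M by simp
      next
        case False
        then have z: "z \<in> Z" "z < M" using that lt by auto
        show ?thesis using Z(3)[OF z(1)] z nin Z(1)
          by (auto simp: above_insert c'_def split: if_splits)
      qed
      then show False using Suc.prems(3) Z nin by (metis card_insert_disjoint finite_insert)
    qed
    obtain q where q: "degree q \<le> m" "lead_coeff q = 1"
      "\<And>i. poly q (real i) \<noteq> 0" "\<And>i. c' i * poly q (real i) \<le> 0" "\<And>i. i\<ge>M \<Longrightarrow> poly q (real i) > 0"
      using Suc.IH[OF f' _ no, of M] by (auto simp: c'_def)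
    \<comment> \<open>The new root lies strictly between \<open>M\<close> and \<open>M + 1\<close>,
      hence at no label. It reverses the sign up to \<open>M\<close>, while above \<open>M\<close>
      both factors are positive.\<close>
    define p where "p = q * [: - (real M + 1/2), 1:]"
    have q0: "q \<noteq> 0" using q(2) by auto
    have pe: "poly p (real i) = poly q (real i) * (real i - real M - 1/2)" for i
      by (simp add: p_def algebra_simps)
    have lf: "real i - real M - 1/2 < 0" if "i \<le> M" for i using that by simp
    have gt: "real i - real M - 1/2 > 0" if "i > M" for i
    proof -
      have "real i \<ge> real M + 1" using that by linarith
      then show ?thesis by linarith
    qed
    have "degree p \<le> Suc m" unfolding p_def using q(1) q0 by (subst degree_mult_eq) auto
    moreover have "lead_coeff p = 1" unfolding p_def lead_coeff_mult using q(2) by simp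
    moreover have "poly p (real i) \<noteq> 0" for i
      using lf[of i] gt[of i] q(3)[of i] by (cases "i \<le> M") (auto simp: pe)
    moreover have "c i * poly p (real i) \<le> 0" for i
    proof -
      consider "i < M" | "i = M" | "i > M" by linarith
      then show ?thesis
      proof cases
        case 1
        then have "c i * poly q (real i) \<ge> 0" using q(4)[of i] by (simp add: c'_def)
        then have "(c i * poly q (real i)) * (real i - real M - 1/2) \<le> 0"
          using lf[of i] 1 by (intro mult_nonneg_nonpos) auto
        then show ?thesis by (simp add: pe mult.assoc)
      next
        case 2
        have "c M * poly q (real M) \<ge> 0" using M q(5)[of M] by simp
        then show ?thesis using 2 by (simp add: pe)
      next
        case 3
        have "poly p (real i) > 0" using gt[of i] q(5)[of i] 3 by (simp add: pe)
        then show ?thesis using M(2)[of i] 3 by (simp add: mult_nonpos_nonneg)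
      qed
    qed
    moreover have "poly p (real i) > 0" if "i \<ge> N" for i
    proof -
      have "i > M" using M(1) Suc.prems(2) that
        by (metis not_less_iff_gr_or_eq less_le_trans linorder_not_less)
      then show ?thesis using gt[of i] q(5)[of i] by (simp add: pe)
    qed
    ultimately show ?thesis by blast
  qed
qed

text \<open>With too few sign changes, \<open>opposite_poly\<close> yields a monic polynomial of
  degree at most \<open>d + 1\<close> for which every term of the moment is negative. But moments of
  order up to \<open>d\<close> vanish and the one of order \<open>d + 1\<close> is not
  negative.\<close>

lemma sign_alternation:
  assumes fin: "finite (supp c)" and nz: "supp c \<noteq> {}"
    and van: "\<And>q. degree q \<le> d \<Longrightarrow> moment_ev c q = 0" and top: "moment_ev c (monom 1 (Suc d)) \<ge> 0"
  shows "\<exists>Z. finite Z \<and> card Z = d + 2 \<and> (\<forall>z\<in>Z. if even (above Z z) then c z > 0 else c z < 0)"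
proof (rule ccontr)
  assume neg: "\<not> ?thesis"
  obtain N where N: "\<forall>i\<ge>N. c i = 0"
  proof
    show "\<forall>i\<ge>Suc (Max (supp c)). c i = 0"
      using Max_ge[OF fin] by (auto simp: supp_def not_less_eq_eq[symmetric])
  qed
  obtain q where q: "degree q \<le> Suc d" "lead_coeff q = 1"
      "\<And>i. poly q (real i) \<noteq> 0" "\<And>i. c i * poly q (real i) \<le> 0"
    using opposite_poly[OF fin N, of "Suc d"] neg by auto
  have "moment_ev c q < 0"
  proof -
    have "c i * poly q (real i) < 0" if "i \<in> supp c" for i
      using q(3)[of i] q(4)[of i] that by (simp add: supp_def less_le)
    then have "(\<Sum>i\<in>supp c. c i * poly q (real i)) < (\<Sum>i\<in>supp c. 0)"
      using fin nz by (intro sum_strict_mono) auto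
    then show ?thesis by (simp add: moment_ev_def)
  qed
  show False
  proof (cases "degree q \<le> d")
    case True
    then show ?thesis using van \<open>moment_ev c q < 0\<close> by fastforce
  next
    case False
    then have dq: "degree q = Suc d" using q by simp
    define r where "r = q - monom 1 (Suc d)"
    have "degree r \<le> d"
    proof (rule degree_le, intro allI impI)
      fix i assume "d < i"
      then consider "i = Suc d" | "i > Suc d" by linarith
      then show "coeff r i = 0"
      proof cases
        case 1 then show ?thesis using q(2) dq by (simp add: r_def)
      next
        case 2 then show ?thesis using dq by (simp add: r_def coeff_eq_0)
      qed
    qed
    then have "moment_ev c r = 0" by (rule van)
    moreover have "moment_ev c r = moment_ev c q - moment_ev c (monom 1 (Suc d))"
      by (simp add: moment_ev_def r_def algebra_simps sum_subtractf)
    ultimately show ?thesis using \<open>moment_ev c q < 0\<close> top by linarith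
  qed
qed

text \<open>In an alternating sequence for \<open>a - b\<close> the positive entries come from
  \<open>S\<close> and the negative ones from \<open>S'\<close>. Equal heights suffice, since
  \<open>a\<close> and \<open>b\<close> differ.\<close>

lemma over_of_height:
  assumes "nonneg S a" "nonneg S' b" "finite S" "finite S'" "same_moments d a b"
    and "moment_ev a (monom 1 (Suc d)) \<ge> moment_ev b (monom 1 (Suc d))" "a \<noteq> b"
  shows "over d S S'"
proof -
  define c where "c = (\<lambda>i. a i - b i)"
  have fs: "finite (supp a)" "finite (supp b)" using assms nonneg_finite by auto
  have "\<exists>Z. finite Z \<and> card Z = d + 2 \<and> (\<forall>z\<in>Z. if even (above Z z) then c z > 0 else c z < 0)"
  proof (rule sign_alternation)
    show "finite (supp c)" unfolding c_def using finite_supp_diff[OF fs] .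
    show "supp c \<noteq> {}" using assms(7) by (auto simp: supp_def c_def)
    show "moment_ev c q = 0" if "degree q \<le> d" for q
      using assms(5) that by (simp add: c_def moment_ev_diff[OF fs] same_moments_def)
    show "moment_ev c (monom 1 (Suc d)) \<ge> 0" using assms(6)
      by (simp add: c_def moment_ev_diff[OF fs])
  qed
  then obtain Z where Z: "finite Z" "card Z = d + 2"
    "\<And>z. z\<in>Z \<Longrightarrow> if even (above Z z) then c z > 0 else c z < 0" by blast
  have "if even (above Z z) then z \<in> S else z \<in> S'" if "z \<in> Z" for z
  proof (cases "even (above Z z)")
    case True
    then have "a z > b z" using Z(3)[OF that] by (simp add: c_def)
    then have "a z \<noteq> 0" using assms(2) by (auto simp: nonneg_def not_less[symmetric])
    then show ?thesis using True assms(1) by (auto simp: nonneg_def supp_def)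
  next
    case False
    then have "b z > a z" using Z(3)[OF that] by (simp add: c_def)
    then have "b z \<noteq> 0" using assms(1) by (auto simp: nonneg_def not_less[symmetric])
    then show ?thesis using False assms(2) by (auto simp: nonneg_def supp_def)
  qed
  then show ?thesis unfolding over_def using Z by blast
qed

text \<open>One of the two heights is at least as large as the other, so distinct weights would give
  a crossing in one of the two directions.\<close>

lemma noncross_eq:
  assumes "nonneg S a" "nonneg S' b" "finite S" "finite S'" "same_moments d a b" "\<not> over d S S'"
    "\<not> over d S' S"
  shows "a = b"
  using over_of_height[OF assms(1-5)] over_of_height[OF assms(2,1,4,3) same_moments_sym[OF assms(5)]] assms(6,7)
  by (metis linear)

section \<open>Interpolation at labels and affine dependences\<close>

definition lag :: "nat set \<Rightarrow> nat \<Rightarrow> real poly" where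
  "lag S s = smult (1 / (\<Prod>w\<in>S-{s}. real s - real w)) (vanish_poly (S - {s}))"

text \<open>The coefficients of the divided difference at the labels in \<open>Z\<close>. For
  \<open>d + 2\<close> labels this is the affine dependence of their points in dimension
  \<open>d\<close>, scaled so that its moment of order \<open>d + 1\<close> is 1.\<close>

definition circ :: "nat set \<Rightarrow> nat \<Rightarrow> real" where
  "circ Z z = (if z \<in> Z then 1 / (\<Prod>w\<in>Z-{z}. real z - real w) else 0)"

lemma lag_props:
  assumes "finite S" "s \<in> S"
  shows "poly (lag S s) (real s) = 1" "t \<in> S \<Longrightarrow> t \<noteq> s \<Longrightarrow> poly (lag S s) (real t) = 0"
    "degree (lag S s) = card S - 1" "coeff (lag S s) (card S - 1) = circ S s"
proof -
  have nz: "(\<Prod>w\<in>S-{s}. real s - real w) \<noteq> 0" using assms by auto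
  show "poly (lag S s) (real s) = 1" using assms nz by (simp add: lag_def vanish_poly_props)
  show "poly (lag S s) (real t) = 0" if "t \<in> S" "t \<noteq> s"
    using assms that by (simp add: lag_def vanish_poly_zero)
  show "degree (lag S s) = card S - 1" using assms nz by (simp add: lag_def vanish_poly_props)
  show "coeff (lag S s) (card S - 1) = circ S s"
    using vanish_poly_props(2,3)[of "S-{s}"] assms by (simp add: lag_def circ_def)
qed

lemma lagrange:
  assumes "finite S" "card S = Suc d" "degree q \<le> d"
  shows "q = (\<Sum>s\<in>S. smult (poly q (real s)) (lag S s))"
proof (rule ccontr)
  define L where "L = (\<Sum>s\<in>S. smult (poly q (real s)) (lag S s))"
  assume "q \<noteq> (\<Sum>s\<in>S. smult (poly q (real s)) (lag S s))"
  then have nz: "q - L \<noteq> 0" by (simp add: L_def)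
  have "degree L \<le> d" unfolding L_def
    using assms lag_props(3)[of S]
    by (intro degree_sum_le) (auto intro!: order_trans[OF degree_smult_le])
  then have dl: "degree (q - L) \<le> d" using assms(3) by (intro degree_diff_le) auto
  have "poly L (real t) = poly q (real t)" if "t \<in> S" for t
  proof -
    have "poly L (real t) = (\<Sum>s\<in>S. poly q (real s) * (if t = s then 1 else 0))"
      unfolding L_def poly_sum
      by (rule sum.cong) (use lag_props(1,2) assms that in auto)
    also have "\<dots> = poly q (real t)" using that assms
      by (simp add: if_distrib[of "times _"] cong: if_cong)
    finally show ?thesis .
  qed
  then have "real ` S \<subseteq> {x. poly (q - L) x = 0}" by auto
  then have "card (real ` S) \<le> card {x. poly (q - L) x = 0}"
    using poly_roots_finite[OF nz] by (intro card_mono)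
  also have "\<dots> \<le> degree (q - L)" using card_poly_roots_bound[OF nz] .
  finally show False using dl assms by (simp add: card_image)
qed

lemma moment_ev_lag:
  assumes "finite S" "s \<in> S" "supp b \<subseteq> S"
  shows "moment_ev b (lag S s) = b s"
proof -
  have "moment_ev b (lag S s) = (\<Sum>i\<in>S. b i * (if i = s then 1 else 0))"
    unfolding moment_ev_superset[OF assms(1,3)]
    by (rule sum.cong) (use lag_props(1,2) assms in auto)
  also have "\<dots> = b s" using assms by (simp add: if_distrib[of "times _"] cong: if_cong)
  finally show ?thesis .
qed

lemma moment_ev_expand:
  assumes "finite S" "card S = Suc d" "degree q \<le> d"
  shows "moment_ev a q = (\<Sum>s\<in>S. poly q (real s) * moment_ev a (lag S s))"
proof -
  have "moment_ev a q = (\<Sum>i\<in>supp a. a i * poly (\<Sum>s\<in>S. smult (poly q (real s)) (lag S s)) (real i))"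
    unfolding moment_ev_def using lagrange[OF assms] by simp
  also have "\<dots> = (\<Sum>i\<in>supp a. \<Sum>s\<in>S. poly q (real s) * (a i * poly (lag S s) (real i)))"
    by (simp add: poly_sum sum_distrib_left mult_ac)
  also have "\<dots> = (\<Sum>s\<in>S. poly q (real s) * moment_ev a (lag S s))"
    by (subst sum.swap) (simp add: moment_ev_def sum_distrib_left)
  finally show ?thesis .
qed

text \<open>By interpolation on \<open>S\<close>, all moments up to order \<open>d\<close> are
  determined by those of the Lagrange polynomials. These serve as coordinates, which may be
  negative.\<close>

lemma basis_coords:
  assumes "finite S" "card S = Suc d"
  shows "same_moments d a (\<lambda>s. if s \<in> S then moment_ev a (lag S s) else 0)"
  unfolding same_moments_def
proof (intro allI impI)
  fix q :: "real poly" assume q: "degree q \<le> d"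
  have "moment_ev (\<lambda>s. if s \<in> S then moment_ev a (lag S s) else 0) q =
    (\<Sum>s\<in>S. poly q (real s) * moment_ev a (lag S s))"
    by (subst moment_ev_superset[OF assms(1)]) (auto simp: supp_def mult.commute)
  then show "moment_ev a q = moment_ev (\<lambda>s. if s \<in> S then moment_ev a (lag S s) else 0) q"
    using moment_ev_expand[OF assms q] by simp
qed

text \<open>This is affine independence of at most \<open>d + 1\<close> points of the moment curve:
  testing with Lagrange polynomials reads off the weights.\<close>

lemma same_moments_supp_unique:
  assumes "finite S" "card S \<le> Suc d" "supp a \<subseteq> S" "supp b \<subseteq> S" "same_moments d a b"
  shows "a = b"
proof
  fix i
  show "a i = b i"
  proof (cases "i \<in> S")
    case True
    have "degree (lag S i) \<le> d" using lag_props(3)[OF assms(1) True] assms(2) by simp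
    then have "moment_ev a (lag S i) = moment_ev b (lag S i)" using assms(5)
      by (simp add: same_moments_def)
    then show ?thesis using moment_ev_lag[OF assms(1) True] assms(3,4) by simp
  next
    case False
    then have "i \<notin> supp a" "i \<notin> supp b" using assms(3,4) by auto
    then show ?thesis by (simp add: supp_def)
  qed
qed

lemma ex_superset_card:
  assumes "finite (S::nat set)" "card S \<le> k"
  shows "\<exists>S'. S \<subseteq> S' \<and> finite S' \<and> card S' = k"
proof -
  have "infinite (UNIV - S)" using assms by simp
  then obtain B where B: "finite B" "card B = k - card S" "B \<subseteq> UNIV - S"
    using infinite_arbitrarily_large by blast
  have "card (S \<union> B) = k" using B assms by (subst card_Un_disjoint) auto
  then have "S \<subseteq> S \<union> B \<and> finite (S \<union> B) \<and> card (S \<union> B) = k" using B assms by simp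
  then show ?thesis by blast
qed

text \<open>The cone over a simplex is closed. In coordinates with respect to \<open>d + 1\<close>
  labels containing \<open>S\<close>, the moving point is \<open>A s + t * E s\<close>; being
  non-negative, and zero outside \<open>S\<close>, for arbitrarily small \<open>t\<close> carries
  over to \<open>t = 0\<close>.\<close>

lemma cone_limit:
  assumes S: "finite S" "card S \<le> Suc d" and fin: "finite (supp a)" "finite (supp e)"
    and lim: "\<And>\<epsilon>. \<epsilon> > 0 \<Longrightarrow> \<exists>t>0. t < \<epsilon> \<and> (\<exists>b. nonneg S b \<and> same_moments d (\<lambda>i. a i + t * e i) b)"
  shows "\<exists>b. nonneg S b \<and> same_moments d a b"
proof -
  obtain S' where S': "S \<subseteq> S'" "finite S'" "card S' = Suc d"
    using ex_superset_card[OF S] by blast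
  define A where "A s = moment_ev a (lag S' s)" for s
  define E where "E s = moment_ev e (lag S' s)" for s
  have close: "\<exists>t>0. t < \<epsilon> \<and> (\<forall>s\<in>S'. A s + t * E s \<ge> 0 \<and> (s \<notin> S \<longrightarrow> A s + t * E s = 0))" if eps:
    "\<epsilon> > 0" for \<epsilon>
  proof -
    obtain t b where t: "t > 0" "t < \<epsilon>" "nonneg S b" "same_moments d (\<lambda>i. a i + t * e i) b"
      using lim[OF eps] by blast
    have "A s + t * E s = b s" if "s \<in> S'" for s
    proof -
      have "degree (lag S' s) \<le> d" using lag_props(3)[OF S'(2) that] S'(3) by simp
      then have "moment_ev (\<lambda>i. a i + t * e i) (lag S' s) = moment_ev b (lag S' s)" using t(4)
        by (simp add: same_moments_def)
      also have "\<dots> = b s" using moment_ev_lag[OF S'(2) that] t(3) S'(1) by (auto simp: nonneg_def)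
      finally show ?thesis by (simp add: A_def E_def moment_ev_add_scaled[OF fin])
    qed
    then show ?thesis using t by (auto simp: nonneg_def supp_def intro!: exI[of _ t])
  qed
  have nonneg: "A s \<ge> 0" if "s \<in> S'" for s
  proof (rule ccontr)
    assume "\<not> A s \<ge> 0"
    then have pos: "- A s / (\<bar>E s\<bar> + 1) > 0" by (intro divide_pos_pos) auto
    obtain t where t: "t > 0" "t < - A s / (\<bar>E s\<bar> + 1)"
      "\<forall>s\<in>S'. A s + t * E s \<ge> 0 \<and> (s \<notin> S \<longrightarrow> A s + t * E s = 0)"
      using close[OF pos] by (elim exE conjE)
    then have t3: "A s + t * E s \<ge> 0" using that by simp
    have "t * E s \<le> t * (\<bar>E s\<bar> + 1)" using t by (intro mult_left_mono) auto
    also have "\<dots> < - A s" using t(2) by (subst (asm) pos_less_divide_eq) auto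
    finally show False using t3 by simp
  qed
  have zero: "A s = 0" if "s \<in> S'" "s \<notin> S" for s
  proof (rule ccontr)
    assume nz: "A s \<noteq> 0"
    then have pos: "\<bar>A s\<bar> / (\<bar>E s\<bar> + 1) > 0" by (intro divide_pos_pos) auto
    obtain t where t: "t > 0" "t < \<bar>A s\<bar> / (\<bar>E s\<bar> + 1)"
      "\<forall>s\<in>S'. A s + t * E s \<ge> 0 \<and> (s \<notin> S \<longrightarrow> A s + t * E s = 0)"
      using close[OF pos] by (elim exE conjE)
    then have t3: "A s + t * E s = 0" using that by simp
    have "A s = - (t * E s)" using t3 by linarith
    then have "\<bar>A s\<bar> = \<bar>t * E s\<bar>" by simp
    also have "\<dots> = t * \<bar>E s\<bar>" using t(1) by (simp add: abs_mult)
    also have "\<dots> \<le> t * (\<bar>E s\<bar> + 1)" using t by (intro mult_left_mono) auto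
    also have "\<dots> < \<bar>A s\<bar>" using t(2) by (subst (asm) pos_less_divide_eq) auto
    finally show False by simp
  qed
  have "nonneg S (\<lambda>s. if s \<in> S' then A s else 0)"
    using nonneg zero by (auto simp: nonneg_def supp_def)
  then show ?thesis using basis_coords[OF S'(2,3), of a] unfolding A_def by blast
qed

lemma circ_sgn:
  assumes "finite Z" "z \<in> Z"
  shows "circ Z z > 0 \<longleftrightarrow> even (above Z z)" "circ Z z < 0 \<longleftrightarrow> odd (above Z z)"
proof -
  have "(\<Prod>w\<in>Z-{z}. real z - real w) = poly (vanish_poly (Z - {z})) (real z)"
    using assms by (simp add: vanish_poly_props)
  then show "circ Z z > 0 \<longleftrightarrow> even (above Z z)" "circ Z z < 0 \<longleftrightarrow> odd (above Z z)"
    using vanish_poly_nonneg_iff[of "Z-{z}" z] assms by (simp_all add: circ_def)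
qed

lemma supp_circ: "finite Z \<Longrightarrow> supp (circ Z) = Z"
  by (auto simp: supp_def circ_def)

text \<open>Comparing coefficients of degree \<open>m\<close> in the interpolation formula. In
  particular a circuit annihilates all polynomials of smaller degree.\<close>

lemma moment_ev_circ:
  assumes "finite Z" "card Z = Suc m" "degree q \<le> m"
  shows "moment_ev (circ Z) q = coeff q m"
proof -
  have "coeff q m = (\<Sum>s\<in>Z. poly q (real s) * coeff (lag Z s) m)"
    by (subst lagrange[OF assms]) (simp add: coeff_sum)
  also have "\<dots> = (\<Sum>s\<in>Z. circ Z s * poly q (real s))"
    using lag_props(4)[OF assms(1)] assms(2) by (intro sum.cong) auto
  finally show ?thesis using supp_circ[OF assms(1)] by (simp add: moment_ev_def)
qed

lemma same_moments_add_circ: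
  assumes "finite Z" "card Z = d + 2" "finite (supp a)"
  shows "same_moments d a (\<lambda>i. a i + t * circ Z i)"
  using assms moment_ev_circ[of Z "Suc d"]
  by (auto simp: same_moments_def moment_ev_add_scaled supp_circ coeff_eq_0)

definition circ_pos :: "nat set \<Rightarrow> nat \<Rightarrow> real" where "circ_pos Z i = max 0 (circ Z i)"
definition circ_neg :: "nat set \<Rightarrow> nat \<Rightarrow> real" where "circ_neg Z i = max 0 (- circ Z i)"

lemma circ_halves:
  assumes "finite Z"
  shows "nonneg {z\<in>Z. even (above Z z)} (circ_pos Z)" "nonneg {z\<in>Z. odd (above Z z)} (circ_neg Z)"
    "supp (circ_pos Z) = {z\<in>Z. even (above Z z)}" "supp (circ_neg Z) = {z\<in>Z. odd (above Z z)}"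
proof -
  have p: "circ_pos Z i \<noteq> 0 \<longleftrightarrow> i \<in> Z \<and> even (above Z i)" for i
    using circ_sgn[OF assms, of i] by (auto simp: circ_pos_def max_def circ_def)
  have n: "circ_neg Z i \<noteq> 0 \<longleftrightarrow> i \<in> Z \<and> odd (above Z i)" for i
    using circ_sgn[OF assms, of i] by (auto simp: circ_neg_def max_def circ_def)
  show "nonneg {z\<in>Z. even (above Z z)} (circ_pos Z)" "nonneg {z\<in>Z. odd (above Z z)} (circ_neg Z)"
    "supp (circ_pos Z) = {z\<in>Z. even (above Z z)}" "supp (circ_neg Z) = {z\<in>Z. odd (above Z z)}"
    using p n by (auto simp: nonneg_def supp_def circ_pos_def circ_neg_def)
qed

lemma moment_ev_circ_halves:
  assumes "finite Z"
  shows "moment_ev (circ_pos Z) q - moment_ev (circ_neg Z) q = moment_ev (circ Z) q"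
proof -
  have "finite (supp (circ_pos Z))" "finite (supp (circ_neg Z))" using circ_halves[OF assms] assms
    by auto
  then have "moment_ev (circ_pos Z) q - moment_ev (circ_neg Z) q =
    moment_ev (\<lambda>i. circ_pos Z i - circ_neg Z i) q"
    by (simp add: moment_ev_diff)
  also have "(\<lambda>i. circ_pos Z i - circ_neg Z i) = circ Z"
    by (auto simp: circ_pos_def circ_neg_def max_def)
  finally show ?thesis .
qed

text \<open>Both halves represent the Radon point of \<open>Z\<close>. Lifted by one dimension they
  come apart, and the scaling of \<open>circ\<close> makes the difference in height exactly
  1.\<close>

lemma circuit_halves:
  assumes "finite Z" "card Z = d + 2"
  shows "same_moments d (circ_pos Z) (circ_neg Z)"
    "moment_ev (circ_pos Z) (monom 1 (Suc d)) = moment_ev (circ_neg Z) (monom 1 (Suc d)) + 1"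
  using moment_ev_circ_halves[OF assms(1)] moment_ev_circ[of Z "Suc d"] assms
  by (auto simp: same_moments_def coeff_eq_0 degree_monom_eq algebra_simps)

text \<open>The moment of \<open>q\<close> on the circuit is 0 because the degree is too small,
  whereas all its terms have the same sign. Thus a hyperplane weakly separating the two halves
  contains the whole circuit.\<close>

lemma circuit_separation:
  assumes Z: "finite Z" "card Z = d + 2" and q: "degree q \<le> d"
    and A: "\<And>z. z \<in> Z \<Longrightarrow> even (above Z z) = b \<Longrightarrow> poly q (real z) \<ge> 0"
    and B: "\<And>z. z \<in> Z \<Longrightarrow> even (above Z z) \<noteq> b \<Longrightarrow> poly q (real z) \<le> 0"
    and z: "z \<in> Z"
  shows "poly q (real z) = 0"
proof -
  define s :: real where "s = (if b then 1 else -1)"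
  have t: "s * (circ Z z * poly q (real z)) \<ge> 0" if "z \<in> Z" for z
    using circ_sgn[OF Z(1) that] A[OF that] B[OF that]
    by (cases b; cases "even (above Z z)")
      (auto simp: s_def mult_nonneg_nonneg mult_nonpos_nonpos mult_nonneg_nonpos mult_nonpos_nonneg less_imp_le)
  have "(\<Sum>z\<in>Z. s * (circ Z z * poly q (real z))) = s * moment_ev (circ Z) q"
    by (simp add: moment_ev_def supp_circ[OF Z(1)] sum_distrib_left)
  also have "\<dots> = 0" using moment_ev_circ[of Z "Suc d" q] Z q by (simp add: coeff_eq_0)
  finally have "\<forall>z\<in>Z. s * (circ Z z * poly q (real z)) = 0"
    using t Z(1) by (subst (asm) sum_nonneg_eq_0_iff) auto
  then have "s * (circ Z z * poly q (real z)) = 0" using z by blast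
  moreover have "s \<noteq> 0" "circ Z z \<noteq> 0" using circ_sgn[OF Z(1) z] by (auto simp: s_def)
  ultimately show ?thesis by simp
qed

subsection \<open>Triangulations as sets of maximal simplices\<close>

text \<open>By Gale's evenness condition, \<open>gale True V d\<close> and \<open>gale False V d\<close> are the lower and the upper
  facets of \<open>C(V, d + 1)\<close>.\<close>

definition gale :: "bool \<Rightarrow> nat set \<Rightarrow> nat \<Rightarrow> nat set set" where
  "gale b V d = {F. F \<subseteq> V \<and> card F = Suc d \<and> (\<forall>v\<in>V-F. even (above F v) = b)}"

definition covers :: "nat \<Rightarrow> nat \<Rightarrow> nat set set \<Rightarrow> bool" where
  "covers n d M \<longleftrightarrow> (\<forall>a. nonneg {1..n} a \<longrightarrow> (\<exists>S\<in>M. \<exists>b. nonneg S b \<and> same_moments d a b))"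

definition triang :: "nat \<Rightarrow> nat \<Rightarrow> nat set set \<Rightarrow> bool" where
  "triang n d M \<longleftrightarrow> (\<forall>S\<in>M. S \<subseteq> {1..n} \<and> card S = Suc d) \<and>
     (\<forall>S\<in>M. \<forall>S'\<in>M. \<not> over d S S') \<and> covers n d M"

text \<open>Comparison of the heights of two sections without mention of points. For triangulations,
  agreement with the pointwise comparison is \<open>section_le_iff\<close>.\<close>

definition below :: "nat \<Rightarrow> nat set set \<Rightarrow> nat set set \<Rightarrow> bool" where
  "below d M M' \<longleftrightarrow> (\<forall>S\<in>M. \<forall>S'\<in>M'. \<not> over d S S')"

text \<open>A multiple of the barycentre. Since its support is all of \<open>S\<close>, a weight
  shown equal to it can only live on a simplex containing \<open>S\<close>.\<close>

definition indic :: "nat set \<Rightarrow> nat \<Rightarrow> real" where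
  "indic S i = (if i \<in> S then 1 else 0)"

lemma supp_indic [simp]: "supp (indic S) = S"
  by (auto simp: supp_def indic_def)

lemma nonneg_indic: "nonneg S (indic S)"
  by (simp add: nonneg_def indic_def)

lemma over_mono: "over d S S' \<Longrightarrow> S \<subseteq> A \<Longrightarrow> S' \<subseteq> B \<Longrightarrow> over d A B"
  unfolding over_def by (elim exE, rule exI) (auto split: if_splits)

lemma triD:
  assumes "triang n d M" "S \<in> M"
  shows "S \<subseteq> {1..n}" "card S = Suc d" "finite S"
proof -
  show "S \<subseteq> {1..n}" "card S = Suc d" using assms by (auto simp: triang_def)
  then show "finite S" using card.infinite by fastforce
qed

lemma triang_noncross: "triang n d M \<Longrightarrow> S \<in> M \<Longrightarrow> S' \<in> M \<Longrightarrow> \<not> over d S S'"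
  by (auto simp: triang_def)

lemma triang_cover:
  assumes "triang n d M" "nonneg {1..n} a"
  obtains S b where "S \<in> M" "nonneg S b" "same_moments d a b"
  using assms by (auto simp: triang_def covers_def)

lemma triang_finite: "triang n d M \<Longrightarrow> finite M"
  by (rule finite_subset[of _ "Pow {1..n}"]) (auto simp: triang_def)

lemma triang_eq:
  assumes "triang n d M" "S \<in> M" "S' \<in> M" "nonneg S a" "nonneg S' b" "same_moments d a b"
  shows "a = b"
  using noncross_eq[OF assms(4,5)] triD(3)[OF assms(1)] assms triang_noncross by metis

section \<open>Circuits, Gale facets and coverings\<close>

lemma gale_minimal:
  assumes "finite R" "card R = d + 2"
  shows "F \<in> gale b R d \<longleftrightarrow> (\<exists>r\<in>R. F = R - {r} \<and> even (above R r) = b)"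
proof
  assume F: "F \<in> gale b R d"
  then have "card (R - F) = 1" using assms
    by (subst card_Diff_subset) (auto simp: gale_def intro: finite_subset)
  then obtain r where r: "R - F = {r}" using card_1_singletonE by blast
  then have "r \<in> R" "F = R - {r}" using F by (auto simp: gale_def)
  moreover have "even (above F r) = b" using F r by (auto simp: gale_def)
  ultimately show "\<exists>r\<in>R. F = R - {r} \<and> even (above R r) = b" by auto
next
  assume "\<exists>r\<in>R. F = R - {r} \<and> even (above R r) = b"
  then show "F \<in> gale b R d" using assms by (auto simp: gale_def)
qed

text \<open>The coefficients of a circuit sum to 0, this being its moment of order 0, so both signs
  occur.\<close>

lemma circuit_parity_ex:
  assumes "finite R" "card R = d + 2"
  shows "\<exists>r\<in>R. even (above R r) = b"
proof (rule ccontr)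
  assume neg: "\<not> ?thesis"
  have s: "(\<Sum>r\<in>R. circ R r) = 0"
    using moment_ev_circ[of R "Suc d" 1] assms by (simp add: moment_ev_def supp_circ)
  have ne: "R \<noteq> {}" using assms by auto
  show False
  proof (cases b)
    case True
    then have "circ R r < 0" if "r \<in> R" for r using neg circ_sgn[OF assms(1) that] that by auto
    then have "(\<Sum>r\<in>R. circ R r) < (\<Sum>r\<in>R. 0)" using assms(1) ne by (intro sum_strict_mono) auto
    then show False using s by simp
  next
    case False
    then have "circ R r > 0" if "r \<in> R" for r using neg circ_sgn[OF assms(1) that] that by auto
    then have "(\<Sum>r\<in>R. 0) < (\<Sum>r\<in>R. circ R r)" using assms(1) ne by (intro sum_strict_mono) auto
    then show False using s by simp
  qed
qed

text \<open>Moving along a circuit until a coefficient of prescribed parity vanishes.\<close>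

lemma circuit_reduce:
  assumes R: "finite R" "card R = d + 2" and a: "nonneg A a" "finite A"
  shows "\<exists>r\<in>R. even (above R r) = b \<and> (\<exists>a'. nonneg (A \<union> R - {r}) a' \<and> same_moments d a a')"
proof -
  define s :: real where "s = (if b then 1 else -1)"
  define g where "g r = s * circ R r" for r
  define Rb where "Rb = {r\<in>R. even (above R r) = b}"
  have Rb: "finite Rb" "Rb \<noteq> {}" using R circuit_parity_ex[OF R] by (auto simp: Rb_def)
  have gpos: "g r > 0" if "r \<in> Rb" for r
    using that circ_sgn[OF R(1), of r] by (cases b) (auto simp: g_def s_def Rb_def)
  have gneg: "g r \<le> 0" if "r \<notin> Rb" for r
  proof (cases "r \<in> R")
    case True
    then show ?thesis using that circ_sgn[OF R(1), of r]
      by (cases b) (auto simp: g_def s_def Rb_def less_imp_le)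
  qed (simp add: g_def circ_def)
  \<comment> \<open>The largest multiple of the circuit that can be subtracted without making a
    coefficient negative; it kills the coefficient at \<open>r0\<close>.\<close>
  define e where "e = Min ((\<lambda>r. a r / g r) ` Rb)"
  have "e \<in> (\<lambda>r. a r / g r) ` Rb" unfolding e_def using Rb by (intro Min_in) auto
  then obtain r0 where r0: "r0 \<in> Rb" "e = a r0 / g r0" by blast
  have emin: "e \<le> a r / g r" if "r \<in> Rb" for r unfolding e_def using Rb that by (intro Min_le) auto
  have an: "a r \<ge> 0" for r using a by (simp add: nonneg_def)
  have e0: "e \<ge> 0" using r0 an[of r0] gpos[of r0] by (simp add: less_imp_le)
  define a' where "a' i = a i + (- e * s) * circ R i" for i
  have a'g: "a' i = a i - e * g i" for i by (simp add: a'_def g_def)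
  have "a' i \<ge> 0" for i
  proof (cases "i \<in> Rb")
    case True
    then have "e * g i \<le> a i" using emin[OF True] gpos[OF True] by (simp add: pos_le_divide_eq)
    then show ?thesis by (simp add: a'g)
  next
    case False
    then have "e * g i \<le> 0" using e0 gneg by (simp add: mult_nonneg_nonpos)
    then show ?thesis using an[of i] by (simp add: a'g)
  qed
  moreover have "a' r0 = 0" using r0 gpos[of r0] by (simp add: a'g)
  moreover have "a' i = 0" if "i \<notin> A \<union> R" for i
  proof -
    have "i \<notin> supp a" using a that by (auto simp: nonneg_def)
    then show ?thesis using that by (simp add: a'_def circ_def supp_def)
  qed
  ultimately have "nonneg (A \<union> R - {r0}) a'" by (auto simp: nonneg_def supp_def)
  moreover have "same_moments d a a'" unfolding a'_def
    using same_moments_add_circ[OF R] nonneg_finite[OF a] by blast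
  ultimately show ?thesis using r0 by (auto simp: Rb_def)
qed

lemma gale_covers:
  assumes "finite R" "card R = d + 2" "nonneg R a"
  obtains F a' where "F \<in> gale b R d" "nonneg F a'" "same_moments d a a'"
proof -
  obtain r a' where "r\<in>R" "even (above R r) = b" "nonneg (R \<union> R - {r}) a'" "same_moments d a a'"
    using circuit_reduce[OF assms(1,2,3,1)] by blast
  then show ?thesis using that[of "R - {r}" a'] gale_minimal[OF assms(1,2)] by auto
qed

text \<open>As long as more than \<open>d + 1\<close> labels carry weight, the support contains a
  circuit along which one of them can be eliminated.\<close>

lemma caratheodory_moment:
  assumes "finite V" "card V \<ge> Suc d" "nonneg V a"
  shows "\<exists>S b. S \<subseteq> V \<and> card S = Suc d \<and> nonneg S b \<and> same_moments d a b"
  using assms(3)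
proof (induction "card (supp a)" arbitrary: a rule: less_induct)
  case less
  have sV: "supp a \<subseteq> V" and fin: "finite (supp a)" using less.prems assms(1)
    by (auto simp: nonneg_def finite_subset)
  show ?case
  proof (cases "card (supp a) \<le> Suc d")
    case True
    obtain S where "supp a \<subseteq> S" "S \<subseteq> V" "card S = Suc d"
      using exists_subset_between[OF True assms(2) sV assms(1)] by blast
    then show ?thesis using nonneg_mono[OF nonneg_supp[OF less.prems]]
      by (intro exI[of _ S] exI[of _ a]) auto
  next
    case False
    then obtain R where R: "R \<subseteq> supp a" "card R = d + 2" "finite R"
      using obtain_subset_with_card_n[of "d+2" "supp a"] by auto
    obtain r a' where r: "r \<in> R" "nonneg (supp a \<union> R - {r}) a'" "same_moments d a a'"
      using circuit_reduce[OF R(3,2) nonneg_supp[OF less.prems] fin] by blast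
    have "supp a' \<subseteq> supp a - {r}" using r(2) R(1) by (auto simp: nonneg_def)
    then have "card (supp a') < card (supp a)"
      using r(1) R(1) fin by (intro psubset_card_mono) auto
    moreover have "nonneg V a'" using r(2) R(1) sV by (auto intro: nonneg_mono)
    ultimately obtain S b where "S \<subseteq> V \<and> card S = Suc d \<and> nonneg S b \<and> same_moments d a' b"
      using less.hyps by blast
    then show ?thesis using r(3) same_moments_trans by blast
  qed
qed

text \<open>Reading a set from the top, with an even gap as 0, an element as 1 and an odd gap as 2, gives
  a number that increases from a lower to an upper facet of any set of labels.\<close>

definition gap_digit :: "nat set \<Rightarrow> nat \<Rightarrow> nat" where
  "gap_digit S i = (if i \<in> S then 1 else if even (above S i) then 0 else 2)"

definition simplex_key :: "nat \<Rightarrow> nat set \<Rightarrow> nat" where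
  "simplex_key n S = (\<Sum>i\<le>n. gap_digit S i * 3 ^ i)"

lemma base3_bound: "(\<And>i. f i \<le> 2) \<Longrightarrow> (\<Sum>i<m. f i * 3 ^ i) < (3::nat) ^ m"
proof (induction m)
  case (Suc m)
  have "f m * 3 ^ m \<le> 2 * 3 ^ m" using Suc.prems by (intro mult_right_mono) auto
  moreover have "(\<Sum>i<m. f i * 3 ^ i) < 3 ^ m" using Suc by blast
  ultimately show ?case unfolding sum.lessThan_Suc power_Suc by linarith
qed simp

lemma base3_less:
  fixes f g :: "nat \<Rightarrow> nat"
  assumes "\<And>i. f i \<le> 2" "m \<le> n" "f m < g m" "\<And>i. m < i \<Longrightarrow> i \<le> n \<Longrightarrow> f i = g i"
  shows "(\<Sum>i\<le>n. f i * 3 ^ i) < (\<Sum>i\<le>n. g i * 3 ^ i)"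
proof -
  have sp: "{..n} = {..<m} \<union> ({m} \<union> {m<..n})" using assms(2) by auto
  have split: "(\<Sum>i\<le>n. h i * 3 ^ i) =
    (\<Sum>i<m. h i * 3 ^ i) + (h m * 3 ^ m + (\<Sum>i\<in>{m<..n}. h i * 3 ^ i))"
    for h :: "nat \<Rightarrow> nat"
    unfolding sp by (subst sum.union_disjoint; force)+
  have "(\<Sum>i\<in>{m<..n}. f i * 3 ^ i) = (\<Sum>i\<in>{m<..n}. g i * 3 ^ i)"
    using assms(4) by (intro sum.cong) auto
  moreover have "(\<Sum>i<m. f i * 3 ^ i) < 3 ^ m" using base3_bound assms(1) by blast
  moreover have "f m * 3 ^ m + 3 ^ m \<le> g m * 3 ^ m"
  proof -
    have "(f m + 1) * 3 ^ m \<le> g m * 3 ^ m" using assms(3) by (intro mult_right_mono) auto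
    then show ?thesis by simp
  qed
  ultimately show ?thesis unfolding split by linarith
qed

text \<open>At the larger of \<open>u\<close> and \<open>v\<close>, one facet has digit 1 and the
  other the gap digit 0 or 2 fixed by the parity. Above it the digits agree, because removing a
  label changes no count at or above that label.\<close>

lemma simplex_key_less:
  assumes R: "finite R" "R \<subseteq> {..n}" "u \<in> R" "v \<in> R" and p: "odd (above R u)" "even (above R v)"
  shows "simplex_key n (R - {v}) < simplex_key n (R - {u})"
proof -
  have d2: "gap_digit S i \<le> 2" for S i by (simp add: gap_digit_def)
  have uv: "u \<noteq> v" using p by auto
  have ab: "above (R - {w}) i = above R i" if "w \<le> i" "w \<in> R" for w i
    using above_remove[OF R(1) that(2)] that by simp
  show ?thesis
  proof (cases "u < v")
    case True
    have "gap_digit (R - {v}) v = 0" using p by (simp add: gap_digit_def)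
    moreover have "gap_digit (R - {u}) v = 1" using R uv by (simp add: gap_digit_def)
    moreover have "gap_digit (R - {v}) i = gap_digit (R - {u}) i" if "v < i" for i
      using that True ab[of v i] ab[of u i] R by (auto simp: gap_digit_def)
    ultimately show ?thesis unfolding simplex_key_def
      using R by (intro base3_less[of _ v]) (auto simp: d2)
  next
    case False
    then have vu: "v < u" using uv by simp
    have "gap_digit (R - {u}) u = 2" using p by (simp add: gap_digit_def)
    moreover have "gap_digit (R - {v}) u = 1" using R uv by (simp add: gap_digit_def)
    moreover have "gap_digit (R - {v}) i = gap_digit (R - {u}) i" if "u < i" for i
      using that vu ab[of v i] ab[of u i] R by (auto simp: gap_digit_def)
    ultimately show ?thesis unfolding simplex_key_def
      using R by (intro base3_less[of _ u]) (auto simp: d2)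
  qed
qed

text \<open>The monic polynomial \<open>vanish_poly F\<close> is non-negative on \<open>V\<close>,
  so on a circuit with \<open>F\<close> at the even positions every term of its moment is at most 0.
  Yet that moment is the leading coefficient 1.\<close>

lemma gale_not_over:
  assumes "F \<in> gale True V d" "S \<subseteq> V" "finite V"
  shows "\<not> over d F S"
proof
  assume "over d F S"
  then obtain Z where Z: "finite Z" "card Z = d + 2"
    "\<And>z. z \<in> Z \<Longrightarrow> if even (above Z z) then z \<in> F else z \<in> S" by (auto simp: over_def)
  have F: "finite F" "card F = Suc d" using assms by (auto simp: gale_def finite_subset)
  have "circ Z z * poly (vanish_poly F) (real z) \<le> 0" if z: "z \<in> Z" for z
  proof (cases "z \<in> F")
    case True
    then show ?thesis using F by (simp add: vanish_poly_zero)
  next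
    case False
    then have "odd (above Z z)" "z \<in> V" using Z(3)[OF z] assms by (auto split: if_splits)
    then have "circ Z z < 0" "poly (vanish_poly F) (real z) > 0"
      using circ_sgn[OF Z(1) z] vanish_poly_nonneg_iff[OF F(1) False] assms(1) False
        by (auto simp: gale_def)
    then show ?thesis by (simp add: mult_neg_pos less_imp_le)
  qed
  then have "moment_ev (circ Z) (vanish_poly F) \<le> 0"
    by (simp add: moment_ev_def supp_circ[OF Z(1)] sum_nonpos)
  moreover have "moment_ev (circ Z) (vanish_poly F) = 1"
    using moment_ev_circ[of Z "Suc d" "vanish_poly F"] Z vanish_poly_props(2,3)[OF F(1)] F(2)
      by simp
  ultimately show False by simp
qed

lemma gale_not_under:
  assumes "F \<in> gale False V d" "S \<subseteq> V" "finite V"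
  shows "\<not> over d S F"
proof
  assume "over d S F"
  then obtain Z where Z: "finite Z" "card Z = d + 2"
    "\<And>z. z \<in> Z \<Longrightarrow> if even (above Z z) then z \<in> S else z \<in> F" by (auto simp: over_def)
  have F: "finite F" "card F = Suc d" using assms by (auto simp: gale_def finite_subset)
  have "circ Z z * poly (vanish_poly F) (real z) \<le> 0" if z: "z \<in> Z" for z
  proof (cases "z \<in> F")
    case True
    then show ?thesis using F by (simp add: vanish_poly_zero)
  next
    case False
    then have "even (above Z z)" "z \<in> V" using Z(3)[OF z] assms by (auto split: if_splits)
    then have "circ Z z > 0" "poly (vanish_poly F) (real z) < 0"
      using circ_sgn[OF Z(1) z] vanish_poly_nonneg_iff[OF F(1) False] assms(1) False
        by (auto simp: gale_def)
    then show ?thesis by (simp add: mult_pos_neg less_imp_le)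
  qed
  then have "moment_ev (circ Z) (vanish_poly F) \<le> 0"
    by (simp add: moment_ev_def supp_circ[OF Z(1)] sum_nonpos)
  moreover have "moment_ev (circ Z) (vanish_poly F) = 1"
    using moment_ev_circ[of Z "Suc d" "vanish_poly F"] Z vanish_poly_props(2,3)[OF F(1)] F(2)
      by simp
  ultimately show False by simp
qed

text \<open>Among the simplices representing the point, take one of extreme key. A label violating
  Gale's condition would complete it to a circuit \<open>R\<close>, and moving the point into
  \<open>gale b R d\<close> would improve the key.\<close>

lemma gale_covers_all:
  assumes n: "n \<ge> Suc d" and a: "nonneg {1..n} a"
  shows "\<exists>S\<in>gale b {1..n} d. \<exists>a'. nonneg S a' \<and> same_moments d a a'"
proof -
  define C where "C = {S. S \<subseteq> {1..n} \<and> card S = Suc d \<and> (\<exists>a'. nonneg S a' \<and> same_moments d a a')}"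
  have C: "finite C" "C \<noteq> {}"
    using caratheodory_moment[of "{1..n}" d a] n a by (auto simp: C_def)
  define h :: "nat set \<Rightarrow> int"
    where "h S = (if b then int (simplex_key n S) else - int (simplex_key n S))" for S
  obtain S where S: "S \<in> C" "\<And>S'. S' \<in> C \<Longrightarrow> h S \<le> h S'"
    using C by (metis arg_min_if_finite(1) arg_min_least)
  have SC: "S \<subseteq> {1..n}" "card S = Suc d" "finite S" using S(1) by (auto simp: C_def finite_subset)
  obtain a' where a': "nonneg S a'" "same_moments d a a'" using S(1) by (auto simp: C_def)
  have "S \<in> gale b {1..n} d"
  proof (rule ccontr)
    assume "S \<notin> gale b {1..n} d"
    then have "\<exists>v\<in>{1..n} - S. even (above S v) \<noteq> b"
      using SC by (simp add: gale_def)
    then obtain v where v: "v \<in> {1..n} - S" "even (above S v) \<noteq> b" ..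
    define R where "R = insert v S"
    have R: "finite R" "card R = d + 2" "R \<subseteq> {1..n}" "S = R - {v}" "v \<in> R" using v SC
      by (auto simp: R_def)
    have pv: "even (above R v) \<noteq> b" using v(2) by (simp add: R_def)
    have "nonneg R a'" using a'(1) R(4) by (auto intro: nonneg_mono)
    then obtain F a'' where F: "F \<in> gale b R d" "nonneg F a''" "same_moments d a' a''"
      using gale_covers[OF R(1,2)] by blast
    then obtain r where r: "r \<in> R" "F = R - {r}" "even (above R r) = b"
      using gale_minimal[OF R(1,2)] by blast
    have "F \<in> C" using F r R a' by (auto simp: C_def gale_def intro: same_moments_trans)
    then have "h S \<le> h F" by (rule S(2))
    moreover have "h F < h S"
      using simplex_key_less[of R n v r] simplex_key_less[of R n r v] R r pv order_trans[OF R(3), of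
        "{..n}"] by (cases b) (auto simp: h_def)
    ultimately show False by simp
  qed
  then show ?thesis using a' by blast
qed

lemma triang_gale:
  assumes "n \<ge> Suc d"
  shows "triang n d (gale b {1..n} d)"
  unfolding triang_def covers_def
proof (intro conjI)
  show "\<forall>S\<in>gale b {1..n} d. S \<subseteq> {1..n} \<and> card S = Suc d" by (auto simp: gale_def)
  show "\<forall>S\<in>gale b {1..n} d. \<forall>S'\<in>gale b {1..n} d. \<not> over d S S'"
  proof (intro ballI)
    fix S S' assume "S \<in> gale b {1..n} d" "S' \<in> gale b {1..n} d"
    then show "\<not> over d S S'"
      using gale_not_over[of S "{1..n}" d S'] gale_not_under[of S' "{1..n}" d S]
      by (cases b) (auto simp: gale_def)
  qed
  show "\<forall>a. nonneg {1..n} a \<longrightarrow> (\<exists>S\<in>gale b {1..n} d. \<exists>ba. nonneg S ba \<and> same_moments d a ba)"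
    using gale_covers_all[OF assms] by blast
qed

section \<open>Comparison of triangulations by height\<close>

lemma below_height:
  assumes "below d M M'" "S \<in> M" "S' \<in> M'" "nonneg S a" "nonneg S' b" "finite S" "finite S'" "same_moments d a b"
  shows "moment_ev a (monom 1 (Suc d)) \<le> moment_ev b (monom 1 (Suc d))"
  using over_of_height[OF assms(4-8)] assms(1-3) by (force simp: below_def)

lemma over_circuit:
  assumes "over d S S'"
  obtains a b where "nonneg S a" "nonneg S' b" "same_moments d a b" "moment_ev b (monom 1 (Suc d)) < moment_ev a (monom 1 (Suc d))"
proof -
  obtain Z where Z: "finite Z" "card Z = d + 2"
    "\<And>z. z \<in> Z \<Longrightarrow> if even (above Z z) then z \<in> S else z \<in> S'" using assms by (auto simp: over_def)
  have "nonneg S (circ_pos Z)"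
    by (rule nonneg_mono[OF circ_halves(1)[OF Z(1)]]) (use Z(3) in \<open>auto split: if_splits\<close>)
  moreover have "nonneg S' (circ_neg Z)"
    by (rule nonneg_mono[OF circ_halves(2)[OF Z(1)]]) (use Z(3) in \<open>auto split: if_splits\<close>)
  ultimately show ?thesis using that circuit_halves[OF Z(1,2)] by simp
qed

text \<open>The point where \<open>S\<close> and \<open>S''\<close> cross is located in a simplex of
  \<open>M'\<close>, where its height lies between the other two. This is where coverage by the
  middle triangulation enters.\<close>

lemma below_trans:
  assumes M: "triang n d M" "triang n d M'" "triang n d M''" and "below d M M'" "below d M' M''"
  shows "below d M M''"
  unfolding below_def
proof (intro ballI notI)
  fix S S'' assume S: "S \<in> M" "S'' \<in> M''" and "over d S S''"
  then obtain a c
    where ac: "nonneg S a" "nonneg S'' c" "same_moments d a c" "moment_ev c (monom 1 (Suc d)) < moment_ev a (monom 1 (Suc d))"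
    using over_circuit by blast
  have "nonneg {1..n} a" using ac(1) triD(1)[OF M(1) S(1)] by (rule nonneg_mono)
  then obtain S' b where b: "S' \<in> M'" "nonneg S' b" "same_moments d a b" using triang_cover[OF M(2)]
    by blast
  have "moment_ev a (monom 1 (Suc d)) \<le> moment_ev b (monom 1 (Suc d))"
    using below_height[OF assms(4) S(1) b(1) ac(1) b(2)] triD(3) M S b by blast
  moreover have "moment_ev b (monom 1 (Suc d)) \<le> moment_ev c (monom 1 (Suc d))"
    using below_height[OF assms(5) b(1) S(2) b(2) ac(2)] triD(3) M S b ac(3) same_moments_trans same_moments_sym by blast
  ultimately show False using ac(4) by linarith
qed

text \<open>The barycentre of \<open>S\<close> lies in some simplex of \<open>M\<close>. As nothing
  crosses \<open>S\<close>, the two representations coincide, so that simplex contains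
  \<open>S\<close> and equals it by cardinality.\<close>

lemma triang_superset_simplex:
  assumes M: "triang n d M" and S: "S \<subseteq> {1..n}" "card S = Suc d"
    and nc: "\<And>S'. S' \<in> M \<Longrightarrow> \<not> over d S S'" "\<And>S'. S' \<in> M \<Longrightarrow> \<not> over d S' S"
  shows "S \<in> M"
proof -
  have fS: "finite S" using S by (auto intro: finite_subset)
  have "nonneg {1..n} (indic S)" using nonneg_indic S(1) by (rule nonneg_mono)
  then obtain S' b where b: "S' \<in> M" "nonneg S' b" "same_moments d (indic S) b"
    using triang_cover[OF M] by blast
  have "indic S = b"
    using noncross_eq[OF nonneg_indic b(2) fS triD(3)[OF M b(1)] b(3)] nc b(1) by blast
  then have "S \<subseteq> S'" using b(2) by (auto simp: nonneg_def dest: arg_cong[of _ _ supp])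
  then have "S = S'" using card_subset_eq triD[OF M b(1)] S(2) by metis
  then show ?thesis using b(1) by simp
qed

lemma below_antisym:
  assumes M: "triang n d M" "triang n d M'" and "below d M M'" "below d M' M"
  shows "M = M'"
proof -
  have "S \<in> M'" if "S \<in> M" for S
    using triang_superset_simplex[OF M(2)] triD[OF M(1) that] assms(3,4) that
      by (auto simp: below_def)
  moreover have "S \<in> M" if "S \<in> M'" for S
    using triang_superset_simplex[OF M(1)] triD[OF M(2) that] assms(3,4) that
      by (auto simp: below_def)
  ultimately show ?thesis by blast
qed

text \<open>Inclusion makes the two triangulations comparable in both directions.\<close>

lemma triang_subset_eq:
  assumes M: "triang n d M" "triang n d M'" and "M \<subseteq> M'"
  shows "M = M'"
  using below_antisym[OF M] triang_noncross[OF M(2)] assms(3) by (auto simp: below_def subset_iff)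

text \<open>Moving from a point in the relative interior of \<open>F\<close> towards \<open>v\<close>, some simplex is met at
  arbitrarily small times; it contains the starting point, hence \<open>F\<close>.\<close>

lemma grow:
  assumes T: "finite T" "\<And>S. S \<in> T \<Longrightarrow> finite S \<and> card S \<le> Suc d"
      "\<And>S S'. S \<in> T \<Longrightarrow> S' \<in> T \<Longrightarrow> \<not> over d S S'" and cov: "covers n d T"
    and F: "S0 \<in> T" "F \<subseteq> S0" "F \<subseteq> {1..n}" "v \<in> {1..n}"
  shows "\<exists>S\<in>T. F \<subseteq> S \<and> (\<exists>t>0. \<exists>b. nonneg S b \<and> same_moments d (\<lambda>i. indic F i + t * indic {v} i) b)"
proof -
  define P where "P S t \<longleftrightarrow> (\<exists>b. nonneg S b \<and> same_moments d (\<lambda>i. indic F i + t * indic {v} i) b)"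
    for S t
  have ex: "\<exists>S\<in>T. P S t" if "t > 0" for t
  proof -
    have "nonneg {1..n} (\<lambda>i. indic F i + t * indic {v} i)" using F that
      by (auto simp: nonneg_def supp_def indic_def)
    then show ?thesis using cov unfolding covers_def P_def by blast
  qed
  have "\<exists>S\<in>T. \<forall>\<epsilon>>0. \<exists>t>0. t < \<epsilon> \<and> P S t"
  proof (rule ccontr)
    assume "\<not> ?thesis"
    then have "\<forall>S\<in>T. \<exists>\<epsilon>>0. \<forall>t>0. t < \<epsilon> \<longrightarrow> \<not> P S t" by blast
    then obtain eps where eps: "\<And>S. S \<in> T \<Longrightarrow> eps S > 0 \<and> (\<forall>t>0. t < eps S \<longrightarrow> \<not> P S t)" by metis
    define m where "m = Min (eps ` T)"
    have "T \<noteq> {}" using F by auto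
    then have m: "m > 0" "\<And>S. S \<in> T \<Longrightarrow> m \<le> eps S" using T(1) eps by (auto simp: m_def)
    obtain S where "S \<in> T" "P S (m/2)" using ex[of "m/2"] m by auto
    then show False using eps[of S] m(1) m(2)[of S] by force
  qed
  then obtain S where S: "S \<in> T" "\<And>\<epsilon>. \<epsilon> > 0 \<Longrightarrow> \<exists>t>0. t < \<epsilon> \<and> P S t" by blast
  have fF: "finite F" using F(3) finite_subset by blast
  obtain b where b: "nonneg S b" "same_moments d (indic F) b"
    using cone_limit[of S d "indic F" "indic {v}"] T(2)[OF S(1)] S(2) fF unfolding P_def by auto
  have "indic F = b"
    using noncross_eq[OF nonneg_indic b(1) fF _ b(2)] T(2,3) S(1) F(1,2) over_mono by blast
  then have "F \<subseteq> S" using b(1) by (auto simp: nonneg_def dest: arg_cong[of _ _ supp])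
  then show ?thesis using S(1) S(2)[of 1] unfolding P_def by auto
qed

text \<open>Moving from \<open>F\<close> towards \<open>v\<close> leads into a simplex
  \<open>insert s F\<close>. Since \<open>vanish_poly F\<close> is zero on \<open>F\<close>,
  comparing its values shows that \<open>s\<close> and \<open>v\<close> lie on the same side of the
  hyperplane through \<open>F\<close>, and the parity of \<open>above F\<close> tells the
  side.\<close>

lemma neighbour:
  assumes M: "triang n d M" and F: "S0 \<in> M" "F \<subseteq> S0" "card F = d" and v: "v \<in> {1..n} - F"
  obtains s where "s \<in> {1..n} - F" "insert s F \<in> M" "even (above F s) = even (above F v)"
proof -
  have Fn: "F \<subseteq> {1..n}" "finite F" using F triD[OF M F(1)] finite_subset by blast+
  have "\<exists>S\<in>M. F \<subseteq> S \<and> (\<exists>t>0. \<exists>b. nonneg S b \<and> same_moments d (\<lambda>i. indic F i + t * indic {v} i) b)"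
    using grow[OF triang_finite[OF M], of d n S0 F v] M F Fn v triD[OF M] triang_noncross[OF M]
    by (auto simp: triang_def)
  then obtain S t b
    where S: "S \<in> M" "F \<subseteq> S" "t > 0" "nonneg S b" "same_moments d (\<lambda>i. indic F i + t * indic {v} i) b"
    by blast
  have "card (S - F) = 1" using triD[OF M S(1)] S(2) F(3) Fn by (simp add: card_Diff_subset)
  then obtain s where s: "S - F = {s}" using card_1_singletonE by blast
  then have Ss: "S = insert s F" "s \<notin> F" using S(2) by auto
  have sn: "s \<in> {1..n}" using Ss triD[OF M S(1)] by auto
  define p where "p = vanish_poly F"
  have dp: "degree p \<le> d" using vanish_poly_props[OF Fn(2)] F(3) by (simp add: p_def)
  have fs: "finite (supp (indic F))" "finite (supp (indic {v}))" using Fn by auto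
  have z: "moment_ev (indic F) p = 0" using Fn by (simp add: moment_ev_def p_def vanish_poly_zero)
  have "moment_ev (\<lambda>i. indic F i + t * indic {v} i) p = t * poly p (real v)"
    unfolding moment_ev_add_scaled[OF fs] z by (simp add: moment_ev_def indic_def)
  moreover have "moment_ev b p = b s * poly p (real s)"
  proof -
    have "moment_ev b p = (\<Sum>i\<in>insert s F. b i * poly p (real i))"
      using S(4) Ss Fn by (intro moment_ev_superset) (auto simp: nonneg_def)
    also have "\<dots> = b s * poly p (real s)" using Ss Fn by (simp add: p_def vanish_poly_zero)
    finally show ?thesis .
  qed
  ultimately have eq: "t * poly p (real v) = b s * poly p (real s)" using S(5) dp
    by (simp add: same_moments_def)
  have bs: "b s \<ge> 0" using S(4) by (simp add: nonneg_def)
  have "even (above F s) = even (above F v)"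
  proof (cases "even (above F v)")
    case True
    then have "t * poly p (real v) > 0" using vanish_poly_nonneg_iff[OF Fn(2), of v] v S(3)
      by (simp add: p_def)
    then have "poly p (real s) > 0" using eq bs by (metis zero_less_mult_pos less_le mult_zero_left)
    then show ?thesis using True vanish_poly_nonneg_iff[OF Fn(2) Ss(2)] by (simp add: p_def)
  next
    case False
    then have "t * poly p (real v) < 0" using vanish_poly_nonneg_iff[OF Fn(2), of v] v S(3)
      by (simp add: p_def mult_pos_neg)
    then have "poly p (real s) < 0" using eq bs by (metis mult_nonneg_nonneg not_less)
    then show ?thesis using False vanish_poly_nonneg_iff[OF Fn(2) Ss(2)] by (simp add: p_def)
  qed
  then show ?thesis using that[of s] Ss sn S(1) by auto
qed

subsection \<open>Flips\<close>

text \<open>\<open>b = True\<close> replaces lower by upper facets.\<close>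

definition flip :: "bool \<Rightarrow> nat \<Rightarrow> nat set \<Rightarrow> nat set set \<Rightarrow> nat set set" where
  "flip b d R M = (M - gale b R d) \<union> gale (\<not> b) R d"

text \<open>The half of \<open>Z\<close> in \<open>U\<close> represents a point of the simplex on
  \<open>R\<close>, which also lies in some facet in \<open>gale b R d\<close> and hence in
  \<open>M\<close>. Uniqueness of representations in \<open>M\<close> forces the other half into
  \<open>R\<close> as well, so \<open>Z = R\<close>. The label missing in \<open>U\<close> has to
  belong to the half in \<open>S\<close>, which determines \<open>c\<close>.\<close>

lemma flip_cross:
  assumes M: "triang n d M" and R: "R \<subseteq> {1..n}" "card R = d + 2" "gale b R d \<subseteq> M"
    and S: "S \<in> M" and U: "U \<in> gale (\<not> b) R d" and Z: "finite Z" "card Z = d + 2"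
    and ZS: "\<And>z. z \<in> Z \<Longrightarrow> even (above Z z) = c \<Longrightarrow> z \<in> S"
    and ZU: "\<And>z. z \<in> Z \<Longrightarrow> even (above Z z) \<noteq> c \<Longrightarrow> z \<in> U"
  shows "Z = R" "c = (\<not> b)"
proof -
  have fR: "finite R" using R(1) finite_subset by blast
  define a where "a = (if c then circ_pos Z else circ_neg Z)"
  define e where "e = (if c then circ_neg Z else circ_pos Z)"
  have ae: "same_moments d a e" using circuit_halves(1)[OF Z] same_moments_sym
    by (auto simp: a_def e_def)
  have sa: "supp a = {z\<in>Z. even (above Z z) = c}" and "nonneg {z\<in>Z. even (above Z z) = c} a"
    using circ_halves[OF Z(1)] by (auto simp: a_def)
  then have na: "nonneg S a" using ZS by (auto intro: nonneg_mono)
  have "nonneg {z\<in>Z. even (above Z z) \<noteq> c} e" using circ_halves[OF Z(1)] by (auto simp: e_def)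
  moreover have "U \<subseteq> R" using U by (auto simp: gale_def)
  ultimately have "nonneg R e" using ZU by (auto intro: nonneg_mono)
  then obtain F e' where F: "F \<in> gale b R d" "nonneg F e'" "same_moments d e e'"
    using gale_covers[OF fR R(2)] by blast
  have "a = e'" using triang_eq[OF M S _ na F(2)] F R(3) ae same_moments_trans by blast
  then have "supp a \<subseteq> R" using F by (auto simp: nonneg_def gale_def)
  then have "Z \<subseteq> R" using sa ZU \<open>U \<subseteq> R\<close> by blast
  then show ZR: "Z = R" using card_subset_eq fR R(2) Z(2) by metis
  obtain u where u: "u \<in> R" "U = R - {u}" "even (above R u) = (\<not> b)"
    using U gale_minimal[OF fR R(2)] by blast
  show "c = (\<not> b)" using ZU[of u] u ZR by auto
qed

text \<open>The simplices in \<open>gale b R d\<close> fill a neighbourhood of any point in the relative interior of their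
  common face, so no other simplex of the triangulation contains that face.\<close>

lemma flip_star:
  assumes M: "triang n d M" and R: "R \<subseteq> {1..n}" "card R = d + 2" "gale b R d \<subseteq> M"
    and S: "S \<in> M" and c: "\<And>r. r \<in> R \<Longrightarrow> even (above R r) = (\<not> b) \<Longrightarrow> r \<in> S"
  shows "S \<in> gale b R d"
proof -
  have fR: "finite R" using R(1) finite_subset by blast
  define a where "a = (if b then circ_neg R else circ_pos R)"
  define e where "e = (if b then circ_pos R else circ_neg R)"
  have ae: "same_moments d e a" using circuit_halves(1)[OF fR R(2)] same_moments_sym
    by (auto simp: a_def e_def)
  have aS: "nonneg S a" using circ_halves(1,2)[OF fR] c by (auto simp: a_def intro: nonneg_mono)
  have fin: "finite (supp a)" "finite (supp e)" using circ_halves(3,4)[OF fR] fR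
    by (auto simp: a_def e_def)
  have abs: "a i + e i = \<bar>circ R i\<bar>" for i by (auto simp: a_def e_def circ_pos_def circ_neg_def)
  obtain r0 where r0: "r0 \<in> R" using R(2)
    by (metis card.empty add_2_eq_Suc' nat.distinct(1) equals0I)
  define g where "g s = (if s \<in> R - {r0} then moment_ev (indic S) (lag (R - {r0}) s) else 0)" for s
  have gS: "same_moments d (indic S) g" unfolding g_def
    using basis_coords[of "R - {r0}" d] fR R(2) r0 by simp
  have fg: "finite (supp g)" by (rule finite_subset[OF _ fR]) (auto simp: supp_def g_def)
  define m where "m = Min ((\<lambda>r. \<bar>circ R r\<bar>) ` R)"
  define B where "B = (\<Sum>r\<in>R. \<bar>g r\<bar>) + 1"
  have lnz: "\<bar>circ R r\<bar> > 0" if "r \<in> R" for r using supp_circ[OF fR] that by (auto simp: supp_def)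
  have m: "m > 0" "\<And>r. r \<in> R \<Longrightarrow> m \<le> \<bar>circ R r\<bar>"
  proof -
    show "m > 0" unfolding m_def using fR lnz r0 by (subst Min_gr_iff) auto
    show "m \<le> \<bar>circ R r\<bar>" if "r \<in> R" for r using fR that by (simp add: m_def)
  qed
  have B: "B > 0" "\<And>r. r \<in> R \<Longrightarrow> \<bar>g r\<bar> \<le> B"
  proof -
    have "(\<Sum>r\<in>R. \<bar>g r\<bar>) \<ge> 0" by (simp add: sum_nonneg)
    then show "B > 0" unfolding B_def by linarith
    show "\<bar>g r\<bar> \<le> B" if "r \<in> R" for r
      using member_le_sum[of r R "\<lambda>r. \<bar>g r\<bar>"] fR that by (simp add: B_def)
  qed
  \<comment> \<open>\<open>m\<close> bounds the circuit from below and \<open>B\<close> bounds the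
    coordinates \<open>g\<close> of \<open>indic S\<close> from above, so this step keeps
    \<open>w\<close> non-negative.\<close>
  define t where "t = m / B"
  have t: "t > 0" using m B by (simp add: t_def)
  define w where "w i = \<bar>circ R i\<bar> + t * g i" for i
  have "w i \<ge> 0" for i
  proof (cases "i \<in> R")
    case True
    have "t * \<bar>g i\<bar> \<le> t * B" using B(2)[OF True] t by simp
    also have "\<dots> = m" using B by (simp add: t_def)
    also have "\<dots> \<le> \<bar>circ R i\<bar>" using m True by simp
    finally have "\<bar>t * g i\<bar> \<le> \<bar>circ R i\<bar>" using t by (simp add: abs_mult)
    then show ?thesis by (simp add: w_def)
  qed (simp add: w_def circ_def g_def)
  then have wR: "nonneg R w"
    by (auto simp: nonneg_def supp_def w_def circ_def g_def split: if_splits)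
  \<comment> \<open>The point of \<open>w\<close>, represented on \<open>S\<close>: the halves
    \<open>a\<close> and \<open>e\<close> represent the same point, so their sum, the absolute value
    of the circuit, may be replaced by \<open>2 * a\<close>. The support is all of \<open>S\<close>,
    which forces \<open>S\<close> into the facet that receives \<open>w\<close>.\<close>
  define x where "x i = 2 * a i + t * indic S i" for i
  have fS: "finite S" using triD[OF M S] by simp
  have xS: "nonneg S x" "supp x = S"
  proof -
    have "a i \<ge> 0" for i using aS by (simp add: nonneg_def)
    moreover have "a i = 0" if "i \<notin> S" for i using aS that by (auto simp: nonneg_def supp_def)
    ultimately show "nonneg S x" "supp x = S" using t
      by (auto simp: nonneg_def supp_def x_def indic_def add_nonneg_eq_0_iff split: if_splits)
  qed
  have "same_moments d x w"
    unfolding same_moments_def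
  proof (intro allI impI)
    fix q :: "real poly" assume q: "degree q \<le> d"
    have "w = (\<lambda>i. 1 * (1 * a i + 1 * e i) + t * g i)" by (simp add: w_def abs fun_eq_iff)
    then have "moment_ev w q = 1 * moment_ev (\<lambda>i. 1 * a i + 1 * e i) q + t * moment_ev g q"
      using moment_ev_linear(1)[OF moment_ev_linear(2)[OF fin, of 1 1] fg, of 1 t] by simp
    then have "moment_ev w q = moment_ev a q + moment_ev e q + t * moment_ev g q"

      using moment_ev_linear(1)[OF fin, of 1 1] by simp
    also have "moment_ev e q = moment_ev a q" using ae q by (simp add: same_moments_def)
    also have "moment_ev g q = moment_ev (indic S) q" using gS q by (simp add: same_moments_def)
    finally have "moment_ev w q = 2 * moment_ev a q + t * moment_ev (indic S) q" by simp
    also have "\<dots> = moment_ev x q" unfolding x_def using moment_ev_linear(1)[of a "indic S"] fin fS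
      by simp
    finally show "moment_ev x q = moment_ev w q" by simp
  qed
  moreover obtain F w' where F: "F \<in> gale b R d" "nonneg F w'" "same_moments d w w'"
    using gale_covers[OF fR R(2) wR] by blast
  ultimately have "x = w'" using triang_eq[OF M S _ xS(1) F(2)] R(3) same_moments_trans by blast
  then have "S \<subseteq> F" using F(2) xS by (auto simp: nonneg_def)
  then have "S = F" using card_subset_eq triD[OF M] S F(1) R(3) by (metis subsetD)
  then show ?thesis using F by simp
qed

text \<open>By \<open>flip_cross\<close>, a crossing of a kept and a new simplex uses all of
  \<open>R\<close> and puts the common face of the removed facets into the kept simplex;
  \<open>flip_star\<close> then says that it was removed. Coverage survives because either set of
  facets covers the simplex on \<open>R\<close>.\<close>

lemma triang_flip:
  assumes M: "triang n d M" and R: "R \<subseteq> {1..n}" "card R = d + 2" "gale b R d \<subseteq> M"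
  shows "triang n d (flip b d R M)"
  unfolding triang_def covers_def
proof (intro conjI allI impI ballI)
  have fR: "finite R" using R(1) finite_subset by blast
  show "S \<subseteq> {1..n}" "card S = Suc d" if "S \<in> flip b d R M" for S
    using that triD[OF M] R(1) by (auto simp: flip_def gale_def)
  have sep: False if "S \<in> M - gale b R d" "U \<in> gale (\<not> b) R d" "finite Z" "card Z = d + 2"
    "\<And>z. z \<in> Z \<Longrightarrow> even (above Z z) = c \<Longrightarrow> z \<in> S"
    "\<And>z. z \<in> Z \<Longrightarrow> even (above Z z) \<noteq> c \<Longrightarrow> z \<in> U" for S U Z c
  proof -
    have "Z = R" "c = (\<not> b)" using flip_cross[OF M R _ that(2-6)] that(1) by auto
    then have "S \<in> gale b R d" using flip_star[OF M R] that(1,5) by blast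
    then show False using that(1) by simp
  qed
  show "\<not> over d S S'" if S: "S \<in> flip b d R M" "S' \<in> flip b d R M" for S S'
  proof
    assume "over d S S'"
    then obtain Z where Z: "finite Z" "card Z = d + 2"
      "\<And>z. z \<in> Z \<Longrightarrow> if even (above Z z) then z \<in> S else z \<in> S'" by (auto simp: over_def)
    consider "S \<in> M" "S' \<in> M" | "S \<in> M - gale b R d" "S' \<in> gale (\<not> b) R d"
      | "S \<in> gale (\<not> b) R d" "S' \<in> M - gale b R d" | "S \<in> gale (\<not> b) R d" "S' \<in> gale (\<not> b) R d"
      using S by (auto simp: flip_def)
    then show False
    proof cases
      case 1
      then show ?thesis using triang_noncross[OF M] \<open>over d S S'\<close> by blast
    next
      case 2
      then show ?thesis using sep[OF 2 Z(1,2), of True] Z(3) by auto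
    next
      case 3
      then show ?thesis using sep[OF 3(2,1) Z(1,2), of False] Z(3) by auto
    next
      case 4
      obtain u where u: "u \<in> R" "S = R - {u}" "even (above R u) = (\<not> b)"
        using 4 gale_minimal[OF fR R(2)] by blast
      obtain u' where u': "u' \<in> R" "S' = R - {u'}" "even (above R u') = (\<not> b)"
        using 4 gale_minimal[OF fR R(2)] by blast
      have "z \<in> R" if "z \<in> Z" for z using Z(3)[OF that] u u' by (auto split: if_splits)
      then have "Z \<subseteq> R" by blast
      then have "Z = R" using card_subset_eq fR R(2) Z(2) by metis
      then show ?thesis using Z(3)[of u] Z(3)[of u'] u u' by (auto split: if_splits)
    qed
  qed
  show "\<exists>S\<in>flip b d R M. \<exists>ba. nonneg S ba \<and> same_moments d a ba" if a: "nonneg {1..n} a" for a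
  proof -
    obtain S e where S: "S \<in> M" "nonneg S e" "same_moments d a e" using triang_cover[OF M a]
      by blast
    show ?thesis
    proof (cases "S \<in> gale b R d")
      case True
      then have "nonneg R e" using S(2) by (auto simp: gale_def intro: nonneg_mono)
      then obtain F e' where "F \<in> gale (\<not> b) R d" "nonneg F e'" "same_moments d e e'"
        using gale_covers[OF fR R(2)] by blast
      then show ?thesis using same_moments_trans[OF S(3)] by (auto simp: flip_def)
    next
      case False
      then show ?thesis using S by (auto simp: flip_def)
    qed
  qed
qed

text \<open>The circuit \<open>R\<close> itself makes an upper and a lower facet cross.\<close>

lemma gale_disjoint:
  assumes M: "triang n d M" and R: "R \<subseteq> {1..n}" "card R = d + 2" "gale b R d \<subseteq> M"
  shows "gale (\<not> b) R d \<inter> M = {}"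
proof (rule ccontr)
  have fR: "finite R" using R(1) finite_subset by blast
  assume "\<not> ?thesis"
  then obtain U where U: "U \<in> gale (\<not> b) R d" "U \<in> M" by blast
  then obtain u where u: "u \<in> R" "U = R - {u}" "even (above R u) = (\<not> b)"
    using gale_minimal[OF fR R(2)] by blast
  obtain v where v: "v \<in> R" "even (above R v) = b" using circuit_parity_ex[OF fR R(2)] by blast
  define F where "F = R - {v}"
  have "F \<in> gale b R d" using v gale_minimal[OF fR R(2)] by (auto simp: F_def)
  then have F: "F \<in> M" using R by blast
  have "over d U F \<or> over d F U"
    unfolding over_def using fR R(2) u v
    by (cases b) (auto simp: F_def intro!: exI[of _ R])
  then show False using triang_noncross[OF M] F U by blast
qed

lemma flip_flip:
  assumes M: "triang n d M" and R: "R \<subseteq> {1..n}" "card R = d + 2" "gale b R d \<subseteq> M"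
  shows "flip (\<not> b) d R (flip b d R M) = M"
  using gale_disjoint[OF M R] R(3) by (auto simp: flip_def)

text \<open>By \<open>flip_cross\<close>, an old and a new simplex can only cross along
  \<open>R\<close>, with the old one at the odd positions, that is, below.\<close>

lemma flip_below:
  assumes M: "triang n d M" and R: "R \<subseteq> {1..n}" "card R = d + 2" "gale True R d \<subseteq> M"
  shows "below d M (flip True d R M)"
  unfolding below_def
proof (intro ballI notI)
  fix S S' assume S: "S \<in> M" "S' \<in> flip True d R M" and o: "over d S S'"
  show False
  proof (cases "S' \<in> M")
    case True
    then show ?thesis using triang_noncross[OF M] S o by blast
  next
    case False
    then have U: "S' \<in> gale (\<not> True) R d" using S by (auto simp: flip_def)
    obtain Z where Z: "finite Z" "card Z = d + 2"
      "\<And>z. z \<in> Z \<Longrightarrow> if even (above Z z) then z \<in> S else z \<in> S'" using o by (auto simp: over_def)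
    show ?thesis using flip_cross(2)[OF M R S(1) U Z(1,2), of True] Z(3) by auto
  qed
qed

subsection \<open>Deletion of the last label\<close>

lemma above_image:
  assumes "strict_mono_on Z g" "z \<in> Z"
  shows "above (g ` Z) (g z) = above Z z"
proof -
  have inj: "inj_on g Z" using assms(1) strict_mono_on_imp_inj_on by blast
  have "{w \<in> g ` Z. g z < w} = g ` {w\<in>Z. z < w}"
    using assms strict_mono_on_less[OF assms(1)] by auto
  then show ?thesis unfolding above_def using inj
    by (simp add: card_image inj_on_subset)
qed

lemma over_image:
  assumes Z: "finite Z" "card Z = d + 2" and g: "strict_mono_on Z g"
    and m: "\<And>z. z \<in> Z \<Longrightarrow> if even (above Z z) then g z \<in> A else g z \<in> B"
  shows "over d A B"
proof -
  have "inj_on g Z" using g strict_mono_on_imp_inj_on by blast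
  then have "card (g ` Z) = d + 2" using Z by (simp add: card_image)
  moreover have "if even (above (g ` Z) z) then z \<in> A else z \<in> B" if "z \<in> g ` Z" for z
    using that m above_image[OF g] by auto
  ultimately show ?thesis unfolding over_def using Z(1) by blast
qed

lemma gale_image:
  assumes R: "finite R" "card R = d + 2" and g: "strict_mono_on R g"
  shows "gale b (g ` R) d = (image g) ` gale b R d"
proof -
  have inj: "inj_on g R" using g strict_mono_on_imp_inj_on by blast
  then have gR: "finite (g ` R)" "card (g ` R) = d + 2" using R by (auto simp: card_image)
  have rem: "g ` (R - {r}) = g ` R - {g r}" if "r \<in> R" for r using inj that
    by (auto simp: inj_on_def)
  show ?thesis
  proof (intro set_eqI iffI)
    fix F assume "F \<in> gale b (g ` R) d"
    then obtain r where "r \<in> R" "F = g ` R - {g r}" "even (above (g ` R) (g r)) = b"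
      using gale_minimal[OF gR] by auto
    then have "F = g ` (R - {r})" "R - {r} \<in> gale b R d"
      using rem gale_minimal[OF R] above_image[OF g] by auto
    then show "F \<in> (image g) ` gale b R d" by blast
  next
    fix F assume "F \<in> (image g) ` gale b R d"
    then obtain F' where F': "F' \<in> gale b R d" "F = g ` F'" by blast
    then obtain r where "r \<in> R" "F' = R - {r}" "even (above R r) = b"
      using gale_minimal[OF R] by blast
    then show "F \<in> gale b (g ` R) d"
      using F'(2) rem gale_minimal[OF gR] above_image[OF g] by auto
  qed
qed

definition collapse :: "nat \<Rightarrow> nat \<Rightarrow> nat" where "collapse m x = (if x = Suc m then m else x)"
definition expand :: "nat \<Rightarrow> nat \<Rightarrow> nat" where "expand m x = (if x = m then Suc m else x)"

definition has_both :: "nat \<Rightarrow> nat set \<Rightarrow> bool" where "has_both m S \<longleftrightarrow> m \<in> S \<and> Suc m \<in> S"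

text \<open>\<open>deletion m\<close> slides the label \<open>m + 1\<close> to \<open>m\<close>. Of its two extreme sections, \<open>lower_lift\<close> places
  \<open>m + 1\<close> on top of a triangulation on \<open>{1..m}\<close>, while \<open>upper_lift\<close> first renames \<open>m\<close> to \<open>m + 1\<close> and
  then places \<open>m\<close>.\<close>

definition deletion :: "nat \<Rightarrow> nat set set \<Rightarrow> nat set set" where
  "deletion m M = (image (collapse m)) ` {S\<in>M. \<not> has_both m S}"

definition lower_section :: "nat \<Rightarrow> nat set set \<Rightarrow> bool" where
  "lower_section m M \<longleftrightarrow> (\<forall>S\<in>M. Suc m \<in> S \<longrightarrow> m \<in> S)"

definition upper_section :: "nat \<Rightarrow> nat set set \<Rightarrow> bool" where
  "upper_section m M \<longleftrightarrow> (\<forall>S\<in>M. m \<in> S \<longrightarrow> Suc m \<in> S)"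

definition lower_lift :: "nat \<Rightarrow> nat \<Rightarrow> nat set set \<Rightarrow> nat set set" where
  "lower_lift m d Q = Q \<union> {S \<in> gale True {1..Suc m} d. Suc m \<in> S}"

definition upper_lift :: "nat \<Rightarrow> nat \<Rightarrow> nat set set \<Rightarrow> nat set set" where
  "upper_lift m d Q = (image (expand m)) ` Q \<union> {S \<in> gale False {1..Suc m} d. m \<in> S}"

lemma collapse_noop: "Suc m \<notin> S \<Longrightarrow> collapse m ` S = S"
  using image_cong[of S S "collapse m" id] by (auto simp: collapse_def)

lemma expand_noop: "m \<notin> S \<Longrightarrow> expand m ` S = S"
  using image_cong[of S S "expand m" id] by (auto simp: expand_def)

lemma expand_collapse: "m \<notin> S \<Longrightarrow> expand m ` collapse m ` S = S"
  using image_cong[of S S "expand m \<circ> collapse m" id]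
    by (auto simp: expand_def collapse_def image_comp)

lemma collapse_expand: "S \<subseteq> {1..m} \<Longrightarrow> collapse m ` expand m ` S = S"
  using image_cong[of S S "collapse m \<circ> expand m" id]
    by (auto simp: expand_def collapse_def image_comp)

lemma m_notin_expand: "m \<notin> expand m ` S"
  by (auto simp: expand_def)

lemma expand_subset: "S \<subseteq> {1..m} \<Longrightarrow> expand m ` S \<subseteq> {1..Suc m}"
  by (fastforce simp: expand_def)

lemma strict_mono_on_collapse:
  assumes "\<not> has_both m S"
  shows "strict_mono_on S (collapse m)"
proof (rule strict_mono_onI)
  fix r s assume "r \<in> S" "s \<in> S" "r < s"
  then show "collapse m r < collapse m s"
    using assms by (cases "s = Suc m") (auto simp: collapse_def has_both_def less_Suc_eq)
qed

lemma strict_mono_on_expand: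
  assumes "S \<subseteq> {1..m}"
  shows "strict_mono_on S (expand m)"
proof (rule strict_mono_onI)
  fix r s assume "r \<in> S" "s \<in> S" "r < s"
  moreover have "s \<le> m" using assms \<open>s \<in> S\<close> by auto
  ultimately show "expand m r < expand m s" by (auto simp: expand_def)
qed

text \<open>Only \<open>m\<close> has two preimages; the one present in the simplex required at its
  position is chosen. As no label of the sequence exceeds \<open>m\<close>, the order is
  kept.\<close>

lemma over_collapse:
  assumes "over d (collapse m ` A) (collapse m ` B)" "A \<subseteq> {1..Suc m}" "B \<subseteq> {1..Suc m}"
  shows "over d A B"
proof -
  obtain Z where Z: "finite Z" "card Z = d + 2"
    "\<And>z. z \<in> Z \<Longrightarrow> if even (above Z z) then z \<in> collapse m ` A else z \<in> collapse m ` B" using assms(1)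
      by (auto simp: over_def)
  define C where "C = (if even (above Z m) then A else B)"
  define g where "g z = (if z = m \<and> m \<notin> C then Suc m else z)" for z
  have zm: "z \<le> m" if "z \<in> Z" for z
    using Z(3)[OF that] assms(2,3) by (auto simp: collapse_def split: if_splits)
  have "strict_mono_on Z g" unfolding strict_mono_on_def g_def using zm by force
  moreover have "if even (above Z z) then g z \<in> A else g z \<in> B" if "z \<in> Z" for z
    using Z(3)[OF that] by (auto simp: g_def C_def collapse_def split: if_splits)
  ultimately show ?thesis using over_image Z(1,2) by blast
qed

lemma over_expand:
  assumes "over d (expand m ` A) (expand m ` B)" "A \<subseteq> {1..m}" "B \<subseteq> {1..m}"
  shows "over d A B"
proof -
  obtain Z where Z: "finite Z" "card Z = d + 2"
    "\<And>z. z \<in> Z \<Longrightarrow> if even (above Z z) then z \<in> expand m ` A else z \<in> expand m ` B" using assms(1)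
      by (auto simp: over_def)
  have Zs: "z \<in> expand m ` A \<or> z \<in> expand m ` B" if "z \<in> Z" for z using Z(3)[OF that]
    by (auto split: if_splits)
  have "Z \<subseteq> {1..Suc m}" "m \<notin> Z"
    using Zs expand_subset[OF assms(2)] expand_subset[OF assms(3)] m_notin_expand by blast+
  then have "strict_mono_on Z (collapse m)"
    by (intro strict_mono_on_collapse) (auto simp: has_both_def)
  moreover have "if even (above Z z) then collapse m z \<in> A else collapse m z \<in> B" if "z \<in> Z" for z
    using Z(3)[OF that] collapse_expand[OF assms(2)] collapse_expand[OF assms(3)]
      by (auto split: if_splits)
  ultimately show ?thesis using over_image Z(1,2) by blast
qed

lemma below_deletion:
  assumes "triang (Suc m) d M" "triang (Suc m) d M'" "below d M M'"
  shows "below d (deletion m M) (deletion m M')"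
  using assms over_collapse triD(1) unfolding below_def deletion_def by blast

lemma above_top:
  assumes "finite S" "S \<subseteq> {1..Suc m}"
  shows "above S (Suc m) = 0" "Suc m \<notin> S \<Longrightarrow> above S m = 0" "Suc m \<in> S \<Longrightarrow> above S m = 1"
proof -
  have le: "w \<le> Suc m" if "w \<in> S" for w using that assms(2) by auto
  show "above S (Suc m) = 0" using assms(1) le by (rule above_Max)
  show "above S m = 0" if "Suc m \<notin> S"
  proof (rule above_Max[OF assms(1)])
    fix z assume "z \<in> S"
    then show "z \<le> m" using le[of z] that by (cases "z = Suc m") auto
  qed
  assume "Suc m \<in> S"
  then have "{Suc m} \<subseteq> {w\<in>S. m < w}" by simp
  moreover have "w \<in> {Suc m}" if "w \<in> S" "m < w" for w using le[OF that(1)] that(2) by simp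
  then have "{w\<in>S. m < w} \<subseteq> {Suc m}" by blast
  ultimately have "{w\<in>S. m < w} = {Suc m}" by (rule equalityI[rotated])
  then show "above S m = 1" by (simp add: above_def)
qed

text \<open>Simplices with the same image could differ only by one having \<open>m\<close> where the
  other has \<open>m + 1\<close>. Their union would then be \<open>d + 2\<close> labels whose two
  topmost ones distinguish them, so they would cross.\<close>

lemma collapse_inj:
  assumes M: "triang (Suc m) d M"
  shows "inj_on (image (collapse m)) {S\<in>M. \<not> has_both m S}"
proof (rule inj_onI)
  have aux: False if "S \<in> M" "S' \<in> M" "\<not> has_both m S"
    "\<not> has_both m S'" "collapse m ` S = collapse m ` S'"
    "Suc m \<in> S'" "Suc m \<notin> S" for S S'
  proof -
    define R where "R = insert (Suc m) S"
    have S: "S \<subseteq> {1..Suc m}" "card S = Suc d" "finite S" using triD[OF M that(1)] by auto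
    have "m \<notin> S'" using that(4,6) by (simp add: has_both_def)
    then have "S' = expand m ` collapse m ` S'" using expand_collapse by simp
    also have "\<dots> = expand m ` S" using that(5) collapse_noop[OF that(7)] by simp
    finally have S': "S' = expand m ` S" .
    have mS: "m \<in> S" using that(6,7) S' by (auto simp: expand_def split: if_splits)
    have "expand m m = Suc m" by (simp add: expand_def)
    then have "expand m ` insert m (S - {m}) = insert (Suc m) (S - {m})"
      using expand_noop[of m "S - {m}"] by (simp only: image_insert) simp
    then have "S' = insert (Suc m) (S - {m})" using S' mS by (simp add: insert_absorb)
    then have S'R: "S' = R - {m}" by (auto simp: R_def)
    have R: "finite R" "card R = d + 2" "S = R - {Suc m}" using S that(7) by (auto simp: R_def)
    have Rn: "R \<subseteq> {1..Suc m}" "Suc m \<in> R" using S by (auto simp: R_def)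
    have "above R (Suc m) = 0" "above R m = 1"
      using above_top(1)[OF R(1) Rn(1)] above_top(3)[OF R(1) Rn] by simp_all
    then have "over d S' S" unfolding over_def using R(1,2)
      by (intro exI[of _ R]) (auto simp: S'R R(3))
    then show False using triang_noncross[OF M that(2,1)] by simp
  qed
  fix S S' assume S: "S \<in> {S\<in>M. \<not> has_both m S}" "S' \<in> {S\<in>M. \<not> has_both m S}" "collapse m ` S =
    collapse m ` S'"
  have "Suc m \<in> S \<longleftrightarrow> Suc m \<in> S'"
  proof
    have *: "S \<in> M" "\<not> has_both m S" "S' \<in> M" "\<not> has_both m S'" using S by auto
    show "Suc m \<in> S'" if "Suc m \<in> S"
      by (rule ccontr) (rule aux[OF *(3,1,4,2) S(3)[symmetric] that])
    show "Suc m \<in> S" if "Suc m \<in> S'"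
      by (rule ccontr) (rule aux[OF *(1,3,2,4) S(3) that])
  qed
  moreover have "\<not> has_both m S" "\<not> has_both m S'" using S(1,2) by auto
  ultimately consider "m \<notin> S" "m \<notin> S'" | "Suc m \<notin> S" "Suc m \<notin> S'" unfolding has_both_def by blast
  then show "S = S'"
  proof cases
    case 1
    show ?thesis using expand_collapse[OF 1(1)] expand_collapse[OF 1(2)] unfolding S(3)
      by (rule_tac trans[OF sym])
  next
    case 2
    show ?thesis using collapse_noop[OF 2(1)] collapse_noop[OF 2(2)] unfolding S(3)
      by (rule_tac trans[OF sym])
  qed
qed

text \<open>Only two facets of \<open>R\<close> fail to contain both labels, namely
  \<open>R - {m}\<close> and \<open>R - {Suc m}\<close>. They are on opposite sides of the flip and
  collapse to the same simplex.\<close>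

lemma deletion_flip_has_both:
  assumes R: "R \<subseteq> {1..Suc m}" "card R = d + 2" "m \<in> R" "Suc m \<in> R" and s: "gale b R d \<subseteq> M"
  shows "deletion m (flip b d R M) = deletion m M"
    "{S\<in>flip b d R M. \<not> has_both m S} = {S\<in>M. \<not> has_both m S} - {if b then R - {Suc m} else R - {m}}
       \<union> {if b then R - {m} else R - {Suc m}}"
    "(if b then R - {Suc m} else R - {m}) \<in> M"
proof -
  have fR: "finite R" using R(1) finite_subset by blast
  have "above R (Suc m) = 0" "above R m = 1"
    using above_top(1)[OF fR R(1)] above_top(3)[OF fR R(1) R(4)] by simp_all
  then have nb: "{S\<in>gale c R d. \<not> has_both m S} = {if c then R - {Suc m} else R - {m}}" for c
    using gale_minimal[OF fR R(2)] R(3,4) by (auto simp: has_both_def)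
  define A where "A = (if b then R - {Suc m} else R - {m})"
  define B where "B = (if b then R - {m} else R - {Suc m})"
  have "{S\<in>flip b d R M. \<not> has_both m S} =
    ({S\<in>M. \<not> has_both m S} - {S\<in>gale b R d. \<not> has_both m S}) \<union> {S\<in>gale (\<not> b) R d. \<not> has_both m S}"
    by (auto simp: flip_def)
  then have eq: "{S\<in>flip b d R M. \<not> has_both m S} = {S\<in>M. \<not> has_both m S} - {A} \<union> {B}"
    unfolding nb A_def B_def by simp
  show "{S\<in>flip b d R M. \<not> has_both m S} =
    {S\<in>M. \<not> has_both m S} - {if b then R - {Suc m} else R - {m}}
       \<union> {if b then R - {m} else R - {Suc m}}" using eq unfolding A_def B_def .
  have A: "A \<in> {S\<in>M. \<not> has_both m S}" using nb[of b] s unfolding A_def by blast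
  then show "(if b then R - {Suc m} else R - {m}) \<in> M" unfolding A_def by simp
  have "collapse m ` (R - {m}) = R - {Suc m}" "collapse m ` (R - {Suc m}) = R - {Suc m}"
    using R(3,4) by (force simp: collapse_def image_iff)+
  then have "collapse m ` A = collapse m ` B" by (simp add: A_def B_def)
  then show "deletion m (flip b d R M) = deletion m M" unfolding deletion_def eq using A by blast
qed

text \<open>On \<open>R\<close> the collapse preserves the order, so it carries facets to facets.
  That taking images commutes with removing facets rests on \<open>collapse_inj\<close>.\<close>

lemma deletion_flip_other:
  assumes M: "triang (Suc m) d M"
    and R: "R \<subseteq> {1..Suc m}" "card R = d + 2" "\<not> has_both m R" and s: "gale b R d \<subseteq> M"
  shows "deletion m (flip b d R M) =
    flip b d (collapse m ` R) (deletion m M)" "gale b (collapse m ` R) d \<subseteq> deletion m M"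
proof -
  have fR: "finite R" using R(1) finite_subset by blast
  have nb: "\<not> has_both m S" if "S \<in> gale c R d" for S c using that R(3)
    by (auto simp: gale_def has_both_def)
  have fi: "gale c (collapse m ` R) d = (image (collapse m)) ` gale c R d" for c
    using gale_image[OF fR R(2)] strict_mono_on_collapse R by blast
  have sub: "gale b R d \<subseteq> {S\<in>M. \<not> has_both m S}" using s nb by blast
  have eq: "{S\<in>flip b d R M. \<not> has_both m S} = ({S\<in>M. \<not> has_both m S} - gale b R d) \<union>
    gale (\<not> b) R d"
    using nb by (auto simp: flip_def)
  have eq2: "(image (collapse m)) ` ({S\<in>M. \<not> has_both m S} - gale b R d) =
    deletion m M - (image (collapse m)) ` gale b R d"
    unfolding deletion_def using inj_on_image_set_diff[OF collapse_inj[OF M] Diff_subset sub]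
      by simp
  have "deletion m (flip b d R M) = (image (collapse m)) ` (({S\<in>M. \<not> has_both m S} - gale b R d) \<union>
    gale (\<not> b) R d)"
    unfolding deletion_def[of m "flip b d R M"] eq ..
  also have "\<dots> = flip b d (collapse m ` R) (deletion m M)" unfolding image_Un eq2 flip_def fi ..
  finally show "deletion m (flip b d R M) = flip b d (collapse m ` R) (deletion m M)" .
  show "gale b (collapse m ` R) d \<subseteq> deletion m M" unfolding fi deletion_def using s nb by auto
qed

lemma lower_lift_flip:
  assumes R: "R \<subseteq> {1..m}"
  shows "lower_lift m d (flip b d R Q) = flip b d R (lower_lift m d Q)" "gale b R d \<subseteq> Q \<Longrightarrow>
    gale b R d \<subseteq> lower_lift m d Q"
proof -
  have "Suc m \<notin> S" if "S \<in> gale c R d" for S c using that R by (auto simp: gale_def)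
  then show "lower_lift m d (flip b d R Q) = flip b d R (lower_lift m d Q)"
    unfolding lower_lift_def flip_def by blast
qed (auto simp: lower_lift_def)

lemma upper_lift_flip:
  assumes Q: "triang m d Q" and R: "R \<subseteq> {1..m}" "card R = d + 2" and s: "gale b R d \<subseteq> Q"
  shows "upper_lift m d (flip b d R Q) =
    flip b d (expand m ` R) (upper_lift m d Q)" "gale b (expand m ` R) d \<subseteq> upper_lift m d Q"
proof -
  have fR: "finite R" using R(1) finite_subset by blast
  have fi: "gale c (expand m ` R) d = (image (expand m)) ` gale c R d" for c
    using gale_image[OF fR R(2)] strict_mono_on_expand[OF R(1)] by blast
  have inj: "inj_on (image (expand m)) Q"
    by (rule inj_on_inverseI[where g = "image (collapse m)"]) (use collapse_expand triD(1)[OF Q] in auto)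
  \<comment> \<open>The added simplices contain \<open>m\<close>, whereas the facets being exchanged
    do not, so the flip leaves the former alone.\<close>
  have D: "S \<notin> {S \<in> gale False {1..Suc m} d. m \<in> S}" if "S \<in> gale c (expand m ` R) d" for S c
    using that m_notin_expand[of m R] by (auto simp: gale_def)
  have "(image (expand m)) ` (Q - gale b R d) =
    (image (expand m)) ` Q - (image (expand m)) ` gale b R d"
    using inj_on_image_set_diff[OF inj, of Q "gale b R d"] s by auto
  then have "(image (expand m)) ` flip b d R Q = (image (expand m)) ` Q - gale b (expand m ` R) d \<union>
    gale (\<not> b) (expand m ` R) d"
    unfolding fi by (simp add: flip_def image_Un)
  then show "upper_lift m d (flip b d R Q) = flip b d (expand m ` R) (upper_lift m d Q)"
    unfolding upper_lift_def flip_def[of b d "expand m ` R"] using D[of _ b] by blast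
  show "gale b (expand m ` R) d \<subseteq> upper_lift m d Q" unfolding fi upper_lift_def using s by blast
qed

subsection \<open>Descending and ascending in a fibre\<close>

text \<open>The analogue of \<open>simplex_key_less\<close> for two simplices on opposite sides of a
  common facet \<open>F\<close>.\<close>

lemma simplex_key_neighbour:
  assumes F: "finite F" "F \<subseteq> {..n}" "r \<notin> F" "s \<notin> F" "r \<le> n" "s \<le> n"
    and p: "odd (above F r)" "even (above F s)"
  shows "simplex_key n (insert r F) < simplex_key n (insert s F)"
proof -
  have d2: "gap_digit S i \<le> 2" for S i by (simp add: gap_digit_def)
  have rs: "r \<noteq> s" using p by auto
  have ab: "above (insert w F) i = above F i" if "w \<le> i" "w \<notin> F" for w i
    using above_insert[OF F(1) that(2)] that by simp
  show ?thesis
  proof (cases "r < s")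
    case True
    have "gap_digit (insert r F) s = 0" using p rs F ab[of r s] True by (simp add: gap_digit_def)
    moreover have "gap_digit (insert s F) s = 1" by (simp add: gap_digit_def)
    moreover have "gap_digit (insert r F) i = gap_digit (insert s F) i" if "s < i" for i
      using that True ab[of r i] ab[of s i] F by (auto simp: gap_digit_def)
    ultimately show ?thesis unfolding simplex_key_def
      using F by (intro base3_less[of _ s]) (auto simp: d2)
  next
    case False
    then have sr: "s < r" using rs by simp
    have "gap_digit (insert s F) r = 2" using p rs F ab[of s r] sr by (simp add: gap_digit_def)
    moreover have "gap_digit (insert r F) r = 1" by (simp add: gap_digit_def)
    moreover have "gap_digit (insert r F) i = gap_digit (insert s F) i" if "r < i" for i
      using that sr ab[of r i] ab[of s i] F by (auto simp: gap_digit_def)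
    ultimately show ?thesis unfolding simplex_key_def
      using F by (intro base3_less[of _ r]) (auto simp: d2)
  qed
qed

text \<open>Among the simplices containing \<open>m + 1\<close> but not \<open>m\<close>, one that comes last in the linear order
  belongs to the last flip that led to the triangulation within its fibre.\<close>

lemma flip_down_exists:
  assumes M: "triang (Suc m) d M" and m: "m \<ge> 1" and nl: "\<not> lower_section m M"
  shows "\<exists>R. R \<subseteq> {1..Suc m} \<and> card R = d + 2 \<and> m \<in> R \<and> Suc m \<in> R \<and> gale False R d \<subseteq> M"
proof -
  define P where "P = {S\<in>M. Suc m \<in> S \<and> m \<notin> S}"
  \<comment> \<open>Minimizing \<open>h\<close> selects the largest key, taken in the link of
    \<open>m + 1\<close>.\<close>
  define h where "h S = - int (simplex_key (Suc m) (S - {Suc m}))" for S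
  have "finite P" "P \<noteq> {}" using triang_finite[OF M] nl by (auto simp: P_def lower_section_def)
  then obtain S where S: "S \<in> P" "\<And>S'. S' \<in> P \<Longrightarrow> h S \<le> h S'"
    by (metis arg_min_if_finite(1) arg_min_least)
  have SM: "S \<in> M" "Suc m \<in> S" "m \<notin> S" using S(1) by (auto simp: P_def)
  note St = triD[OF M SM(1)]
  define R where "R = insert m S"
  have R: "finite R" "R \<subseteq> {1..Suc m}" "card R = d + 2" "m \<in> R" "Suc m \<in> R" "S = R - {m}"
    using St SM m by (auto simp: R_def)
  have "R - {x} \<in> M" if x: "x \<in> R" "odd (above R x)" for x
  proof (cases "x = m")
    case True
    then show ?thesis using R SM by simp
  next
    case False
    have xn: "x \<noteq> Suc m" using x above_top(1)[OF R(1,2)] by auto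
    have xm: "x < m" using x(1) False xn R(2) by (auto simp: subset_iff)
    have xS: "x \<in> S" using x False R by auto
    define F where "F = S - {x}"
    define G where "G = F - {Suc m}"
    have F: "finite F" "F \<subseteq> {1..Suc m}" "card F = d" "Suc m \<in> F" "m \<notin> F" "x \<notin> F" "insert x F = S"
      using St xS xn SM by (auto simp: F_def)
    have aF: "above F v = Suc (above G v)" if "v \<le> m" for v
      using above_insert[of G "Suc m" v] F that by (simp add: G_def insert_absorb)
    have "above R x = Suc (above S x)" using above_insert[of S m x] St SM xm by (simp add: R_def)
    moreover have "above S x = above F x" by (simp add: F_def)
    ultimately have oG: "odd (above G x)" using x(2) aF[of x] xm by simp
    \<comment> \<open>Cross the facet opposite to \<open>x\<close> towards \<open>m\<close>.
      Arriving at \<open>m\<close> gives \<open>R - {x}\<close>; arriving elsewhere would give an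
      element of \<open>P\<close> with a larger key.\<close>
    obtain s where s: "s \<in> {1..Suc m} - F" "insert s F \<in> M" "even (above F s) = even (above F m)"
      using neighbour[OF M SM(1) _ F(3), of m] F m by auto
    have "odd (above F s)" using s(3) above_top(3)[OF F(1,2,4)] by simp
    show ?thesis
    proof (cases "s = m")
      case True
      have "insert m F = R - {x}" using False by (auto simp: R_def F_def)
      then show ?thesis using s True by simp
    next
      case False
      have "s \<noteq> Suc m" using s F by auto
      then have sm: "s < m" using False s by (auto simp: le_Suc_eq)
      then have eG: "even (above G s)" using aF[of s] \<open>odd (above F s)\<close> by simp
      have "insert s F \<in> P" using s F False by (auto simp: P_def)
      then have "h S \<le> h (insert s F)" by (rule S(2))
      moreover have "insert s F - {Suc m} = insert s G" "S - {Suc m} = insert x G"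
        using F xn \<open>s \<noteq> Suc m\<close> by (auto simp: G_def)
      moreover have "simplex_key (Suc m) (insert x G) < simplex_key (Suc m) (insert s G)"
        by (rule simplex_key_neighbour) (use F xm sm s oG eG in \<open>auto simp: G_def\<close>)
      ultimately show ?thesis by (simp add: h_def)
    qed
  qed
  then have "gale False R d \<subseteq> M" using gale_minimal[OF R(1,3)] by auto
  then show ?thesis using R by blast
qed

text \<open>The mirror image of \<open>flip_down_exists\<close>: \<open>m\<close> and
  \<open>m + 1\<close> exchange roles, and the smallest key, in the link of \<open>m\<close>, is
  selected.\<close>

lemma flip_expand_exists:
  assumes M: "triang (Suc m) d M" and m: "m \<ge> 1" and nl: "\<not> upper_section m M"
  shows "\<exists>R. R \<subseteq> {1..Suc m} \<and> card R = d + 2 \<and> m \<in> R \<and> Suc m \<in> R \<and> gale True R d \<subseteq> M"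
proof -
  define P where "P = {S\<in>M. m \<in> S \<and> Suc m \<notin> S}"
  define h where "h S = simplex_key (Suc m) (S - {m})" for S
  have "finite P" "P \<noteq> {}" using triang_finite[OF M] nl by (auto simp: P_def upper_section_def)
  then obtain S where S: "S \<in> P" "\<And>S'. S' \<in> P \<Longrightarrow> h S \<le> h S'"
    by (metis arg_min_if_finite(1) arg_min_least)
  have SM: "S \<in> M" "m \<in> S" "Suc m \<notin> S" using S(1) by (auto simp: P_def)
  note St = triD[OF M SM(1)]
  define R where "R = insert (Suc m) S"
  have R: "finite R" "R \<subseteq> {1..Suc m}" "card R = d + 2" "m \<in> R" "Suc m \<in> R" "S = R - {Suc m}"
    using St SM by (auto simp: R_def)
  have "R - {x} \<in> M" if x: "x \<in> R" "even (above R x)" for x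
  proof (cases "x = Suc m")
    case True
    then show ?thesis using R SM by simp
  next
    case False
    have xn: "x \<noteq> m" using x above_top(3)[OF R(1,2,5)] by auto
    have xm: "x < m" using x(1) False xn R(2) by (auto simp: subset_iff)
    have xS: "x \<in> S" using x False R by auto
    define F where "F = S - {x}"
    define G where "G = F - {m}"
    have F: "finite F" "F \<subseteq> {1..Suc m}" "card F = d" "Suc m \<notin> F" "m \<in> F" "x \<notin> F" "insert x F = S"
      using St xS xn SM by (auto simp: F_def)
    have aF: "above F v = Suc (above G v)" if "v < m" for v
      using above_insert[of G m v] F that by (simp add: G_def insert_absorb)
    have "above R x = Suc (above S x)" using above_insert[of S "Suc m" x] St SM xm
      by (simp add: R_def)
    moreover have "above S x = above F x" by (simp add: F_def)
    ultimately have oG: "even (above G x)" using x(2) aF[of x] xm by simp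
    obtain s where s: "s \<in> {1..Suc m} - F" "insert s F \<in> M" "even (above F s) =
      even (above F (Suc m))"
      using neighbour[OF M SM(1) _ F(3), of "Suc m"] F by auto
    have "even (above F s)" using s(3) above_top(1)[OF F(1,2)] by simp
    show ?thesis
    proof (cases "s = Suc m")
      case True
      have "insert (Suc m) F = R - {x}" using False by (auto simp: R_def F_def)
      then show ?thesis using s True by simp
    next
      case False
      have "s \<noteq> m" using s F by auto
      then have sm: "s < m" using False s by (auto simp: le_Suc_eq)
      then have eG: "odd (above G s)" using aF[of s] \<open>even (above F s)\<close> by simp
      have "insert s F \<in> P" using s F False by (auto simp: P_def)
      then have "h S \<le> h (insert s F)" by (rule S(2))
      moreover have "insert s F - {m} = insert s G" "S - {m} = insert x G"
        using F xn \<open>s \<noteq> m\<close> by (auto simp: G_def)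
      moreover have "simplex_key (Suc m) (insert s G) < simplex_key (Suc m) (insert x G)"
        by (rule simplex_key_neighbour) (use F xm sm s oG eG in \<open>auto simp: G_def\<close>)
      ultimately show ?thesis by (simp add: h_def)
    qed
  qed
  then have "gale True R d \<subseteq> M" using gale_minimal[OF R(1,3)] by auto
  then show ?thesis using R by blast
qed

definition flips :: "nat \<Rightarrow> nat \<Rightarrow> nat set set rel" where
  "flips n d = {(M, M'). triang n d M \<and> (\<exists>R. R \<subseteq> {1..n} \<and> card R = d + 2 \<and> gale True R d \<subseteq> M \<and> M' =
    flip True d R M)}"

text \<open>The flips that do not change the deletion are those at sets containing \<open>m\<close> and \<open>m + 1\<close>.\<close>

definition fibre_flips :: "nat \<Rightarrow> nat \<Rightarrow> nat set set rel" where
  "fibre_flips m d = {(M, M'). triang (Suc m) d M \<and> (\<exists>R. R \<subseteq> {1..Suc m} \<and> card R = d + 2 \<and> m \<in> R \<and>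
    Suc m \<in> R
      \<and> gale True R d \<subseteq> M \<and> M' = flip True d R M)}"

lemma flips_triang: "(M, M') \<in> flips n d \<Longrightarrow> triang n d M'"
  unfolding flips_def using triang_flip by blast

lemma fibre_flips_flips: "fibre_flips m d \<subseteq> flips (Suc m) d"
  unfolding flips_def fibre_flips_def by blast

lemma flips_star_triang: "(M, M') \<in> (flips n d)\<^sup>* \<Longrightarrow> triang n d M \<Longrightarrow> triang n d M'"
  by (induction rule: rtrancl_induct) (auto intro: flips_triang)

lemma flips_star_below: "(M, M') \<in> (flips n d)\<^sup>* \<Longrightarrow> triang n d M \<Longrightarrow> below d M M'"
proof (induction rule: rtrancl_induct)
  case base
  then show ?case using triang_noncross by (auto simp: below_def)
next
  case (step M' M'')
  have "triang n d M'" "triang n d M''" using step flips_star_triang flips_triang by blast+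
  moreover have "below d M' M''" using step(2) flip_below unfolding flips_def by blast
  ultimately show ?case using step below_trans by blast
qed

lemma descend:
  assumes "triang (Suc m) d M" "m \<ge> 1"
  shows "\<exists>M0. triang (Suc m) d M0 \<and> lower_section m M0 \<and> deletion m M0 = deletion m M \<and>
    (M0, M) \<in> (fibre_flips m d)\<^sup>*"
  using assms(1)
proof (induction "card {S\<in>M. Suc m \<in> S \<and> m \<notin> S}" arbitrary: M rule: less_induct)
  case less
  show ?case
  proof (cases "lower_section m M")
    case True
    then show ?thesis using less.prems by blast
  next
    case False
    obtain R where R: "R \<subseteq> {1..Suc m}" "card R = d + 2" "m \<in> R" "Suc m \<in> R" "gale False R d \<subseteq> M"
      using flip_down_exists[OF less.prems assms(2) False] by blast
    define M' where "M' = flip False d R M"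
    note b = deletion_flip_has_both[OF R]
    have t: "triang (Suc m) d M'" unfolding M'_def using triang_flip[OF less.prems R(1,2,5)] .
    have "{S\<in>M'. Suc m \<in> S \<and> m \<notin> S} \<subseteq> {S\<in>M. Suc m \<in> S \<and> m \<notin> S} - {R - {m}}"
    proof
      fix S assume S: "S \<in> {S\<in>M'. Suc m \<in> S \<and> m \<notin> S}"
      then have "S \<in> {S\<in>M'. \<not> has_both m S}" by (simp add: has_both_def)
      then show "S \<in> {S\<in>M. Suc m \<in> S \<and> m \<notin> S} - {R - {m}}" using S
        unfolding M'_def b(2) if_True if_False by auto
    qed
    moreover have "R - {m} \<in> {S\<in>M. Suc m \<in> S \<and> m \<notin> S}" using b(3) R(3,4) by simp
    moreover have fin: "finite {S\<in>M. Suc m \<in> S \<and> m \<notin> S}" using triang_finite[OF less.prems] by simp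
    ultimately have "card {S\<in>M'. Suc m \<in> S \<and> m \<notin> S} < card {S\<in>M. Suc m \<in> S \<and> m \<notin> S}"
      using card_Diff1_less[OF fin] card_mono[OF finite_Diff[OF fin]] by (meson le_less_trans)
    from less.hyps[OF this t] obtain M0
      where M0: "triang (Suc m) d M0" "lower_section m M0" "deletion m M0 = deletion m M'"
        "(M0, M') \<in> (fibre_flips m d)\<^sup>*"
      by (elim exE conjE)
    have "M = flip True d R M'" using flip_flip[OF less.prems R(1,2,5)] by (simp add: M'_def)
    moreover have "gale True R d \<subseteq> M'" by (auto simp: M'_def flip_def)
    ultimately have e: "(M', M) \<in> fibre_flips m d" unfolding fibre_flips_def using t R(1-4) by blast
    have "deletion m M0 = deletion m M" using M0(3) b(1) by (simp add: M'_def)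
    then show ?thesis using M0(1,2) rtrancl_into_rtrancl[OF M0(4) e] by blast
  qed
qed

lemma ascend:
  assumes "triang (Suc m) d M" "m \<ge> 1"
  shows "\<exists>M1. triang (Suc m) d M1 \<and> upper_section m M1 \<and> deletion m M1 = deletion m M \<and>
    (M, M1) \<in> (fibre_flips m d)\<^sup>*"
  using assms(1)
proof (induction "card {S\<in>M. m \<in> S \<and> Suc m \<notin> S}" arbitrary: M rule: less_induct)
  case less
  show ?case
  proof (cases "upper_section m M")
    case True
    then show ?thesis using less.prems by blast
  next
    case False
    obtain R where R: "R \<subseteq> {1..Suc m}" "card R = d + 2" "m \<in> R" "Suc m \<in> R" "gale True R d \<subseteq> M"
      using flip_expand_exists[OF less.prems assms(2) False] by blast
    define M' where "M' = flip True d R M"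
    note b = deletion_flip_has_both[OF R]
    have t: "triang (Suc m) d M'" unfolding M'_def using triang_flip[OF less.prems R(1,2,5)] .
    have "{S\<in>M'. m \<in> S \<and> Suc m \<notin> S} \<subseteq> {S\<in>M. m \<in> S \<and> Suc m \<notin> S} - {R - {Suc m}}"
    proof
      fix S assume S: "S \<in> {S\<in>M'. m \<in> S \<and> Suc m \<notin> S}"
      then have "S \<in> {S\<in>M'. \<not> has_both m S}" by (simp add: has_both_def)
      then show "S \<in> {S\<in>M. m \<in> S \<and> Suc m \<notin> S} - {R - {Suc m}}" using S
        unfolding M'_def b(2) if_True if_False by auto
    qed
    moreover have "R - {Suc m} \<in> {S\<in>M. m \<in> S \<and> Suc m \<notin> S}" using b(3) R(3,4) by simp
    moreover have fin: "finite {S\<in>M. m \<in> S \<and> Suc m \<notin> S}" using triang_finite[OF less.prems] by simp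
    ultimately have "card {S\<in>M'. m \<in> S \<and> Suc m \<notin> S} < card {S\<in>M. m \<in> S \<and> Suc m \<notin> S}"
      using card_Diff1_less[OF fin] card_mono[OF finite_Diff[OF fin]] by (meson le_less_trans)
    from less.hyps[OF this t] obtain M1
      where M1: "triang (Suc m) d M1" "upper_section m M1" "deletion m M1 = deletion m M'"
        "(M', M1) \<in> (fibre_flips m d)\<^sup>*"
      by (elim exE conjE)
    have e: "(M, M') \<in> fibre_flips m d" unfolding fibre_flips_def M'_def using less.prems R by blast
    have "deletion m M1 = deletion m M" using M1(3) b(1) by (simp add: M'_def)
    then show ?thesis using M1(1,2) converse_rtrancl_into_rtrancl[OF e M1(4)] by blast
  qed
qed

subsection \<open>Deletion and its two sections\<close>

lemma vanish_poly_eq_0_iff: "finite F \<Longrightarrow> poly (vanish_poly F) (real z) = 0 \<longleftrightarrow> z \<in> F"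
  by (auto simp: vanish_poly_props)

lemma neighbour_ex:
  assumes "triang n d M" "S0 \<in> M" "F \<subseteq> S0" "card F = d" "v \<in> {1..n} - F"
  shows "\<exists>s\<in>{1..n} - F. insert s F \<in> M \<and> even (above F s) = even (above F v)"
  by (rule neighbour[OF assms]) blast

lemma gale_contains_top:
  assumes "S \<in> gale b {1..Suc m} d" "m \<ge> 1"
  shows "b \<Longrightarrow> Suc m \<in> S \<Longrightarrow> m \<in> S" "\<not> b \<Longrightarrow> Suc m \<in> S"
proof -
  have S: "finite S" "S \<subseteq> {1..Suc m}" using assms finite_subset by (auto simp: gale_def)
  show "m \<in> S" if b "Suc m \<in> S"
  proof (rule ccontr)
    assume "m \<notin> S"
    then have "even (above S m)" using assms \<open>b\<close> by (auto simp: gale_def)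
    then show False using above_top(3)[OF S that(2)] by simp
  qed
  show "Suc m \<in> S" if "\<not> b"
  proof (rule ccontr)
    assume "Suc m \<notin> S"
    then have "odd (above S (Suc m))" using assms that by (auto simp: gale_def)
    then show False using above_top(1)[OF S] by simp
  qed
qed

text \<open>If evenness failed at \<open>v\<close>, then \<open>v\<close> and \<open>m\<close> would
  lie on different sides of the facet \<open>S - {m}\<close>. The neighbour across it would contain
  \<open>m + 1\<close> but not \<open>m\<close>.\<close>

lemma lower_section_has_both:
  assumes M: "triang (Suc m) d M" "lower_section m M" "m \<ge> 1" and S: "S \<in> M" "Suc m \<in> S"
  shows "S \<in> gale True {1..Suc m} d"
proof -
  note St = triD[OF M(1) S(1)]
  have mS: "m \<in> S" using M S by (auto simp: lower_section_def)
  have "even (above S v)" if v: "v \<in> {1..Suc m} - S" for v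
  proof (rule ccontr)
    assume o: "odd (above S v)"
    define F where "F = S - {m}"
    have F: "finite F" "F \<subseteq> {1..Suc m}" "card F = d" "Suc m \<in> F" "m \<notin> F" using St mS S
      by (auto simp: F_def)
    have FS: "F \<subseteq> S" and vF: "v \<in> {1..Suc m} - F" using v by (auto simp: F_def)
    have "v \<noteq> m" "v \<noteq> Suc m" using v mS S by auto
    then have "v < m" using v by auto
    then have "above F v = above S v - 1" using above_remove[OF St(3) mS] by (simp add: F_def)
    then have par: "even (above F v)" using o by auto
    obtain s where s: "s \<in> {1..Suc m} - F" "insert s F \<in> M" "even (above F s) = even (above F v)"
      using neighbour_ex[OF M(1) S(1) FS F(3) vF] by blast
    have "s \<noteq> m" using s(3) par above_top(3)[OF F(1,2,4)] by auto
    then have "m \<notin> insert s F" "Suc m \<in> insert s F" using F(4,5) by auto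
    then show False using s(2) M(2) unfolding lower_section_def by blast
  qed
  then show ?thesis using St by (auto simp: gale_def)
qed

lemma upper_section_has_both:
  assumes M: "triang (Suc m) d M" "upper_section m M" "m \<ge> 1" and S: "S \<in> M" "m \<in> S"
  shows "S \<in> gale False {1..Suc m} d"
proof -
  note St = triD[OF M(1) S(1)]
  have mS: "Suc m \<in> S" using M S by (auto simp: upper_section_def)
  have "odd (above S v)" if v: "v \<in> {1..Suc m} - S" for v
  proof
    assume o: "even (above S v)"
    define F where "F = S - {Suc m}"
    have F: "finite F" "F \<subseteq> {1..Suc m}" "card F = d" "m \<in> F" "Suc m \<notin> F" using St mS S
      by (auto simp: F_def)
    have FS: "F \<subseteq> S" and vF: "v \<in> {1..Suc m} - F" using v by (auto simp: F_def)
    have "v \<noteq> m" "v \<noteq> Suc m" using v mS S by auto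
    then have "v < Suc m" using v by auto
    then have "above F v = above S v - 1" using above_remove[OF St(3) mS] by (simp add: F_def)
    moreover have "above S v > 0" using above_pos[OF St(3) mS \<open>v < Suc m\<close>] .
    ultimately have par: "odd (above F v)" using o by auto
    obtain s where s: "s \<in> {1..Suc m} - F" "insert s F \<in> M" "even (above F s) = even (above F v)"
      using neighbour_ex[OF M(1) S(1) FS F(3) vF] by blast
    have "s \<noteq> Suc m" using s(3) par above_top(1)[OF F(1,2)] by auto
    then have "Suc m \<notin> insert s F" "m \<in> insert s F" using F(4,5) by auto
    then show False using s(2) M(2) unfolding upper_section_def by blast
  qed
  then show ?thesis using St by (auto simp: gale_def)
qed

lemma deletion_lower_section:
  assumes "lower_section m M"
  shows "deletion m M = {S\<in>M. Suc m \<notin> S}"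
proof -
  have "{S\<in>M. \<not> has_both m S} = {S\<in>M. Suc m \<notin> S}" using assms
    by (auto simp: lower_section_def has_both_def)
  then have "deletion m M = (image (collapse m)) ` {S\<in>M. Suc m \<notin> S}" by (simp add: deletion_def)
  also have "\<dots> = id ` {S\<in>M. Suc m \<notin> S}" by (rule image_cong) (simp_all add: collapse_noop)
  finally show ?thesis by simp
qed

lemma deletion_upper_section:
  assumes "upper_section m M"
  shows "deletion m M = (image (collapse m)) ` {S\<in>M. m \<notin> S}"
proof -
  have "{S\<in>M. \<not> has_both m S} = {S\<in>M. m \<notin> S}" using assms
    by (auto simp: upper_section_def has_both_def)
  then show ?thesis by (simp add: deletion_def)
qed

text \<open>\<open>D\<close> joins \<open>m + 1\<close> to an upper facet \<open>F\<close> of the cyclic polytope on \<open>{1..m}\<close>; the hyperplane through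
  \<open>F\<close> separates it from that polytope.\<close>

lemma top_facet_sgn:
  assumes D: "D \<in> gale True {1..Suc m} d" "Suc m \<in> D" "m \<ge> 1"
  defines "F \<equiv> D - {Suc m}"
  shows "finite F" "card F = d" "F \<subseteq> {1..m}" "v \<in> {1..m} - F \<Longrightarrow> odd (above F v)"
    "v \<in> {1..m} \<Longrightarrow> poly (vanish_poly F) (real v) \<le> 0" "poly (vanish_poly F) (real (Suc m)) > 0"
proof -
  have Dp: "finite D" "D \<subseteq> {1..Suc m}" "card D = Suc d" using D finite_subset
    by (auto simp: gale_def)
  show F: "finite F" "card F = d" "F \<subseteq> {1..m}" using Dp D by (auto simp: F_def le_Suc_eq)
  show odd: "odd (above F v)" if "v \<in> {1..m} - F" for v
  proof -
    have v: "v \<in> {1..Suc m} - D" "v < Suc m" using that by (auto simp: F_def)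
    then have "even (above D v)" using D by (auto simp: gale_def)
    moreover have "above D v > 0" using above_pos[OF Dp(1) D(2) v(2)] .
    moreover have "above F v = above D v - 1" using above_remove[OF Dp(1) D(2)] v
      by (simp add: F_def)
    ultimately show ?thesis by auto
  qed
  show "poly (vanish_poly F) (real v) \<le> 0" if "v \<in> {1..m}"
    using odd[of v] vanish_poly_nonneg_iff(2)[OF F(1), of v] vanish_poly_zero[OF F(1), of v] that
      by (cases "v \<in> F") auto
  have "above F (Suc m) = 0" using F by (intro above_Max) auto
  moreover have "Suc m \<notin> F" by (simp add: F_def)
  ultimately show "poly (vanish_poly F) (real (Suc m)) > 0"
    using vanish_poly_nonneg_iff(1)[OF F(1), of "Suc m"] by simp
qed

text \<open>The label \<open>m + 1\<close> would be topmost in the circuit and thus in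
  \<open>S\<close>, so it does not occur. Hence the half in \<open>D\<close> lies in
  \<open>F\<close> and the other half weakly on one side of its hyperplane, and
  \<open>circuit_separation\<close> puts \<open>d + 2\<close> labels into \<open>F\<close>.\<close>

lemma not_over_lowpart:
  assumes D: "D \<in> gale True {1..Suc m} d" "Suc m \<in> D" "m \<ge> 1" and S: "S \<subseteq> {1..m}"
  shows "\<not> over d S D"
proof
  assume "over d S D"
  then obtain Z where Z: "finite Z" "card Z = d + 2"
    "\<And>z. z \<in> Z \<Longrightarrow> if even (above Z z) then z \<in> S else z \<in> D" by (auto simp: over_def)
  define F where "F = D - {Suc m}"
  note F = top_facet_sgn[OF D, folded F_def]
  have Zb: "Z \<subseteq> {1..Suc m}"
  proof
    fix z assume "z \<in> Z"
    then have "z \<in> S \<or> z \<in> D" using Z(3)[of z] by (auto split: if_splits)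
    moreover have "D \<subseteq> {1..Suc m}" using D(1) by (simp add: gale_def)
    ultimately show "z \<in> {1..Suc m}" using S by auto
  qed
  have "Suc m \<notin> Z"
  proof
    assume "Suc m \<in> Z"
    then show False using Z(3)[of "Suc m"] above_top(1)[OF Z(1) Zb] S by auto
  qed
  then have ZF: "z \<in> F" if "z \<in> Z" "odd (above Z z)" for z using Z(3)[OF that(1)] that
    by (auto simp: F_def)
  have zero: "poly (vanish_poly F) (real z) = 0" if "z \<in> Z" for z
  proof (rule circuit_separation[OF Z(1,2) _ _ _ that, of _ False])
    show "degree (vanish_poly F) \<le> d" using vanish_poly_props(2)[OF F(1)] F(2) by simp
    show "poly (vanish_poly F) (real z) \<ge> 0" if "z \<in> Z" "even (above Z z) = False" for z
    proof -
      have "z \<in> F" using ZF[OF that(1)] that(2) by simp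
      then show ?thesis using vanish_poly_zero[OF F(1)] by simp
    qed
    show "poly (vanish_poly F) (real z) \<le> 0" if "z \<in> Z" "even (above Z z) \<noteq> False" for z
    proof -
      have "z \<in> S" using Z(3)[OF that(1)] that(2) by simp
      then have "z \<in> {1..m}" using S by blast
      then show ?thesis by (rule F(5))
    qed
  qed
  have "Z \<subseteq> F" using zero vanish_poly_eq_0_iff[OF F(1)] by blast
  then have "card Z \<le> card F" using F(1) by (rule card_mono[rotated])
  then show False using F(2) Z(2) by simp
qed

text \<open>The hyperplane through \<open>D - {m}\<close> has \<open>m\<close> strictly on one side
  and all other labels weakly on the other, so \<open>circuit_separation\<close> puts the whole
  circuit into a set of \<open>d\<close> labels.\<close>

lemma not_over_highpart:
  assumes D: "D \<in> gale False {1..Suc m} d" "m \<in> D" "m \<ge> 1" and S: "S \<subseteq> {1..Suc m}" "m \<notin> S"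
  shows "\<not> over d D S"
proof
  assume "over d D S"
  then obtain Z where Z: "finite Z" "card Z = d + 2"
    "\<And>z. z \<in> Z \<Longrightarrow> if even (above Z z) then z \<in> D else z \<in> S" by (auto simp: over_def)
  have Dp: "finite D" "D \<subseteq> {1..Suc m}" "card D = Suc d" using D finite_subset
    by (auto simp: gale_def)
  have DS: "Suc m \<in> D" using gale_contains_top(2)[OF D(1,3)] by simp
  define F where "F = D - {m}"
  have F: "finite F" "card F = d" "F \<subseteq> {1..Suc m}" "Suc m \<in> F" "m \<notin> F" using Dp D DS
    by (auto simp: F_def)
  have pos: "poly (vanish_poly F) (real v) \<ge> 0" if v: "v \<in> {1..Suc m} - {m}" for v
  proof (cases "v \<in> F")
    case True
    then show ?thesis using vanish_poly_zero[OF F(1)] by simp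
  next
    case False
    then have vD: "v \<in> {1..Suc m} - D" using v by (auto simp: F_def)
    then have o: "odd (above D v)" using D by (auto simp: gale_def)
    have "v \<noteq> Suc m" using vD DS by auto
    then have "v < m" using v by auto
    then have "above F v = above D v - 1" using above_remove[OF Dp(1) D(2)] by (simp add: F_def)
    then have "even (above F v)" using o by auto
    then show ?thesis using vanish_poly_nonneg_iff(1)[OF F(1) False] by simp
  qed
  have neg: "poly (vanish_poly F) (real m) < 0"
    using vanish_poly_nonneg_iff(2)[OF F(1,5)] above_top(3)[OF F(1,3,4)] by simp
  have zero: "poly (vanish_poly F) (real z) = 0" if "z \<in> Z" for z
  proof (rule circuit_separation[OF Z(1,2) _ _ _ that, of _ False])
    show "degree (vanish_poly F) \<le> d" using vanish_poly_props(2)[OF F(1)] F(2) by simp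
    show "poly (vanish_poly F) (real z) \<ge> 0" if "z \<in> Z" "even (above Z z) = False" for z
    proof -
      have "z \<in> S" using Z(3)[OF that(1)] that(2) by auto
      then show ?thesis using S by (intro pos) auto
    qed
    show "poly (vanish_poly F) (real z) \<le> 0" if "z \<in> Z" "even (above Z z) \<noteq> False" for z
    proof (cases "z = m")
      case True
      then show ?thesis using neg by simp
    next
      case False
      then have "z \<in> F" using Z(3)[OF that(1)] that(2) by (auto simp: F_def)
      then show ?thesis using vanish_poly_zero[OF F(1)] by simp
    qed
  qed
  have "Z \<subseteq> F" using zero vanish_poly_eq_0_iff[OF F(1)] by blast
  then have "card Z \<le> card F" using F(1) by (rule card_mono[rotated])
  then show False using F(2) Z(2) by simp
qed

text \<open>The issue is coverage. If a point of the smaller polytope lies in a simplex with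
  \<open>m + 1\<close>, it lies in the facet opposite to \<open>m + 1\<close>, whose hyperplane
  separates \<open>m + 1\<close> from that polytope. The neighbour across this facet avoids
  \<open>m + 1\<close>.\<close>

lemma triang_deletion_lower_section:
  assumes M: "triang (Suc m) d M" "lower_section m M" and m: "m \<ge> Suc d"
  shows "triang m d (deletion m M)"
  unfolding triang_def covers_def
proof (intro conjI ballI allI impI)
  have m1: "m \<ge> 1" using m by simp
  note dl = deletion_lower_section[OF M(2)]
  show "S \<subseteq> {1..m}" "card S = Suc d" if "S \<in> deletion m M" for S
    using triD[OF M(1), of S] that unfolding dl by (auto simp: le_Suc_eq)
  show "\<not> over d S S'" if "S \<in> deletion m M" "S' \<in> deletion m M" for S S'
    using triang_noncross[OF M(1)] that unfolding dl by blast
  fix a assume a: "nonneg {1..m} a"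
  then have "nonneg {1..Suc m} a" by (rule nonneg_mono) auto
  then obtain S b where S: "S \<in> M" "nonneg S b" "same_moments d a b" using triang_cover[OF M(1)]
    by blast
  show "\<exists>S\<in>deletion m M. \<exists>b. nonneg S b \<and> same_moments d a b"
  proof (cases "Suc m \<in> S")
    case False
    then show ?thesis using S unfolding dl by blast
  next
    case True
    have D: "S \<in> gale True {1..Suc m} d" by (rule lower_section_has_both[OF M m1 S(1) True])
    define F where "F = S - {Suc m}"
    note F = top_facet_sgn[OF D True m1, folded F_def]
    define p where "p = vanish_poly F"
    have "degree p \<le> d" using vanish_poly_props(2)[OF F(1)] F(2) by (simp add: p_def)
    then have "moment_ev a p = moment_ev b p" using S(3) by (simp add: same_moments_def)
    moreover have "moment_ev a p \<le> 0"
      unfolding moment_ev_def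
    proof (rule sum_nonpos)
      fix i assume "i \<in> supp a"
      then have "i \<in> {1..m}" using a by (auto simp: nonneg_def)
      then show "a i * poly p (real i) \<le> 0" using F(5)[of i] a
        by (simp add: p_def nonneg_def mult_nonneg_nonpos)
    qed
    moreover have "moment_ev b p = b (Suc m) * poly p (real (Suc m))"
    proof -
      have "S = insert (Suc m) F" using True by (auto simp: F_def)
      then have "moment_ev b p = (\<Sum>i\<in>insert (Suc m) F. b i * poly p (real i))"
        using S(2) F(1) by (intro moment_ev_superset) (auto simp: nonneg_def)
      also have "\<dots> = b (Suc m) * poly p (real (Suc m)) + (\<Sum>i\<in>F. b i * poly p (real i))"
        using F(1) by (subst sum.insert) (auto simp: F_def)
      also have "(\<Sum>i\<in>F. b i * poly p (real i)) = 0"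
        by (rule sum.neutral) (simp add: p_def vanish_poly_zero[OF F(1)])
      finally show ?thesis by simp
    qed
    moreover have "poly p (real (Suc m)) > 0" using F(6) by (simp add: p_def)
    moreover have "b (Suc m) \<ge> 0" using S(2) by (simp add: nonneg_def)
    ultimately have "b (Suc m) = 0" by (metis less_eq_real_def mult_pos_pos not_less)
    then have bF: "nonneg F b" using S(2) by (auto simp: nonneg_def supp_def F_def)
    \<comment> \<open>\<open>F\<close> has only \<open>d\<close> labels, fewer than
      \<open>m\<close>, so there is a label strictly on the far side of its hyperplane.\<close>
    have "\<not> {1..m} \<subseteq> F" using card_mono[OF F(1), of "{1..m}"] F(2) m by auto
    then obtain v where v: "v \<in> {1..m} - F" by blast
    have vo: "odd (above F v)" using F(4) v .
    have FS: "F \<subseteq> S" and vF: "v \<in> {1..Suc m} - F" using v by (auto simp: F_def)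
    obtain s where s: "s \<in> {1..Suc m} - F" "insert s F \<in> M" "even (above F s) = even (above F v)"
      using neighbour_ex[OF M(1) S(1) _ F(2), of v] FS vF by blast
    have "above F (Suc m) = 0" using F(1,3) by (intro above_Max) auto
    then have "s \<noteq> Suc m" using s(3) vo by auto
    then have "insert s F \<in> deletion m M" using s(2) unfolding dl by (auto simp: F_def)
    then show ?thesis using S(3) nonneg_mono[OF bF] by blast
  qed
qed

text \<open>Descending to a lower section does not change the deletion, and there the deletion is
  just a subset of the simplices.\<close>

lemma triang_deletion:
  assumes "triang (Suc m) d M" "m \<ge> Suc d"
  shows "triang m d (deletion m M)"
  using descend[OF assms(1)] triang_deletion_lower_section assms(2) by fastforce

text \<open>For coverage, represent the point on a lower facet first. Either this facet contains
  \<open>m + 1\<close> and is in the lift, or it lives on \<open>{1..m}\<close>, where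
  \<open>Q\<close> takes over.\<close>

lemma triang_lower_lift:
  assumes Q: "triang m d Q" and m: "m \<ge> Suc d"
  shows "triang (Suc m) d (lower_lift m d Q)" "lower_section m (lower_lift m d Q)" "deletion m (lower_lift m d Q) = Q"
proof -
  have m1: "m \<ge> 1" using m by simp
  have Qn: "Suc m \<notin> S" "S \<subseteq> {1..m}" if "S \<in> Q" for S using triD(1)[OF Q that] by auto
  show low: "lower_section m (lower_lift m d Q)" unfolding lower_section_def lower_lift_def
    using Qn(1) gale_contains_top(1)[OF _ m1] by blast
  show "deletion m (lower_lift m d Q) = Q" unfolding deletion_lower_section[OF low]
    unfolding lower_lift_def using Qn(1) by blast
  show "triang (Suc m) d (lower_lift m d Q)"
    unfolding triang_def covers_def
  proof (intro conjI ballI allI impI)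
    show "S \<subseteq> {1..Suc m}" "card S = Suc d" if "S \<in> lower_lift m d Q" for S
      using triD[OF Q, of S] that by (fastforce simp: lower_lift_def gale_def)+
    show "\<not> over d S S'" if S: "S \<in> lower_lift m d Q" "S' \<in> lower_lift m d Q" for S S'
    proof (cases "S \<in> Q")
      case True
      then show ?thesis
        using S(2) triang_noncross[OF Q True] not_over_lowpart[OF _ _ m1 Qn(2)[OF True]]
        unfolding lower_lift_def by blast
    next
      case False
      then have "S \<in> gale True {1..Suc m} d" using S by (auto simp: lower_lift_def)
      moreover have "S' \<subseteq> {1..Suc m}" using S(2) Qn(2)[of S']
        by (fastforce simp: lower_lift_def gale_def)
      ultimately show ?thesis using gale_not_over by blast
    qed
    fix a assume a: "nonneg {1..Suc m} a"
    obtain S b where S: "S \<in> gale True {1..Suc m} d" "nonneg S b" "same_moments d a b"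
      using gale_covers_all[OF _ a, of d True] m by auto
    show "\<exists>S\<in>lower_lift m d Q. \<exists>b. nonneg S b \<and> same_moments d a b"
    proof (cases "Suc m \<in> S")
      case True
      then show ?thesis using S unfolding lower_lift_def by blast
    next
      case False
      have "S \<subseteq> {1..Suc m}" using S(1) by (simp add: gale_def)
      then have "S \<subseteq> {1..m}" using False by (auto simp: le_Suc_eq)
      then have "nonneg {1..m} b" using S(2) nonneg_mono by blast
      then obtain S' b' where "S' \<in> Q" "nonneg S' b'" "same_moments d b b'" using triang_cover[OF Q]
        by blast
      then show ?thesis using same_moments_trans[OF S(3)] unfolding lower_lift_def by blast
    qed
  qed
qed

lemma lower_section_eq_lower_lift:
  assumes M: "triang (Suc m) d M" "lower_section m M" and m: "m \<ge> Suc d"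
  shows "M = lower_lift m d (deletion m M)"
proof (rule triang_subset_eq[OF M(1)])
  show "triang (Suc m) d (lower_lift m d (deletion m M))"
    using triang_lower_lift(1)[OF triang_deletion[OF M(1) m] m] .
  have m1: "m \<ge> 1" using m by simp
  show "M \<subseteq> lower_lift m d (deletion m M)"
    unfolding deletion_lower_section[OF M(2)] lower_lift_def using lower_section_has_both[OF M m1]
      by blast
qed

lemma lower_lift_down:
  assumes M: "triang (Suc m) d M" and m: "m \<ge> Suc d"
  shows "(lower_lift m d (deletion m M), M) \<in> (fibre_flips m d)\<^sup>*"
proof -
  obtain M0 where "triang (Suc m) d M0" "lower_section m M0" "deletion m M0 = deletion m M"
    "(M0, M) \<in> (fibre_flips m d)\<^sup>*"
    using descend[OF M] m by auto
  then show ?thesis using lower_section_eq_lower_lift[of m d M0] m by simp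
qed

text \<open>Unlike in the lower case, \<open>upper_lift\<close> is not yet known to be a
  triangulation, so both inclusions are shown. An added simplex belongs to \<open>M\<close> because
  nothing in \<open>M\<close> crosses it.\<close>

lemma upper_section_eq_upper_lift:
  assumes M: "triang (Suc m) d M" "upper_section m M" and m: "m \<ge> Suc d"
  shows "M = upper_lift m d (deletion m M)"
proof
  have m1: "m \<ge> 1" using m by simp
  have pure: "S = expand m ` collapse m ` S" if "m \<notin> S" for S using expand_collapse[OF that] by simp
  show sub: "M \<subseteq> upper_lift m d (deletion m M)"
  proof
    fix S assume S: "S \<in> M"
    show "S \<in> upper_lift m d (deletion m M)"
    proof (cases "m \<in> S")
      case True
      then show ?thesis using upper_section_has_both[OF M m1 S] by (simp add: upper_lift_def)
    next
      case False
      then show ?thesis unfolding upper_lift_def deletion_upper_section[OF M(2)]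
        using S pure[OF False] by blast
    qed
  qed
  show "upper_lift m d (deletion m M) \<subseteq> M"
  proof
    fix D assume "D \<in> upper_lift m d (deletion m M)"
    then consider S
      where "S \<in> M" "m \<notin> S" "D = expand m ` collapse m ` S" | "D \<in> gale False {1..Suc m} d" "m \<in> D"
      unfolding upper_lift_def deletion_upper_section[OF M(2)] by blast
    then show "D \<in> M"
    proof cases
      case 1
      then show ?thesis using pure by metis
    next
      case 2
      show ?thesis
      proof (rule triang_superset_simplex[OF M(1)])
        show "D \<subseteq> {1..Suc m}" "card D = Suc d" using 2 by (auto simp: gale_def)
        fix S' assume S': "S' \<in> M"
        have sub': "S' \<subseteq> {1..Suc m}" using triD(1)[OF M(1) S'] .
        show "\<not> over d S' D" using gale_not_under[OF 2(1) sub'] by simp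
        show "\<not> over d D S'"
        proof (cases "m \<in> S'")
          case True
          then have "S' \<in> gale False {1..Suc m} d" using upper_section_has_both[OF M m1 S'] by simp
          then show ?thesis using gale_not_under[of S' "{1..Suc m}" d D] 2 by (auto simp: gale_def)
        next
          case False
          then show ?thesis using not_over_highpart[OF 2 m1 sub'] by simp
        qed
      qed
    qed
  qed
qed

text \<open>Ascending from the lower lift ends in an upper section with deletion \<open>Q\<close>,
  which can only be \<open>upper_lift m d Q\<close>. This gives the triangulation property and the
  connecting flips at once.\<close>

lemma triang_upper_lift:
  assumes Q: "triang m d Q" and m: "m \<ge> Suc d"
  shows "triang (Suc m) d (upper_lift m d Q)" "upper_section m (upper_lift m d Q)" "deletion m (upper_lift m d Q) = Q"
    "(lower_lift m d Q, upper_lift m d Q) \<in> (fibre_flips m d)\<^sup>*"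
proof -
  note i = triang_lower_lift[OF Q m]
  obtain M1 where M1: "triang (Suc m) d M1" "upper_section m M1" "deletion m M1 =
    deletion m (lower_lift m d Q)"
    "(lower_lift m d Q, M1) \<in> (fibre_flips m d)\<^sup>*"
    using ascend[OF i(1)] m by auto
  have "M1 = upper_lift m d Q" using upper_section_eq_upper_lift[OF M1(1,2) m] M1(3) i(3) by simp
  then show "triang (Suc m) d (upper_lift m d Q)" "upper_section m (upper_lift m d Q)" "deletion m (upper_lift m d Q) = Q"
    "(lower_lift m d Q, upper_lift m d Q) \<in> (fibre_flips m d)\<^sup>*" using M1 i(3) by simp_all
qed

lemma upper_lift_expand:
  assumes M: "triang (Suc m) d M" and m: "m \<ge> Suc d"
  shows "(M, upper_lift m d (deletion m M)) \<in> (fibre_flips m d)\<^sup>*"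
proof -
  obtain M1 where "triang (Suc m) d M1" "upper_section m M1" "deletion m M1 = deletion m M"
    "(M, M1) \<in> (fibre_flips m d)\<^sup>*"
    using ascend[OF M] m by auto
  then show ?thesis using upper_section_eq_upper_lift[of m d M1] m by simp
qed

lemma below_lower_lift:
  assumes Q: "triang m d Q" "triang m d Q'" "below d Q Q'" and m: "m \<ge> 1"
  shows "below d (lower_lift m d Q) (lower_lift m d Q')"
  unfolding below_def
proof (intro ballI)
  fix S S' assume S: "S \<in> lower_lift m d Q" "S' \<in> lower_lift m d Q'"
  show "\<not> over d S S'"
  proof (cases "S \<in> Q")
    case True
    then show ?thesis using S(2) Q(3) not_over_lowpart[OF _ _ m triD(1)[OF Q(1) True]]
      unfolding lower_lift_def below_def by blast
  next
    case False
    then have "S \<in> gale True {1..Suc m} d" using S by (auto simp: lower_lift_def)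
    moreover have "S' \<subseteq> {1..Suc m}" using S(2) triD(1)[OF Q(2), of S']
      by (fastforce simp: lower_lift_def gale_def)
    ultimately show ?thesis using gale_not_over by blast
  qed
qed

lemma below_upper_lift:
  assumes Q: "triang m d Q" "triang m d Q'" "below d Q Q'" and m: "m \<ge> 1"
  shows "below d (upper_lift m d Q) (upper_lift m d Q')"
  unfolding below_def
proof (intro ballI)
  fix S S' assume S: "S \<in> upper_lift m d Q" "S' \<in> upper_lift m d Q'"
  have sub: "S0 \<subseteq> {1..Suc m}" if "S0 \<in> upper_lift m d Q \<or> S0 \<in> upper_lift m d Q'" for S0
    using that expand_subset[OF triD(1)[OF Q(1)]] expand_subset[OF triD(1)[OF Q(2)]]
    unfolding upper_lift_def gale_def by blast
  show "\<not> over d S S'"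
  proof (cases "S' \<in> gale False {1..Suc m} d")
    case True
    then show ?thesis using gale_not_under[OF True sub[of S]] S by simp
  next
    case False
    then obtain S0' where S0': "S0' \<in> Q'" "S' = expand m ` S0'" using S(2)
      by (auto simp: upper_lift_def)
    show ?thesis
    proof (cases "m \<in> S")
      case True
      then have "S \<in> gale False {1..Suc m} d" using S(1) m_notin_expand
        by (auto simp: upper_lift_def)
      then show ?thesis using not_over_highpart[OF _ True m sub[of S']] S(2) S0'(2) m_notin_expand
        by simp
    next
      case False
      then obtain S0 where "S0 \<in> Q" "S = expand m ` S0" using S(1) by (auto simp: upper_lift_def)
      then show ?thesis using over_expand[of d m S0 S0'] S0' triD(1)[OF Q(1)] triD(1)[OF Q(2)] Q(3)
        unfolding below_def by blast
    qed
  qed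
qed

subsection \<open>Extreme triangulations and the colouring\<close>

lemma lower_lift_bot:
  assumes m: "m \<ge> Suc d"
  shows "lower_lift m d (gale True {1..m} d) = gale True {1..Suc m} d"
    "deletion m (gale True {1..Suc m} d) = gale True {1..m} d"
proof -
  let ?B = "gale True {1..Suc m} d"
  have t: "triang (Suc m) d ?B" using m by (intro triang_gale) simp
  have low: "lower_section m ?B" using gale_contains_top(1)[of _ True m d] m
    by (auto simp: lower_section_def)
  have "deletion m ?B \<subseteq> gale True {1..m} d"
    unfolding deletion_lower_section[OF low] by (auto simp: gale_def le_Suc_eq)
  then show *: "deletion m ?B = gale True {1..m} d"
    by (rule triang_subset_eq[OF triang_deletion[OF t m] triang_gale[OF m]])
  show "lower_lift m d (gale True {1..m} d) = ?B" using lower_section_eq_lower_lift[OF t low m]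
    unfolding * by simp
qed

lemma upper_lift_top:
  assumes m: "m \<ge> Suc d"
  shows "upper_lift m d (gale False {1..m} d) = gale False {1..Suc m} d"
    "deletion m (gale False {1..Suc m} d) = gale False {1..m} d"
proof -
  let ?B = "gale False {1..Suc m} d"
  have t: "triang (Suc m) d ?B" using m by (intro triang_gale) simp
  have tn: "Suc m \<in> S" if "S \<in> ?B" for S using gale_contains_top(2)[of _ False m d] that m by auto
  then have upB: "upper_section m ?B" by (auto simp: upper_section_def)
  have "deletion m ?B \<subseteq> gale False {1..m} d"
  proof
    fix S' assume "S' \<in> deletion m ?B"
    then obtain S where S: "S \<in> ?B" "m \<notin> S" "S' = collapse m ` S"
      unfolding deletion_upper_section[OF upB] by blast
    have nb: "\<not> has_both m S" using S by (simp add: has_both_def)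
    have sm: "strict_mono_on S (collapse m)" by (rule strict_mono_on_collapse[OF nb])
    have Sp: "S \<subseteq> {1..Suc m}" "card S = Suc d" "finite S" using S(1) finite_subset
      by (auto simp: gale_def)
    have "card S' = Suc d" using Sp(2) card_image[OF strict_mono_on_imp_inj_on[OF sm]] S(3) by simp
    moreover have "S' \<subseteq> {1..m}" using Sp(1) m unfolding S(3) by (auto simp: collapse_def le_Suc_eq)
    moreover have "odd (above S' v)" if v: "v \<in> {1..m} - S'" for v
    proof -
      have "m \<in> S'" using tn[OF S(1)] S(3) by (force simp: collapse_def)
      then have "v \<noteq> m" using v by auto
      then have vm: "v < m" using v by auto
      have vS: "v \<notin> S"
      proof
        assume "v \<in> S"
        then have "collapse m v \<in> S'" using S(3) by blast
        then show False using v vm by (simp add: collapse_def)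
      qed
      have "strict_mono_on (insert v S) (collapse m)" using nb vm
        by (intro strict_mono_on_collapse) (auto simp: has_both_def)
      then have "above (collapse m ` insert v S) (collapse m v) = above (insert v S) v"
        by (rule above_image) simp
      moreover have "collapse m v = v" using vm by (simp add: collapse_def)
      ultimately have "above S' v = above S v" using S(3) by simp
      then show ?thesis using S(1) vS v by (auto simp: gale_def)
    qed
    ultimately show "S' \<in> gale False {1..m} d" by (auto simp: gale_def)
  qed
  then show *: "deletion m ?B = gale False {1..m} d"
    by (rule triang_subset_eq[OF triang_deletion[OF t m] triang_gale[OF m]])
  show "upper_lift m d (gale False {1..m} d) = ?B" using upper_section_eq_upper_lift[OF t upB m]
    unfolding * by simp
qed

text \<open>An increasing flip can only create the simplex on the last \<open>d + 1\<close> labels if \<open>d\<close> is even, and only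
  destroy it if \<open>d\<close> is odd; so the following colour is inherited upwards.\<close>

definition last_simplex :: "nat \<Rightarrow> nat \<Rightarrow> nat set" where "last_simplex m d = {Suc m - d..Suc m}"

definition red_colour :: "nat \<Rightarrow> nat \<Rightarrow> nat set set \<Rightarrow> bool" where
  "red_colour m d M \<longleftrightarrow> (last_simplex m d \<in> M) = even d"

lemma last_simplex_props:
  assumes m: "m \<ge> Suc d"
  shows "finite (last_simplex m d)" "last_simplex m d \<subseteq> {1..Suc m}" "card (last_simplex m d) =
    Suc d" "Suc m \<in> last_simplex m d"
    "d \<ge> 1 \<Longrightarrow> m \<in> last_simplex m d" "last_simplex m d \<in> gale b {1..Suc m} d \<longleftrightarrow> b = odd d"
proof -
  show W: "finite (last_simplex m d)" "Suc m \<in> last_simplex m d" "last_simplex m d \<subseteq> {1..Suc m}" "card (last_simplex m d) = Suc d"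
    "d \<ge> 1 \<Longrightarrow> m \<in> last_simplex m d"
    using m by (auto simp: last_simplex_def)
  have ab: "above (last_simplex m d) v = Suc d" if "v \<in> {1..Suc m} - last_simplex m d" for v
  proof -
    have "{w \<in> last_simplex m d. v < w} = last_simplex m d" using that
      by (auto simp: last_simplex_def)
    then show ?thesis using m by (simp add: above_def last_simplex_def)
  qed
  have "Suc 0 \<in> {1..Suc m} - last_simplex m d" using m by (auto simp: last_simplex_def)
  then have "(\<forall>v\<in>{1..Suc m} - last_simplex m d. even (above (last_simplex m d) v) = b) \<longleftrightarrow>
    even (Suc d) = b"
    using ab by metis
  then show "last_simplex m d \<in> gale b {1..Suc m} d \<longleftrightarrow> b = odd d"
    using W(3,4) by (auto simp: gale_def)
qed

text \<open>For even \<open>d\<close> the last simplex is an upper facet, over which nothing lies;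
  if \<open>M\<close> contains it, it crosses nothing in \<open>M'\<close> and belongs to
  \<open>M'\<close>. For odd \<open>d\<close> it is a lower facet, and its presence passes from
  \<open>M'\<close> down to \<open>M\<close>.\<close>

lemma red_colour_mono:
  assumes M: "triang (Suc m) d M" "triang (Suc m) d M'" "below d M M'" and r: "red_colour m d M"
    and m: "m \<ge> Suc d"
  shows "red_colour m d M'"
proof (cases "even d")
  case True
  then have W: "last_simplex m d \<in> M" using r by (simp add: red_colour_def)
  have "last_simplex m d \<in> M'"
  proof (rule triang_superset_simplex[OF M(2) last_simplex_props(2,3)[OF m]])
    fix S' assume S': "S' \<in> M'"
    show "\<not> over d (last_simplex m d) S'" using M(3) W S' by (simp add: below_def)
    have "last_simplex m d \<in> gale False {1..Suc m} d" using last_simplex_props(6)[OF m] True by simp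
    then show "\<not> over d S' (last_simplex m d)" using gale_not_under triD(1)[OF M(2) S'] by blast
  qed
  then show ?thesis using True by (simp add: red_colour_def)
next
  case False
  have "last_simplex m d \<notin> M'"
  proof
    assume W: "last_simplex m d \<in> M'"
    have "last_simplex m d \<in> M"
    proof (rule triang_superset_simplex[OF M(1) last_simplex_props(2,3)[OF m]])
      fix S' assume S': "S' \<in> M"
      show "\<not> over d S' (last_simplex m d)" using M(3) W S' by (simp add: below_def)
      have "last_simplex m d \<in> gale True {1..Suc m} d" using last_simplex_props(6)[OF m] False
        by simp
      then show "\<not> over d (last_simplex m d) S'" using gale_not_over triD(1)[OF M(1) S'] by blast
    qed
    then show False using r False by (simp add: red_colour_def)
  qed
  then show ?thesis using False by (simp add: red_colour_def)
qed

lemma not_red_colour_lower_lift: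
  assumes Q: "triang m d Q" and m: "m \<ge> Suc d"
  shows "\<not> red_colour m d (lower_lift m d Q)"
proof -
  have "last_simplex m d \<notin> Q"
  proof
    assume "last_simplex m d \<in> Q"
    then have "Suc m \<in> {1..m}" using triD(1)[OF Q] last_simplex_props(4)[OF m] by blast
    then show False by simp
  qed
  then show ?thesis using last_simplex_props(4,6)[OF m]
    by (auto simp: red_colour_def lower_lift_def)
qed

text \<open>For \<open>d \<ge> 1\<close> the last simplex contains \<open>m\<close>, so the added
  facets alone decide whether it is present.\<close>

lemma red_colour_upper_lift:
  assumes d: "d \<ge> 1" and m: "m \<ge> Suc d"
  shows "red_colour m d (upper_lift m d Q)"
proof -
  have W: "m \<in> last_simplex m d" using last_simplex_props(5)[OF m d] .
  then have "last_simplex m d \<notin> (image (expand m)) ` Q" using m_notin_expand by auto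
  then show ?thesis using W last_simplex_props(6)[OF m]
    by (auto simp: red_colour_def upper_lift_def)
qed

text \<open>Let \<open>v\<close> be the largest missing label of the last block. Removing
  \<open>m\<close> or \<open>m + 1\<close>, whichever has parity \<open>b\<close>, shows that
  \<open>above R v\<close> has the wrong parity for a facet missing only labels below
  \<open>v\<close>. But at most \<open>d\<close> labels of \<open>R\<close> lie above
  \<open>v\<close>, hence two lie below, and the second of these from the top has parity
  \<open>b\<close>; removing it gives such a facet.\<close>

lemma extreme_facets_consecutive:
  assumes R: "R \<subseteq> {1..Suc m}" "card R = d + 2" "m \<in> R" "Suc m \<in> R"
    and s: "gale b R d \<subseteq> gale b {1..Suc m} d" and m: "m \<ge> Suc d"
  shows "last_simplex m d \<subseteq> R"
proof (rule ccontr)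
  assume "\<not> ?thesis"
  then have ne: "last_simplex m d - R \<noteq> {}" by blast
  have fR: "finite R" using R(1) finite_subset by blast
  define v where "v = Max (last_simplex m d - R)"
  have fin: "finite (last_simplex m d - R)" by (simp add: last_simplex_def)
  have v: "v \<in> last_simplex m d" "v \<notin> R" using Max_in[OF fin ne] by (auto simp: v_def)
  have vmax: "w \<in> R" if "v < w" "w \<le> Suc m" for w
  proof (rule ccontr)
    assume "w \<notin> R"
    then have "w \<in> last_simplex m d - R" using that v(1) by (auto simp: last_simplex_def)
    then show False using Max_ge[OF fin] that(1) by (simp add: v_def not_less[symmetric])
  qed
  have vb: "v \<le> Suc m" "v \<ge> 1" "Suc m - v \<le> d" using v(1) m by (auto simp: last_simplex_def)
  have "v \<noteq> m" "v \<noteq> Suc m" using v R by auto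
  then have vm: "v < m" using vb by linarith
  have H: "{w\<in>R. v < w} = {Suc v..Suc m}" using vmax R(1) by auto
  then have abv: "above R v = Suc m - v" by (simp add: above_def)
  have face: "even (above (R - {r}) v) = b" if "r \<in> R" "even (above R r) = b" for r
  proof -
    have "R - {r} \<in> gale b {1..Suc m} d" using that s gale_minimal[OF fR R(2)] by blast
    then show ?thesis using v vb by (auto simp: gale_def)
  qed
  have "\<exists>r\<in>R. r > v \<and> even (above R r) = b"
  proof (cases b)
    case True
    then show ?thesis using R(4) vm above_top(1)[OF fR R(1)] by (intro bexI[of _ "Suc m"]) auto
  next
    case False
    then show ?thesis using R(3) vm above_top(3)[OF fR R(1,4)] by (intro bexI[of _ m]) auto
  qed
  then obtain r where r: "r \<in> R" "r > v" "even (above R r) = b" by blast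
  have pk: "even (Suc m - v) \<noteq> b"
    using face[OF r(1,3)] above_remove[OF fR r(1), of v] r(2) abv vm by auto
  define L where "L = {w\<in>R. w < v}"
  have "R = L \<union> {Suc v..Suc m}" using H v(2) R(1) by (auto simp: L_def not_less_iff_gr_or_eq)
  moreover have "L \<inter> {Suc v..Suc m} = {}" by (auto simp: L_def)
  moreover have fL: "finite L" using fR by (simp add: L_def)
  ultimately have "card R = card L + (Suc m - v)"
    by (metis card_Un_disjoint card_atLeastAtMost finite_atLeastAtMost diff_Suc_Suc)
  then have cL: "card L \<ge> 2" using R(2) vb(3) by linarith
  then have L0: "L \<noteq> {}" by auto
  define r1 where "r1 = Max L"
  have r1: "r1 \<in> L" "\<And>w. w \<in> L \<Longrightarrow> w \<le> r1" using fL L0 by (auto simp: r1_def)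
  have "card (L - {r1}) \<ge> 1" using cL r1(1) fL by simp
  then have L1: "L - {r1} \<noteq> {}" using card.empty by (metis not_one_le_zero)
  define r2 where "r2 = Max (L - {r1})"
  have r2: "r2 \<in> L - {r1}" "\<And>w. w \<in> L - {r1} \<Longrightarrow> w \<le> r2"
    using Max_in[OF _ L1] Max_ge[of "L - {r1}"] fL by (auto simp: r2_def)
  have r21: "r2 < r1" using r2(1) r1(2)[of r2] by auto
  have "{w\<in>R. r2 < w} = insert r1 {w\<in>R. v < w}"
  proof (intro set_eqI iffI)
    fix w assume w: "w \<in> {w\<in>R. r2 < w}"
    show "w \<in> insert r1 {w\<in>R. v < w}"
    proof (cases "w < v")
      case True
      then have "w \<in> L" using w by (simp add: L_def)
      then show ?thesis using r2(2)[of w] w by auto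
    next
      case False
      then show ?thesis using w v(2) by (auto simp: not_less_iff_gr_or_eq)
    qed
  next
    fix w assume "w \<in> insert r1 {w\<in>R. v < w}"
    then show "w \<in> {w\<in>R. r2 < w}" using r1(1) r2(1) r21 by (auto simp: L_def)
  qed
  moreover have "r1 \<notin> {w\<in>R. v < w}" using r1(1) by (auto simp: L_def)
  ultimately have "above R r2 = Suc (Suc m - v)" using fR abv by (simp add: above_def)
  then have "even (above R r2) = b" using pk by auto
  moreover have "r2 \<in> R" "r2 < v" using r2(1) by (auto simp: L_def)
  ultimately have "even (above R v) = b" using face[of r2] above_remove[OF fR, of r2 v] by simp
  then show False using pk abv by simp
qed

lemma last_simplex_facet:
  assumes R: "R \<subseteq> {1..Suc m}" "card R = d + 2" "last_simplex m d \<subseteq> R" and m: "m \<ge> Suc d"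
  shows "last_simplex m d \<in> gale b R d \<longleftrightarrow> b = odd d"
proof -
  have fR: "finite R" using R(1) finite_subset by blast
  have "card (R - last_simplex m d) = 1" using R last_simplex_props[OF m]
    by (simp add: card_Diff_subset)
  then obtain r where r: "R - last_simplex m d = {r}" using card_1_singletonE by blast
  then have rR: "r \<in> R" "r \<notin> last_simplex m d" and W: "last_simplex m d = R - {r}" using R(3)
    by blast+
  have "r \<in> {1..Suc m}" using rR(1) R(1) by blast
  then have rl: "r < Suc m - d" using rR(2) by (auto simp: last_simplex_def)
  have "r < w" if "w \<in> last_simplex m d" for w using that rl by (simp add: last_simplex_def)
  then have "{w \<in> R. r < w} = R - {r}" using W by blast
  then have ab: "above R r = Suc d" using last_simplex_props(3)[OF m] unfolding W above_def by simp
  show ?thesis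
  proof
    assume "last_simplex m d \<in> gale b R d"
    then obtain r' where r': "r' \<in> R" "last_simplex m d = R - {r'}" "even (above R r') = b"
      using gale_minimal[OF fR R(2)] by blast
    then have "r' = r" using W rR(1) by blast
    then show "b = odd d" using r'(3) ab by auto
  next
    assume "b = odd d"
    then show "last_simplex m d \<in> gale b R d" using gale_minimal[OF fR R(2)] rR(1) ab W by auto
  qed
qed

text \<open>The first flip on a path from the bottom inside the fibre exchanges extreme facets, so
  its circuit contains the last simplex and the colour becomes red. Red persists upwards.\<close>

lemma fibre_bot:
  assumes M: "triang (Suc m) d M" and m: "m \<ge> Suc d"
    and f: "deletion m M = gale True {1..m} d" and g: "\<not> red_colour m d M"
  shows "M = gale True {1..Suc m} d"
proof (rule ccontr)
  let ?B = "gale True {1..Suc m} d"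
  assume ne: "M \<noteq> ?B"
  have "(?B, M) \<in> (fibre_flips m d)\<^sup>*" using lower_lift_down[OF M m]
    unfolding f lower_lift_bot(1)[OF m] .
  then obtain M1 where M1: "(?B, M1) \<in> fibre_flips m d" "(M1, M) \<in> (fibre_flips m d)\<^sup>*"
    using ne by (metis converse_rtranclE)
  obtain R where R: "R \<subseteq> {1..Suc m}" "card R = d + 2" "m \<in> R" "Suc m \<in> R" "gale True R d \<subseteq> ?B"
    "M1 = flip True d R ?B" using M1(1) by (auto simp: fibre_flips_def)
  have W: "last_simplex m d \<subseteq> R" using extreme_facets_consecutive[OF R(1-5) m] .
  have t1: "triang (Suc m) d M1" using M1(1) fibre_flips_flips flips_triang by blast
  have "(M1, M) \<in> (flips (Suc m) d)\<^sup>*" using M1(2) rtrancl_mono[OF fibre_flips_flips] by blast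
  then have "below d M1 M" using flips_star_below t1 by blast
  moreover have "red_colour m d M1"
    using last_simplex_facet[OF R(1,2) W m] last_simplex_props(6)[OF m]
      unfolding R(6) red_colour_def flip_def by auto
  ultimately show False using red_colour_mono[OF t1 M] m g by blast
qed

text \<open>Dually, the triangulation just before the last flip into the top is not red, hence
  neither is anything below it.\<close>

lemma fibre_top:
  assumes M: "triang (Suc m) d M" and m: "m \<ge> Suc d"
    and f: "deletion m M = gale False {1..m} d" and g: "red_colour m d M"
  shows "M = gale False {1..Suc m} d"
proof (rule ccontr)
  let ?B = "gale False {1..Suc m} d"
  assume ne: "M \<noteq> ?B"
  have "(M, ?B) \<in> (fibre_flips m d)\<^sup>*" using upper_lift_expand[OF M m]
    unfolding f upper_lift_top(1)[OF m] .
  then obtain M1 where M1: "(M, M1) \<in> (fibre_flips m d)\<^sup>*" "(M1, ?B) \<in> fibre_flips m d"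
    using ne by (metis rtranclE)
  obtain R where R: "R \<subseteq> {1..Suc m}" "card R = d + 2" "m \<in> R" "Suc m \<in> R" "gale True R d \<subseteq> M1"
    "?B = flip True d R M1" and t1: "triang (Suc m) d M1" using M1(2) unfolding fibre_flips_def
      by blast
  have "gale False R d \<subseteq> ?B" unfolding R(6) by (auto simp: flip_def)
  then have W: "last_simplex m d \<subseteq> R" using extreme_facets_consecutive[OF R(1-4) _ m] by blast
  have "(M, M1) \<in> (flips (Suc m) d)\<^sup>*" using M1(1) rtrancl_mono[OF fibre_flips_flips] by blast
  then have "below d M M1" using flips_star_below M by blast
  then have "red_colour m d M1" using red_colour_mono[OF M t1] m g by blast
  moreover have "gale False R d \<inter> M1 = {}" using gale_disjoint[OF t1 R(1,2,5)] by simp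
  ultimately show False
    using last_simplex_facet[OF R(1,2) W m, of True] last_simplex_facet[OF R(1,2) W m, of False] R(5)
    unfolding red_colour_def by (cases "even d") auto
qed

subsection \<open>Realizations of finite posets\<close>

definition realization :: "'a rel \<Rightarrow> ('a \<Rightarrow> real) set" where
  "realization r = {w. (\<forall>v. w v \<ge> 0) \<and> {v. w v \<noteq> 0} \<in> order_complex r \<and> (\<Sum>v | w v \<noteq> 0. w v) = 1}"

lemma geometric_realization_top_of_set: "geometric_realization (order_complex r) =
  top_of_set (realization r)"
  by (simp add: geometric_realization_def realization_def euclidean_product_topology)

definition finite_poset :: "'a rel \<Rightarrow> bool" where
  "finite_poset r \<longleftrightarrow> finite (Field r) \<and> (\<forall>x\<in>Field r. (x, x) \<in> r) \<and> trans r \<and> antisym r"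

definition mono_map :: "'a rel \<Rightarrow> 'b rel \<Rightarrow> ('a \<Rightarrow> 'b) \<Rightarrow> bool" where
  "mono_map r s g \<longleftrightarrow> (\<forall>x y. (x, y) \<in> r \<longrightarrow> (g x, g y) \<in> s)"

text \<open>The simplicial map induced by \<open>g\<close>, in barycentric coordinates: weights of
  elements with the same image add up.\<close>

definition push_fwd :: "'a rel \<Rightarrow> ('a \<Rightarrow> 'b) \<Rightarrow> ('a \<Rightarrow> real) \<Rightarrow> 'b \<Rightarrow> real" where
  "push_fwd r g w v = (\<Sum>u\<in>Field r. if g u = v then w u else 0)"

lemma realization_iff:
  assumes "finite (Field r)"
  shows "w \<in> realization r \<longleftrightarrow> (\<forall>v. w v \<ge> 0) \<and> (\<forall>u v. w u \<noteq> 0 \<longrightarrow> w v \<noteq> 0 \<longrightarrow> (u, v) \<in> r \<or> (v, u) \<in> r)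
    \<and> (\<Sum>v\<in>Field r. w v) = 1" (is "_ \<longleftrightarrow> ?R")
proof -
  have *: "{v. w v \<noteq> 0} \<subseteq> Field r" if "\<forall>u v. w u \<noteq> 0 \<longrightarrow> w v \<noteq> 0 \<longrightarrow> (u, v) \<in> r \<or> (v, u) \<in> r"

  proof
    fix v assume "v \<in> {v. w v \<noteq> 0}"
    then have "(v, v) \<in> r" using that by blast
    then show "v \<in> Field r" by (rule FieldI1)
  qed
  have s: "(\<Sum>v | w v \<noteq> 0. w v) = (\<Sum>v\<in>Field r. w v)" if "{v. w v \<noteq> 0} \<subseteq> Field r"
    using assms that by (intro sum.mono_neutral_left) auto
  have c: "{v. w v \<noteq> 0} \<in> order_complex r \<longleftrightarrow>
      (\<forall>u v. w u \<noteq> 0 \<longrightarrow> w v \<noteq> 0 \<longrightarrow> (u, v) \<in> r \<or> (v, u) \<in> r)"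
  proof
    assume "{v. w v \<noteq> 0} \<in> order_complex r"
    then show "\<forall>u v. w u \<noteq> 0 \<longrightarrow> w v \<noteq> 0 \<longrightarrow> (u, v) \<in> r \<or> (v, u) \<in> r"
      by (simp add: order_complex_def Chains_def)
  next
    assume a: "\<forall>u v. w u \<noteq> 0 \<longrightarrow> w v \<noteq> 0 \<longrightarrow> (u, v) \<in> r \<or> (v, u) \<in> r"
    then show "{v. w v \<noteq> 0} \<in> order_complex r"
      using finite_subset[OF *[OF a] assms] by (simp add: order_complex_def Chains_def)
  qed
  show ?thesis unfolding realization_def mem_Collect_eq c
    by (intro conj_cong refl) (simp only: s[OF *])
qed

lemma push_fwd_nz:
  assumes "push_fwd r g w v \<noteq> 0"
  shows "\<exists>u\<in>Field r. g u = v \<and> w u \<noteq> 0"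
proof (rule ccontr)
  assume "\<not> ?thesis"
  then have "push_fwd r g w v = 0" unfolding push_fwd_def by (intro sum.neutral) auto
  then show False using assms by simp
qed

lemma push_fwd_nonneg: "(\<And>u. w u \<ge> 0) \<Longrightarrow> push_fwd r g w v \<ge> 0"
  unfolding push_fwd_def by (intro sum_nonneg) auto

lemma push_fwd_sum:
  assumes "finite (Field r)" "finite G" "\<And>u. u \<in> Field r \<Longrightarrow> g u \<in> G"
  shows "(\<Sum>v\<in>G. push_fwd r g w v) = (\<Sum>u\<in>Field r. w u)"
proof -
  have "(\<Sum>v\<in>G. push_fwd r g w v) = (\<Sum>u\<in>Field r. \<Sum>v\<in>G. if g u = v then w u else 0)"
    unfolding push_fwd_def by (rule sum.swap)
  also have "\<dots> = (\<Sum>u\<in>Field r. w u)" using assms by (intro sum.cong) auto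
  finally show ?thesis .
qed

lemma mono_map_Field: "mono_map r s g \<Longrightarrow> x \<in> Field r \<Longrightarrow> g x \<in> Field s"
  unfolding mono_map_def Field_def by blast

lemma continuous_on_push_fwd:
  assumes "finite (Field r)" "continuous_on S h"
  shows "continuous_on S (\<lambda>x. push_fwd r g (h x) v)"
proof -
  have "continuous_on S (\<lambda>x. if g u = v then h x u else 0)" for u
    using continuous_on_product_then_coordinatewise[OF assms(2), of u] by (cases "g u = v") auto
  then show ?thesis unfolding push_fwd_def by (intro continuous_on_sum)
qed

text \<open>Contiguity of simplicial maps. Testing pairs is enough because pairwise comparable
  elements already form a chain.\<close>

definition contiguous :: "'a rel \<Rightarrow> 'b rel \<Rightarrow> ('a \<Rightarrow> 'b) \<Rightarrow> ('a \<Rightarrow> 'b) \<Rightarrow> bool" where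
  "contiguous r s g h \<longleftrightarrow> (\<forall>u v. (u, v) \<in> r \<longrightarrow>
     (\<forall>x\<in>{g u, h u, g v, h v}. \<forall>y\<in>{g u, h u, g v, h v}. (x, y) \<in> s \<or> (y, x) \<in> s))"

text \<open>The straight-line homotopy: over a chain, the values of both maps together form a chain,
  so convex combinations stay in the realization.\<close>

lemma homotopic_contiguous:
  assumes r: "finite (Field r)" and s: "finite (Field s)" and c: "contiguous r s g h"
  shows "homotopic_with (\<lambda>_. True) (top_of_set (realization r)) (top_of_set (realization s)) (push_fwd r g) (push_fwd r h)"
proof -
  define H where "H p v = (1 - fst p) * push_fwd r g (snd p) v + fst p * push_fwd r h (snd p) v"
    for p :: "real \<times> ('a \<Rightarrow> real)" and v
  have "continuous_on ({0..1} \<times> realization r) H"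
  proof (rule continuous_on_coordinatewise_then_product)
    fix v
    show "continuous_on ({0..1} \<times> realization r) (\<lambda>p. H p v)"
      unfolding H_def by (intro continuous_intros continuous_on_push_fwd[OF r])
  qed
  moreover have "H (t, w) \<in> realization s" if t: "t \<in> {0..1}" and w: "w \<in> realization r" for t w
    unfolding realization_iff[OF s]
  proof (intro conjI allI impI)
    have w': "\<And>v. w v \<ge> 0" "\<And>u v. w u \<noteq> 0 \<Longrightarrow> w v \<noteq> 0 \<Longrightarrow> (u, v) \<in> r \<or> (v, u) \<in> r"
      "(\<Sum>v\<in>Field r. w v) = 1" using w unfolding realization_iff[OF r] by blast+
    show "H (t, w) v \<ge> 0" for v
      unfolding H_def using t push_fwd_nonneg[of w, OF w'(1)]
      by (intro add_nonneg_nonneg mult_nonneg_nonneg) auto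
    have ex: "\<exists>u. w u \<noteq> 0 \<and> x \<in> {g u, h u}" if "H (t, w) x \<noteq> 0" for x
    proof -
      have "push_fwd r g w x \<noteq> 0 \<or> push_fwd r h w x \<noteq> 0" using that by (auto simp: H_def)
      then show ?thesis using push_fwd_nz by fastforce
    qed
    show "(x, y) \<in> s \<or> (y, x) \<in> s" if xy: "H (t, w) x \<noteq> 0" "H (t, w) y \<noteq> 0" for x y
    proof -
      obtain u v where uv: "w u \<noteq> 0" "x \<in> {g u, h u}" "w v \<noteq> 0" "y \<in> {g v, h v}"
        using ex[OF xy(1)] ex[OF xy(2)] by blast
      have "(u, v) \<in> r \<or> (v, u) \<in> r" using w'(2) uv by blast
      then show ?thesis
      proof
        assume "(u, v) \<in> r"
        then show ?thesis using c uv(2,4) unfolding contiguous_def by blast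
      next
        assume "(v, u) \<in> r"
        then show ?thesis using c uv(2,4) unfolding contiguous_def by blast
      qed
    qed
    have F: "g u \<in> Field s" "h u \<in> Field s" if "u \<in> Field r" for u
      using that c unfolding contiguous_def Field_def by blast+
    have "(\<Sum>v\<in>Field s. H (t, w) v) =
      (1 - t) * (\<Sum>v\<in>Field s. push_fwd r g w v) + t * (\<Sum>v\<in>Field s. push_fwd r h w v)"
      by (simp add: H_def sum.distrib sum_distrib_left)
    also have "\<dots> = 1" using push_fwd_sum[OF r s] F w'(3) by simp
    finally show "(\<Sum>v\<in>Field s. H (t, w) v) = 1" .
  qed
  ultimately have "continuous_map (prod_topology (top_of_set {0..1}) (top_of_set (realization r))) (top_of_set (realization s)) H"
    by (auto simp: Pi_iff)
  then show ?thesis unfolding homotopic_with_def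
    by (intro exI[of _ H]) (auto simp: H_def)
qed

lemma mono_contiguous:
  assumes "finite_poset s" "mono_map r s g"
  shows "contiguous r s g g"
proof -
  have "(g u, g u) \<in> s" "(g v, g v) \<in> s" "(g u, g v) \<in> s" if "(u, v) \<in> r" for u v
    using assms that mono_map_Field[OF assms(2)] unfolding finite_poset_def mono_map_def Field_def
      by blast+
  then show ?thesis unfolding contiguous_def by blast
qed

lemma continuous_map_push_fwd:
  assumes "finite_poset r" "finite_poset s" "mono_map r s g"
  shows "continuous_map (top_of_set (realization r)) (top_of_set (realization s)) (push_fwd r g)"
  using homotopic_contiguous[OF _ _ mono_contiguous[OF assms(2,3)]] assms homotopic_with_imp_continuous_maps
  unfolding finite_poset_def by blast

text \<open>Two comparable maps need not be contiguous, but they are joined by changing one value at a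
  time, starting with maximal arguments.\<close>

lemma homotopic_comparable:
  assumes r: "finite_poset r" and s: "finite_poset s" and "mono_map r s g" "mono_map r s h" and
    "\<forall>x\<in>Field r. (g x, h x) \<in> s"
  shows "homotopic_with (\<lambda>_. True) (top_of_set (realization r)) (top_of_set (realization s)) (push_fwd r g) (push_fwd r h)"
  using assms(3-5)
proof (induction "card {x\<in>Field r. g x \<noteq> h x}" arbitrary: g rule: less_induct)
  case less
  note g = less.prems(1) and h = less.prems(2) and le = less.prems(3)
  have fr: "finite (Field r)" and fs: "finite (Field s)" using r s by (auto simp: finite_poset_def)
  have tr: "trans s" and anti: "antisym r" and trr: "trans r" using r s
    by (auto simp: finite_poset_def)
  define D where "D = {x\<in>Field r. g x \<noteq> h x}"
  have fD: "finite D" using fr by (simp add: D_def)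
  show ?case
  proof (cases "D = {}")
    case True
    then have "g u = h u" if "u \<in> Field r" for u using that unfolding D_def by blast
    then have "push_fwd r g = push_fwd r h" unfolding push_fwd_def by (intro ext sum.cong) simp_all
    then show ?thesis using continuous_map_push_fwd[OF r s h] by simp
  next
    case False
    \<comment> \<open>An element of \<open>D\<close> with fewest elements of \<open>D\<close> above
      it is maximal in \<open>D\<close>. The two maps agree strictly above \<open>a\<close>, so that
      changing the value at \<open>a\<close> preserves monotonicity.\<close>
    obtain a where a: "a \<in> D" "\<And>b. b \<in> D \<Longrightarrow> card {c\<in>D. (a, c) \<in> r} \<le> card {c\<in>D. (b, c) \<in> r}"
    proof
      let ?f = "\<lambda>b. card {c\<in>D. (b, c) \<in> r}"
      show "arg_min_on ?f D \<in> D" by (rule arg_min_if_finite(1)[OF fD False])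
      show "?f (arg_min_on ?f D) \<le> ?f b" if "b \<in> D" for b by (rule arg_min_least[OF fD False that])
    qed
    have aF: "a \<in> Field r" using a by (simp add: D_def)
    have amax: "b = a" if b: "b \<in> D" "(a, b) \<in> r" for b
    proof (rule ccontr)
      assume ne: "b \<noteq> a"
      have "{c\<in>D. (b, c) \<in> r} \<subseteq> {c\<in>D. (a, c) \<in> r}" using transD[OF trr b(2)] by blast
      moreover have "a \<in> {c\<in>D. (a, c) \<in> r}" using a r aF by (simp add: finite_poset_def)
      moreover have "a \<notin> {c\<in>D. (b, c) \<in> r}" using antisymD[OF anti b(2)] ne by blast
      ultimately have "{c\<in>D. (b, c) \<in> r} \<subset> {c\<in>D. (a, c) \<in> r}" by blast
      then have "card {c\<in>D. (b, c) \<in> r} < card {c\<in>D. (a, c) \<in> r}" using fD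
        by (intro psubset_card_mono) auto
      then show False using a(2)[OF b(1)] by simp
    qed
    have eq: "g y = h y" if "(a, y) \<in> r" "y \<noteq> a" for y
    proof (rule ccontr)
      assume "g y \<noteq> h y"
      then have "y \<in> D" using FieldI2[OF that(1)] by (simp add: D_def)
      then show False using amax that by blast
    qed
    define g' where "g' = g(a := h a)"
    have gs: "(g x, g y) \<in> s" "(h x, h y) \<in> s" if "(x, y) \<in> r" for x y
      using g h that by (auto simp: mono_map_def)
    have gha: "(g a, h a) \<in> s" using le aF by blast
    have rs: "(g x, g x) \<in> s" "(h x, h x) \<in> s" if "x \<in> Field r" for x
      using that mono_map_Field[OF g] mono_map_Field[OF h] s by (auto simp: finite_poset_def)
    have m': "mono_map r s g'"
      unfolding mono_map_def
    proof (intro allI impI)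
      fix x y assume xy: "(x, y) \<in> r"
      consider "x = a" "y = a" | "x = a" "y \<noteq> a" | "x \<noteq> a" "y = a" | "x \<noteq> a" "y \<noteq> a" by blast
      then show "(g' x, g' y) \<in> s"
      proof cases
        case 1
        then show ?thesis using rs aF by (simp add: g'_def)
      next
        case 2
        then show ?thesis using gs(2)[OF xy] eq[of y] xy by (simp add: g'_def)
      next
        case 3
        then show ?thesis using transD[OF tr gs(1)[OF xy]] gha by (simp add: g'_def)
      next
        case 4
        then show ?thesis using gs[OF xy] by (simp add: g'_def)
      qed
    qed
    have "contiguous r s g g'"
      unfolding contiguous_def
    proof (intro allI impI)
      fix u v assume uv: "(u, v) \<in> r"
      then have F: "u \<in> Field r" "v \<in> Field r" by (auto simp: Field_def)
      have m: "(g u, g v) \<in> s" "(g' u, g' v) \<in> s" using gs(1)[OF uv] m' uv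
        by (auto simp: mono_map_def)
      have d: "(g x, g' x) \<in> s" if "x \<in> Field r" for x using gha rs that by (auto simp: g'_def)
      have rr: "(g' x, g' x) \<in> s" if "x \<in> Field r" for x using rs aF that by (auto simp: g'_def)
      have "(g u, g' v) \<in> s" using transD[OF tr m(1) d[OF F(2)]] .
      moreover have "(g' u, g v) \<in> s \<or> (g v, g' u) \<in> s"
      proof (cases "u = a")
        case True
        show ?thesis
        proof (cases "v = a")
          case True
          then show ?thesis using \<open>u = a\<close> gha by (simp add: g'_def)
        next
          case False
          then show ?thesis using \<open>u = a\<close> m(2) by (simp add: g'_def)
        qed
      next
        case False
        then show ?thesis using m(1) by (simp add: g'_def)
      qed
      ultimately show
        "\<forall>x\<in>{g u, g' u, g v, g' v}. \<forall>y\<in>{g u, g' u, g v, g' v}. (x, y) \<in> s \<or> (y, x) \<in> s"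
        using m d[OF F(1)] d[OF F(2)] rr[OF F(1)] rr[OF F(2)] rs(1)[OF F(1)] rs(1)[OF F(2)]
        by (simp add: disj_commute)
    qed
    then have 1: "homotopic_with (\<lambda>_. True) (top_of_set (realization r)) (top_of_set (realization s)) (push_fwd r g) (push_fwd r g')"
      by (rule homotopic_contiguous[OF fr fs])
    have "{x\<in>Field r. g' x \<noteq> h x} = D - {a}" by (auto simp: g'_def D_def)
    then have "card {x\<in>Field r. g' x \<noteq> h x} < card {x\<in>Field r. g x \<noteq> h x}"
      using card_Diff1_less[OF fD a(1)] by (simp add: D_def)
    moreover have "\<forall>x\<in>Field r. (g' x, h x) \<in> s" using le rs by (auto simp: g'_def)
    ultimately have "homotopic_with (\<lambda>_. True) (top_of_set (realization r)) (top_of_set (realization s)) (push_fwd r g') (push_fwd r h)"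
      using less.hyps m' h by blast
    then show ?thesis using 1 homotopic_with_trans by blast
  qed
qed

lemma push_fwd_id:
  assumes "finite (Field r)" "w \<in> realization r"
  shows "push_fwd r id w = w"
proof
  fix v
  have "w v = 0" if "v \<notin> Field r" using assms(2) that
    unfolding realization_iff[OF assms(1)] Field_def by blast
  then show "push_fwd r id w v = w v" using assms(1) by (auto simp: push_fwd_def)
qed

lemma push_fwd_push_fwd:
  assumes "finite (Field r)" "finite (Field s)" "mono_map r s g"
  shows "push_fwd s h (push_fwd r g w) = push_fwd r (h \<circ> g) w"
proof
  fix v
  have "push_fwd s h (push_fwd r g w) v = (\<Sum>x\<in>Field s. \<Sum>u\<in>Field r. if h x = v \<and> g u =
    x then w u else 0)"
    unfolding push_fwd_def by (intro sum.cong) auto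
  also have "\<dots> = (\<Sum>u\<in>Field r. \<Sum>x\<in>Field s. if h x = v \<and> g u = x then w u else 0)" by (rule sum.swap)
  also have "\<dots> = (\<Sum>u\<in>Field r. if h (g u) = v then w u else 0)"
  proof (rule sum.cong)
    fix u assume "u \<in> Field r"
    then have gu: "g u \<in> Field s" using mono_map_Field[OF assms(3)] by blast
    have "(\<Sum>x\<in>Field s. if h x = v \<and> g u = x then w u else 0) = (\<Sum>x\<in>Field s. if g u =
      x then (if h (g u) = v then w u else 0) else 0)"
      by (intro sum.cong) auto
    also have "\<dots> = (if h (g u) = v then w u else 0)" using gu assms(2) by simp
    finally show "(\<Sum>x\<in>Field s. if h x = v \<and> g u = x then w u else 0) = (if h (g u) =
      v then w u else 0)" .
  qed simp
  finally show "push_fwd s h (push_fwd r g w) v = push_fwd r (h \<circ> g) w v"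
    by (simp add: push_fwd_def)
qed

definition push_homotopic :: "'a rel \<Rightarrow> ('a \<Rightarrow> 'a) \<Rightarrow> ('a \<Rightarrow> 'a) \<Rightarrow> bool" where
  "push_homotopic r g h \<longleftrightarrow>
    homotopic_with (\<lambda>_. True) (top_of_set (realization r)) (top_of_set (realization r)) (push_fwd r g) (push_fwd r h)"

lemma homotopy_equivalentI:
  assumes r: "finite_poset r" and s: "finite_poset s" and g: "mono_map r s g"
    and h: "mono_map s r h"
    and 1: "push_homotopic r (h \<circ> g) id" and 2: "push_homotopic s (g \<circ> h) id"
  shows "geometric_realization (order_complex r) homotopy_equivalent_space
    geometric_realization (order_complex s)"
proof -
  have fr: "finite (Field r)" and fs: "finite (Field s)" using r s by (auto simp: finite_poset_def)
  have idr: "homotopic_with (\<lambda>_. True) (top_of_set (realization r)) (top_of_set (realization r)) (push_fwd r id) id"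
    by (rule homotopic_with_equal) (use push_fwd_id[OF fr] continuous_map_push_fwd[OF r r, of id] in \<open>auto simp: mono_map_def\<close>)
  have ids: "homotopic_with (\<lambda>_. True) (top_of_set (realization s)) (top_of_set (realization s)) (push_fwd s id) id"
    by (rule homotopic_with_equal) (use push_fwd_id[OF fs] continuous_map_push_fwd[OF s s, of id] in \<open>auto simp: mono_map_def\<close>)
  have e1: "push_fwd s h \<circ> push_fwd r g = push_fwd r (h \<circ> g)"
    and e2: "push_fwd r g \<circ> push_fwd s h = push_fwd s (g \<circ> h)"
    by (rule ext, simp add: push_fwd_push_fwd[OF fr fs g]) (rule ext, simp add: push_fwd_push_fwd[OF fs fr h])
  have "homotopic_with (\<lambda>_. True) (top_of_set (realization r)) (top_of_set (realization r)) (push_fwd s h \<circ> push_fwd r g) id"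
    unfolding e1 using homotopic_with_trans[OF 1[unfolded push_homotopic_def] idr] .
  moreover have "homotopic_with (\<lambda>_. True) (top_of_set (realization s)) (top_of_set (realization s)) (push_fwd r g \<circ> push_fwd s h) id"
    unfolding e2 using homotopic_with_trans[OF 2[unfolded push_homotopic_def] ids] .
  ultimately show ?thesis unfolding geometric_realization_top_of_set homotopy_equivalent_space_def
    using continuous_map_push_fwd[OF r s g] continuous_map_push_fwd[OF s r h] by blast
qed

lemma push_homotopic_eq:
  assumes r: "finite_poset r" and g: "\<And>x. x \<in> Field r \<Longrightarrow> g x = h x" and h: "mono_map r r h"
  shows "push_homotopic r g h"
proof -
  have "push_fwd r g = push_fwd r h" using g
    by (intro ext) (auto simp: push_fwd_def intro!: sum.cong)
  then show ?thesis unfolding push_homotopic_def using continuous_map_push_fwd[OF r r h] by simp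
qed

subsection \<open>Strict maps of bounded posets\<close>

text \<open>What lets a monotone map restrict to proper parts. The condition concerns preimages:
  only the bottom may reach the bottom, yet it may also be sent elsewhere, and likewise at the
  top.\<close>

definition strict_map :: "'a rel \<Rightarrow> 'a \<Rightarrow> 'a \<Rightarrow> 'b rel \<Rightarrow> 'b \<Rightarrow> 'b \<Rightarrow> ('a \<Rightarrow> 'b) \<Rightarrow> bool" where
  "strict_map r b t s b' t' g \<longleftrightarrow> mono_map r s g \<and>
     (\<forall>x\<in>Field r. (g x = b' \<longrightarrow> x = b) \<and> (g x = t' \<longrightarrow> x = t))"

definition zigzag :: "'a rel \<Rightarrow> 'a \<Rightarrow> 'a \<Rightarrow> (('a \<Rightarrow> 'a) \<times> ('a \<Rightarrow> 'a)) set" where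
  "zigzag r b t = {(g, h). strict_map r b t r b t g \<and> strict_map r b t r b t h \<and>
     ((\<forall>x\<in>Field r. (g x, h x) \<in> r) \<or> (\<forall>x\<in>Field r. (h x, g x) \<in> r))}"

lemma Field_proper_part:
  assumes "finite_poset r"
  shows "Field (proper_part r b t) = Field r - {b, t}"
  using assms unfolding finite_poset_def proper_part_def Field_def by blast

lemma finite_poset_proper_part:
  assumes "finite_poset r"
  shows "finite_poset (proper_part r b t)"
  unfolding finite_poset_def
proof (intro conjI ballI)
  have a: "finite (Field r)" "\<And>x. x\<in>Field r \<Longrightarrow> (x, x) \<in> r" "trans r" "antisym r" using assms
    by (auto simp: finite_poset_def)
  show "finite (Field (proper_part r b t))" using a(1) by (simp add: Field_proper_part[OF assms])
  show "(x, x) \<in> proper_part r b t" if "x \<in> Field (proper_part r b t)" for x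
    using that a(2) unfolding Field_proper_part[OF assms] by (simp add: proper_part_def)
  show "trans (proper_part r b t)" using a(3) unfolding proper_part_def trans_def by blast
  show "antisym (proper_part r b t)" using a(4) unfolding proper_part_def antisym_def by blast
qed

lemma strict_map_proper:
  assumes "strict_map r b t s b' t' g"
  shows "mono_map (proper_part r b t) (proper_part s b' t') g"
  unfolding mono_map_def
proof (intro allI impI)
  fix x y assume "(x, y) \<in> proper_part r b t"
  then have xy: "(x, y) \<in> r" "x \<in> Field r - {b, t}" "y \<in> Field r - {b, t}"
    by (auto simp: proper_part_def)
  have m: "mono_map r s g" using assms by (simp add: strict_map_def)
  have "(g x, g y) \<in> s" using m xy(1) by (simp add: mono_map_def)
  moreover have "g x \<in> Field s - {b', t'}" "g y \<in> Field s - {b', t'}"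
    using assms xy(2,3) mono_map_Field[OF m] by (auto simp: strict_map_def)
  ultimately show "(g x, g y) \<in> proper_part s b' t'" by (simp add: proper_part_def)
qed

lemma zigzag_push_homotopic:
  assumes r: "finite_poset r" and "(g, h) \<in> (zigzag r b t)\<^sup>*" "strict_map r b t r b t g"
  shows "push_homotopic (proper_part r b t) g h"
  using assms(2)
proof (induction rule: rtrancl_induct)
  case base
  then show ?case
    using push_homotopic_eq[OF finite_poset_proper_part[OF r] _ strict_map_proper[OF assms(3)]]
    by blast
next
  case (step h h')
  let ?p = "proper_part r b t"
  note p = finite_poset_proper_part[OF r, of b t]
  have s: "mono_map ?p ?p h" "mono_map ?p ?p h'" using step(2) strict_map_proper
    by (auto simp: zigzag_def)
  have comp: "(g1 x, g2 x) \<in> ?p" if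
    "\<forall>x\<in>Field r. (g1 x, g2 x) \<in> r" "mono_map ?p ?p g1" "mono_map ?p ?p g2" "x \<in> Field ?p"
    for g1 g2 x
    using that mono_map_Field[OF that(2,4)] mono_map_Field[OF that(3,4)]
      unfolding Field_proper_part[OF r]
    by (auto simp: proper_part_def)
  consider "\<forall>x\<in>Field r. (h x, h' x) \<in> r" | "\<forall>x\<in>Field r. (h' x, h x) \<in> r" using step(2)
    by (auto simp: zigzag_def)
  then have "push_homotopic ?p h h'"
  proof cases
    case 1
    then show ?thesis unfolding push_homotopic_def using homotopic_comparable[OF p p s] comp[OF 1 s]
      by blast
  next
    case 2
    then show ?thesis unfolding push_homotopic_def
      using homotopic_comparable[OF p p s(2,1)] comp[OF 2 s(2,1)] homotopic_with_symD by blast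
  qed
  then show ?case using step(3) homotopic_with_trans unfolding push_homotopic_def by blast
qed

definition brel :: "nat \<Rightarrow> nat set rel" where
  "brel k = {(A, B). A \<subseteq> B \<and> B \<subseteq> {..<k}}"

lemma Field_brel: "Field (brel k) = Pow {..<k}"
  by (auto simp: brel_def Field_def)

lemma finite_poset_brel: "finite_poset (brel k)"
  unfolding finite_poset_def Field_brel by (auto simp: brel_def trans_def antisym_def)

text \<open>Requiring the homotopy to run through strict maps of posets, instead of a homotopy equivalence of
  proper parts, makes the following notion stable under products with a chain.\<close>

definition boolean_type :: "'a rel \<Rightarrow> 'a \<Rightarrow> 'a \<Rightarrow> nat \<Rightarrow> bool" where
  "boolean_type r b t k \<longleftrightarrow> (\<exists>\<phi> \<psi>. strict_map r b t (brel k) {} {..<k} \<phi> \<and>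
    strict_map (brel k) {} {..<k} r b t \<psi> \<and>
     (\<forall>A. A \<subseteq> {..<k} \<longrightarrow> \<phi> (\<psi> A) = A) \<and> (\<psi> \<circ> \<phi>, id) \<in> (zigzag r b t)\<^sup>*)"

lemma strict_map_comp:
  assumes "strict_map r b t s b' t' g" "strict_map s b' t' q b'' t'' h"
  shows "strict_map r b t q b'' t'' (h \<circ> g)"
proof -
  have "mono_map r s g" using assms(1) by (simp add: strict_map_def)
  note F = mono_map_Field[OF this]
  show ?thesis using assms F by (auto simp: strict_map_def mono_map_def)
qed

lemma boolean_type_homotopy:
  assumes r: "finite_poset r" and b: "boolean_type r b t k"
  shows "geometric_realization (order_complex (proper_part r b t)) homotopy_equivalent_space
    geometric_realization (order_complex (proper_part (brel k) {} {..<k}))"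
proof -
  obtain \<phi> \<psi>
    where p: "strict_map r b t (brel k) {} {..<k} \<phi>" "strict_map (brel k) {} {..<k} r b t \<psi>"
    "\<And>A. A \<subseteq> {..<k} \<Longrightarrow> \<phi> (\<psi> A) = A" "(\<psi> \<circ> \<phi>, id) \<in> (zigzag r b t)\<^sup>*"
    using b by (auto simp: boolean_type_def)
  show ?thesis
  proof (rule homotopy_equivalentI[OF finite_poset_proper_part[OF r] finite_poset_proper_part[OF finite_poset_brel]
        strict_map_proper[OF p(1)] strict_map_proper[OF p(2)]])
    show "push_homotopic (proper_part r b t) (\<psi> \<circ> \<phi>) id"
      using zigzag_push_homotopic[OF r p(4) strict_map_comp[OF p(1,2)]] .
    show "push_homotopic (proper_part (brel k) {} {..<k}) (\<phi> \<circ> \<psi>) id"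
    proof (rule push_homotopic_eq[OF finite_poset_proper_part[OF finite_poset_brel]])
      show "(\<phi> \<circ> \<psi>) A = id A" if "A \<in> Field (proper_part (brel k) {} {..<k})" for A
        using that p(3) unfolding Field_proper_part[OF finite_poset_brel] Field_brel by simp
    qed (simp add: mono_map_def)
  qed
qed

lemma boolean_type_trivial: "boolean_type {(b, b)} b b 0"
proof -
  have F: "Field {(b, b)} = {b}" by (simp add: Field_def)
  have "strict_map {(b, b)} b b (brel 0) {} {..<0} (\<lambda>_. {})"
    by (simp add: strict_map_def mono_map_def brel_def F)
  moreover have "strict_map (brel 0) {} {..<0} {(b, b)} b b (\<lambda>_. b)"
    by (auto simp: strict_map_def mono_map_def brel_def Field_def)
  moreover have "((\<lambda>_. b) \<circ> (\<lambda>_. {}), id) \<in> zigzag {(b, b)} b b"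
    by (auto simp: zigzag_def strict_map_def mono_map_def F)
  ultimately show ?thesis unfolding boolean_type_def by (intro exI[of _ "\<lambda>_. {}"] exI[of _
    "\<lambda>_. b"]) auto
qed

text \<open>Up to homotopy through strict maps, \<open>P\<close> is \<open>Q\<close> times a two-element
  chain, by sending \<open>x\<close> to the pair of \<open>f x\<close> and its colour.\<close>

lemma boolean_type_suspension:
  fixes P :: "'a rel" and Q :: "'b rel"
  assumes P: "finite_poset P" and Q: "finite_poset Q" and bQ: "b \<in> Field Q" "t \<in> Field Q"
    and f: "mono_map P Q f" and i: "mono_map Q P i" and j: "mono_map Q P j"
    and fi: "\<And>q. q \<in> Field Q \<Longrightarrow> f (i q) = q" and fj: "\<And>q. q \<in> Field Q \<Longrightarrow> f (j q) = q"
    and ij: "\<And>q. q \<in> Field Q \<Longrightarrow> (i q, j q) \<in> P"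
    and upward: "\<And>x y. (x, y) \<in> P \<Longrightarrow> R x \<Longrightarrow> R y"
    and ig: "\<And>q. q \<in> Field Q \<Longrightarrow> \<not> R (i q)" and jr: "\<And>q. q \<in> Field Q \<Longrightarrow> R (j q)"
    and low: "\<And>x. x \<in> Field P \<Longrightarrow> (i (f x), x) \<in> P" and high: "\<And>x. x \<in> Field P \<Longrightarrow> (x, j (f x)) \<in> P"
    and fb: "\<And>x. x \<in> Field P \<Longrightarrow> f x = b \<Longrightarrow> \<not> R x \<Longrightarrow> x = i b"
    and ft: "\<And>x. x \<in> Field P \<Longrightarrow> f x = t \<Longrightarrow> R x \<Longrightarrow> x = j t"
    and k: "boolean_type Q b t k"
  shows "boolean_type P (i b) (j t) (Suc k)"
proof -
  obtain \<phi> \<psi> where \<phi>: "strict_map Q b t (brel k) {} {..<k} \<phi>"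
    and \<psi>: "strict_map (brel k) {} {..<k} Q b t \<psi>"
    and \<phi>\<psi>: "\<And>A. A \<subseteq> {..<k} \<Longrightarrow> \<phi> (\<psi> A) = A" and zz: "(\<psi> \<circ> \<phi>, id) \<in> (zigzag Q b t)\<^sup>*"
    using k by (auto simp: boolean_type_def)
  have trP: "trans P" and rP: "\<And>x. x \<in> Field P \<Longrightarrow> (x, x) \<in> P" and rQ: "\<And>x. x \<in> Field Q \<Longrightarrow> (x, x) \<in> Q"
    using P Q by (auto simp: finite_poset_def)
  note fF = mono_map_Field[OF f] and iF = mono_map_Field[OF i] and jF = mono_map_Field[OF j]
  have FP: "x \<in> Field P" "y \<in> Field P" if "(x, y) \<in> P" for x y using that by (auto simp: Field_def)
  have FQ: "x \<in> Field Q" "y \<in> Field Q" if "(x, y) \<in> Q" for x y using that by (auto simp: Field_def)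
  have fm: "(f x, f y) \<in> Q" if "(x, y) \<in> P" for x y using f that by (simp add: mono_map_def)
  have im: "(i x, i y) \<in> P" and jm: "(j x, j y) \<in> P" and ijm: "(i x, j y) \<in> P" if "(x, y) \<in> Q"
    for x y
  proof -
    show ixy: "(i x, i y) \<in> P" "(j x, j y) \<in> P" using i j that by (simp_all add: mono_map_def)
    show "(i x, j y) \<in> P" by (rule transD[OF trP ixy(1) ij[OF FQ(2)[OF that]]])
  qed
  have ib: "q = b" if "q \<in> Field Q" "i q = i b" for q
    using fi[OF that(1)] fi[OF bQ(1)] unfolding that(2) by (rule trans[OF sym])
  have jt: "q = t" if "q \<in> Field Q" "j q = j t" for q
    using fj[OF that(1)] fj[OF bQ(2)] unfolding that(2) by (rule trans[OF sym])
  have nib: "j q \<noteq> i b" if "q \<in> Field Q" for q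
  proof
    assume "j q = i b"
    then show False using ig[OF bQ(1)] jr[OF that] by simp
  qed
  have njt: "i q \<noteq> j t" if "q \<in> Field Q" for q
  proof
    assume "i q = j t"
    then show False using jr[OF bQ(2)] ig[OF that] by simp
  qed
  \<comment> \<open>A map \<open>g\<close> of \<open>Q\<close> transported to \<open>P\<close>:
    apply it to the image in \<open>Q\<close> and return through the section that belongs to the
    colour.\<close>
  define T where "T g x = (if R x then j (g (f x)) else i (g (f x)))" for g x
  have Ts: "strict_map P (i b) (j t) P (i b) (j t) (T g)" if g: "strict_map Q b t Q b t g" for g
    unfolding strict_map_def
  proof (intro conjI ballI impI)
    have gm: "mono_map Q Q g" using g by (simp add: strict_map_def)
    have gFx: "g (f x) \<in> Field Q" if "x \<in> Field P" for x using mono_map_Field[OF gm fF[OF that]] .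
    show "mono_map P P (T g)"
      unfolding mono_map_def
    proof (intro allI impI)
      fix x y assume xy: "(x, y) \<in> P"
      have gf: "(g (f x), g (f y)) \<in> Q" using gm fm[OF xy] by (simp add: mono_map_def)
      show "(T g x, T g y) \<in> P" using im[OF gf] jm[OF gf] ijm[OF gf] upward[OF xy]
        by (auto simp: T_def)
    qed
    fix x assume x: "x \<in> Field P"
    show "x = i b" if "T g x = i b"
    proof -
      have "\<not> R x" using that nib[OF gFx[OF x]] by (auto simp: T_def)
      then have "g (f x) = b" using ib[OF gFx[OF x]] that by (simp add: T_def)
      then have "f x = b" using g fF[OF x] by (simp add: strict_map_def)
      then show ?thesis using fb[OF x] \<open>\<not> R x\<close> by simp
    qed
    show "x = j t" if "T g x = j t"
    proof -
      have "R x" using that njt[OF gFx[OF x]] by (auto simp: T_def split: if_splits)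
      then have "g (f x) = t" using jt[OF gFx[OF x]] that by (simp add: T_def)
      then have "f x = t" using g fF[OF x] by (simp add: strict_map_def)
      then show ?thesis using ft[OF x] \<open>R x\<close> by simp
    qed
  qed
  have Tz: "(T g, T h) \<in> (zigzag P (i b) (j t))\<^sup>*" if "(g, h) \<in> (zigzag Q b t)\<^sup>*" for g h
    using that
  proof (induction rule: rtrancl_induct)
    case (step h h')
    have "(T h, T h') \<in> zigzag P (i b) (j t)"
    proof -
      have s: "strict_map Q b t Q b t h" "strict_map Q b t Q b t h'" using step(2)
        by (auto simp: zigzag_def)
      have c: "\<forall>x\<in>Field P. (T g1 x, T g2 x) \<in> P" if "\<forall>x\<in>Field Q. (g1 x, g2 x) \<in> Q" for g1 g2
        using that fF im jm by (simp add: T_def)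
      consider "\<forall>x\<in>Field Q. (h x, h' x) \<in> Q" | "\<forall>x\<in>Field Q. (h' x, h x) \<in> Q" using step(2)
        by (auto simp: zigzag_def)
      then show ?thesis
      proof cases
        case 1
        show ?thesis using Ts[OF s(1)] Ts[OF s(2)] c[OF 1] by (simp add: zigzag_def)
      next
        case 2
        show ?thesis using Ts[OF s(1)] Ts[OF s(2)] c[OF 2] by (simp add: zigzag_def)
      qed
    qed
    then show ?case using step(3) by simp
  qed simp
  \<comment> \<open>A link between \<open>T id\<close> and the identity. It lies below both, as it
    differs from the identity only by lowering elements that are not red.\<close>
  define H where "H x = (if R x then x else i (f x))" for x
  have Hs: "strict_map P (i b) (j t) P (i b) (j t) H"
    unfolding strict_map_def
  proof (intro conjI ballI impI)
    show "mono_map P P H"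
      unfolding mono_map_def
    proof (intro allI impI)
      fix x y assume xy: "(x, y) \<in> P"
      show "(H x, H y) \<in> P"
        using xy upward[OF xy] im[OF fm[OF xy]] transD[OF trP low[OF FP(1)[OF xy]] xy]
          by (auto simp: H_def)
    qed
    fix x assume x: "x \<in> Field P"
    show "x = i b" if "H x = i b"
    proof (cases "R x")
      case True
      then show ?thesis using that by (simp add: H_def)
    next
      case False
      then show ?thesis using that ib[OF fF[OF x]] fb[OF x] by (simp add: H_def)
    qed
    show "x = j t" if "H x = j t"
      using that njt[OF fF[OF x]] by (auto simp: H_def split: if_splits)
  qed
  have ids: "strict_map P (i b) (j t) P (i b) (j t) id" "strict_map Q b t Q b t id"
    by (auto simp: strict_map_def mono_map_def)
  have "\<forall>x\<in>Field P. (H x, T id x) \<in> P" using high iF fF rP by (simp add: H_def T_def)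
  then have z1: "(T id, H) \<in> zigzag P (i b) (j t)" using Hs Ts[OF ids(2)] by (simp add: zigzag_def)
  have "\<forall>x\<in>Field P. (H x, id x) \<in> P" using low rP by (simp add: H_def)
  then have z2: "(H, id) \<in> zigzag P (i b) (j t)" using Hs ids(1) by (simp add: zigzag_def)
  \<comment> \<open>The additional element \<open>k\<close> records the colour, so that on
    \<open>P\<close> the composite of the two new maps is
    \<open>T (\<psi> \<circ> \<phi>)\<close>.\<close>
  define \<phi>' where "\<phi>' x = (if R x then insert k (\<phi> (f x)) else \<phi> (f x))" for x
  define \<psi>' where "\<psi>' A = (if k \<in> A then j (\<psi> (A - {k})) else i (\<psi> A))" for A
  have \<phi>F: "\<phi> q \<subseteq> {..<k}" if "q \<in> Field Q" for q
    using mono_map_Field[of Q "brel k" \<phi> q] \<phi> that by (auto simp: strict_map_def Field_brel)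
  have \<psi>F: "\<psi> A \<in> Field Q" if "A \<subseteq> {..<k}" for A
    using mono_map_Field[of "brel k" Q \<psi> A] \<psi> that by (auto simp: strict_map_def Field_brel)
  have dk: "A - {k} \<subseteq> {..<k}" if "A \<subseteq> {..<Suc k}" for A using that by (auto simp: lessThan_Suc)
  have nk: "A \<subseteq> {..<k}" if "A \<subseteq> {..<Suc k}" "k \<notin> A" for A using that by (auto simp: lessThan_Suc)
  have \<phi>'s: "strict_map P (i b) (j t) (brel (Suc k)) {} {..<Suc k} \<phi>'"
    unfolding strict_map_def
  proof (intro conjI ballI impI)
    show "mono_map P (brel (Suc k)) \<phi>'"
      unfolding mono_map_def
    proof (intro allI impI)
      fix x y assume xy: "(x, y) \<in> P"
      have "(\<phi> (f x), \<phi> (f y)) \<in> brel k" using \<phi> fm[OF xy]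
        by (simp add: strict_map_def mono_map_def)
      then show "(\<phi>' x, \<phi>' y) \<in> brel (Suc k)" using upward[OF xy] by (auto simp: \<phi>'_def brel_def)
    qed
    fix x assume x: "x \<in> Field P"
    show "x = i b" if "\<phi>' x = {}"
    proof -
      have "\<not> R x" "\<phi> (f x) = {}" using that by (auto simp: \<phi>'_def split: if_splits)
      then show ?thesis using fb[OF x] \<phi> fF[OF x] by (simp add: strict_map_def)
    qed
    show "x = j t" if "\<phi>' x = {..<Suc k}"
    proof -
      have kk: "k \<notin> \<phi> (f x)" using \<phi>F[OF fF[OF x]] by auto
      have "k \<in> \<phi>' x" using that by simp
      then have R: "R x" using kk by (auto simp: \<phi>'_def split: if_splits)
      then have "insert k (\<phi> (f x)) = insert k {..<k}" using that by (simp add: \<phi>'_def lessThan_Suc)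
      then have "\<phi> (f x) = {..<k}" using kk by (metis insert_ident lessThan_iff less_irrefl)
      then have "f x = t" using \<phi> fF[OF x] by (simp add: strict_map_def)
      then show ?thesis using ft[OF x] R by simp
    qed
  qed
  have \<psi>'s: "strict_map (brel (Suc k)) {} {..<Suc k} P (i b) (j t) \<psi>'"
    unfolding strict_map_def Field_brel
  proof (intro conjI ballI impI)
    have \<psi>m: "(\<psi> A, \<psi> B) \<in> Q" if "A \<subseteq> B" "B \<subseteq> {..<k}" for A B
      using \<psi> that by (simp add: strict_map_def mono_map_def brel_def)
    show "mono_map (brel (Suc k)) P \<psi>'"
      unfolding mono_map_def
    proof (intro allI impI)
      fix A B assume "(A, B) \<in> brel (Suc k)"
      then have AB: "A \<subseteq> B" "B \<subseteq> {..<Suc k}" "A \<subseteq> {..<Suc k}" by (auto simp: brel_def)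
      consider "k \<in> A" "k \<in> B" | "k \<notin> A" "k \<in> B" | "k \<notin> A" "k \<notin> B" using AB by blast
      then show "(\<psi>' A, \<psi>' B) \<in> P"
      proof cases
        case 1
        have "(\<psi> (A - {k}), \<psi> (B - {k})) \<in> Q" using AB dk[OF AB(2)] by (intro \<psi>m) auto
        then show ?thesis using 1 jm by (simp add: \<psi>'_def)
      next
        case 2
        have "(\<psi> A, \<psi> (B - {k})) \<in> Q" using AB 2 dk[OF AB(2)] by (intro \<psi>m) auto
        then show ?thesis using 2 ijm by (simp add: \<psi>'_def)
      next
        case 3
        have "(\<psi> A, \<psi> B) \<in> Q" using AB 3 nk[OF AB(2)] by (intro \<psi>m) auto
        then show ?thesis using 3 im by (simp add: \<psi>'_def)
      qed
    qed
    fix A assume "A \<in> Pow {..<Suc k}"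
    then have A: "A \<subseteq> {..<Suc k}" by simp
    show "A = {}" if "\<psi>' A = i b"
    proof -
      have kA: "k \<notin> A" using that nib[OF \<psi>F[OF dk[OF A]]] by (auto simp: \<psi>'_def)
      then have "\<psi> A = b" using that ib[OF \<psi>F[OF nk[OF A]]] by (simp add: \<psi>'_def)
      then show ?thesis using \<psi> nk[OF A kA] by (simp add: strict_map_def Field_brel)
    qed
    show "A = {..<Suc k}" if "\<psi>' A = j t"
    proof -
      have kA: "k \<in> A" using that njt[OF \<psi>F[OF nk[OF A]]] by (auto simp: \<psi>'_def split: if_splits)
      then have "\<psi> (A - {k}) = t" using that jt[OF \<psi>F[OF dk[OF A]]] by (simp add: \<psi>'_def)
      then have "A - {k} = {..<k}" using \<psi> dk[OF A] by (simp add: strict_map_def Field_brel)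
      then show ?thesis using kA by (auto simp: lessThan_Suc)
    qed
  qed
  have inv: "\<phi>' (\<psi>' A) = A" if A: "A \<subseteq> {..<Suc k}" for A
  proof (cases "k \<in> A")
    case True
    have q: "\<psi> (A - {k}) \<in> Field Q" using \<psi>F[OF dk[OF A]] .
    show ?thesis using True jr[OF q] fj[OF q] \<phi>\<psi>[OF dk[OF A]] by (auto simp: \<phi>'_def \<psi>'_def)
  next
    case False
    have q: "\<psi> A \<in> Field Q" using \<psi>F[OF nk[OF A False]] .
    show ?thesis using False ig[OF q] fi[OF q] \<phi>\<psi>[OF nk[OF A False]] by (simp add: \<phi>'_def \<psi>'_def)
  qed
  have "(\<psi>' \<circ> \<phi>', T (\<psi> \<circ> \<phi>)) \<in> zigzag P (i b) (j t)"
  proof -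
    have "(\<psi>' \<circ> \<phi>') x = T (\<psi> \<circ> \<phi>) x" if x: "x \<in> Field P" for x
    proof -
      have "k \<notin> \<phi> (f x)" using \<phi>F[OF fF[OF x]] by auto
      then show ?thesis by (simp add: \<psi>'_def \<phi>'_def T_def)
    qed
    note eq = this
    note t = Ts[OF strict_map_comp[OF \<phi> \<psi>]]
    then have "mono_map P P (T (\<psi> \<circ> \<phi>))" by (simp add: strict_map_def)
    then have "((\<psi>' \<circ> \<phi>') x, T (\<psi> \<circ> \<phi>) x) \<in> P" if "x \<in> Field P" for x
      unfolding eq[OF that] by (rule rP[OF mono_map_Field[OF _ that]])
    then show ?thesis unfolding zigzag_def mem_Collect_eq prod.case
      using strict_map_comp[OF \<phi>'s \<psi>'s] t by (intro conjI disjI1 ballI)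
  qed
  then have "(\<psi>' \<circ> \<phi>', id) \<in> (zigzag P (i b) (j t))\<^sup>*"
    by (rule converse_rtrancl_into_rtrancl)
      (rule rtrancl_into_rtrancl[OF rtrancl_into_rtrancl[OF Tz[OF zz] z1] z2])
  then show ?thesis unfolding boolean_type_def using \<phi>'s \<psi>'s inv by blast
qed

subsection \<open>The proper part of a Boolean lattice\<close>

text \<open>The point of the orthant that is the sum of the indicator vectors of the sets, weighted
  by \<open>w\<close>. Chains of sets correspond to the cells on which the order of the coordinates
  is fixed.\<close>

definition coord :: "nat \<Rightarrow> (nat set \<Rightarrow> real) \<Rightarrow> nat \<Rightarrow> real" where
  "coord k w i = (\<Sum>A\<in>Pow {..<k}. if i \<in> A then w A else 0)"

definition chainfun :: "nat \<Rightarrow> (nat set \<Rightarrow> real) \<Rightarrow> bool" where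
  "chainfun k w \<longleftrightarrow> (\<forall>A. w A \<ge> 0) \<and> (\<forall>A. w A \<noteq> 0 \<longrightarrow> A \<subseteq> {..<k} \<and> A \<noteq> {}) \<and>
     (\<forall>A B. w A \<noteq> 0 \<longrightarrow> w B \<noteq> 0 \<longrightarrow> A \<subseteq> B \<or> B \<subseteq> A)"

lemma chainfunD:
  assumes "chainfun k w"
  shows "w A \<ge> 0" "w A \<noteq> 0 \<Longrightarrow> A \<subseteq> {..<k}" "w A \<noteq> 0 \<Longrightarrow> A \<noteq> {}"
    "w A \<noteq> 0 \<Longrightarrow> w B \<noteq> 0 \<Longrightarrow> A \<subseteq> B \<or> B \<subseteq> A"
  using assms by (auto simp: chainfun_def)

text \<open>The threshold is the total weight of the supersets of \<open>A\<close>. Every coordinate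
  in \<open>A\<close> collects all of it; outside \<open>A\<close> the weight of \<open>A\<close>
  itself is lost, and only larger sets of the chain can contribute.\<close>

lemma chainfun_superlevel:
  assumes w: "chainfun k w" and A: "w A \<noteq> 0"
  shows "\<exists>c. A = {i. i < k \<and> coord k w i \<ge> c}"
proof -
  note c = chainfunD[OF w]
  define S where "S = (\<Sum>B\<in>Pow {..<k}. if A \<subseteq> B then w B else 0)"
  have ge: "coord k w i \<ge> S" if "i \<in> A" for i
    unfolding coord_def S_def using that c(1) by (intro sum_mono) auto
  have lt: "coord k w i < S" if i: "i \<notin> A" for i
  proof -
    have AP: "A \<in> Pow {..<k}" using c(2)[OF A] by simp
    have "coord k w i = (\<Sum>B\<in>Pow {..<k} - {A}. if i \<in> B then w B else 0)"
      unfolding coord_def using i AP by (subst sum.remove[of _ A]) auto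
    also have "\<dots> \<le> (\<Sum>B\<in>Pow {..<k} - {A}. if A \<subseteq> B then w B else 0)"
    proof (rule sum_mono)
      fix B
      show "(if i \<in> B then w B else 0) \<le> (if A \<subseteq> B then w B else 0)"
      proof (cases "w B = 0")
        case False
        then show ?thesis using c(4)[OF A False] i c(1)[of B] by auto
      qed simp
    qed
    also have "\<dots> < S" unfolding S_def using AP A c(1)[of A] by (subst (2) sum.remove[of _ A]) auto
    finally show ?thesis .
  qed
  have "A = {i. i < k \<and> coord k w i \<ge> S}"
  proof (intro set_eqI iffI)
    fix i assume "i \<in> A"
    then show "i \<in> {i. i < k \<and> coord k w i \<ge> S}" using ge c(2)[OF A] by auto
  next
    fix i assume "i \<in> {i. i < k \<and> coord k w i \<ge> S}"
    then show "i \<in> A" using lt[of i] by (cases "i \<in> A") auto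
  qed
  then show ?thesis by blast
qed

text \<open>Let \<open>A\<close> be a largest set where the weights differ and \<open>i\<close> an
  element of \<open>A\<close> with smallest coordinate. All sets concerned are superlevel sets of
  the same function, so those containing \<open>i\<close> contain \<open>A\<close>. Thus only
  \<open>A\<close> contributes to the difference of the coordinates at \<open>i\<close>.\<close>

lemma coord_inj:
  assumes w: "chainfun k w" and w': "chainfun k w'" and eq: "\<And>i. i < k \<Longrightarrow> coord k w i = coord k w' i"
  shows "w = w'"
proof (rule ccontr)
  assume "w \<noteq> w'"
  define D where "D = {A. w A \<noteq> w' A}"
  have "D \<subseteq> Pow {..<k}"
  proof
    fix A assume "A \<in> D"
    then have "w A \<noteq> 0 \<or> w' A \<noteq> 0" by (auto simp: D_def)
    then show "A \<in> Pow {..<k}" using chainfunD(2)[OF w] chainfunD(2)[OF w'] by blast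
  qed
  then have fD: "finite D" by (rule finite_subset) simp
  have neD: "D \<noteq> {}" using \<open>w \<noteq> w'\<close> by (auto simp: D_def)
  have lev: "\<exists>c. A = {i. i < k \<and> coord k w i \<ge> c}" if "A \<in> D" for A
  proof -
    have "w A \<noteq> 0 \<or> w' A \<noteq> 0" using that by (auto simp: D_def)
    then show ?thesis
    proof
      assume "w' A \<noteq> 0"
      then obtain c where "A = {i. i < k \<and> coord k w' i \<ge> c}" using chainfun_superlevel[OF w']
        by blast
      also have "\<dots> = {i. i < k \<and> coord k w i \<ge> c}" using eq by auto
      finally show ?thesis by blast
    qed (rule chainfun_superlevel[OF w])
  qed
  have "Max (card ` D) \<in> card ` D" using fD neD by (intro Max_in) auto
  then obtain A where A: "A \<in> D" "card A = Max (card ` D)" by force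
  have Amax: "card B \<le> card A" if "B \<in> D" for B using that fD A(2) by simp
  have "w A \<noteq> 0 \<or> w' A \<noteq> 0" using A by (auto simp: D_def)
  then have neA: "A \<noteq> {}" and sA: "A \<subseteq> {..<k}"
    using chainfunD(2,3)[OF w] chainfunD(2,3)[OF w'] by blast+
  then have fA: "finite A" by (auto intro: finite_subset)
  have "Min (coord k w ` A) \<in> coord k w ` A" using fA neA by (intro Min_in) auto
  then obtain i where i: "i \<in> A" "coord k w i = Min (coord k w ` A)" by force
  have imin: "coord k w i \<le> coord k w j" if "j \<in> A" for j using that fA i(2) by simp
  have only: "C = A" if C: "C \<in> D" "i \<in> C" for C
  proof -
    obtain c where c: "C = {i. i < k \<and> coord k w i \<ge> c}" using lev[OF C(1)] by blast
    have "coord k w i \<ge> c" using C(2) unfolding c by simp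
    then have "A \<subseteq> C" unfolding c using imin sA by fastforce
    moreover have "finite C" unfolding c by simp
    ultimately show ?thesis using Amax[OF C(1)] card_seteq by blast
  qed
  have "coord k w i - coord k w' i = (\<Sum>C\<in>Pow {..<k}. if i \<in> C then w C - w' C else 0)"
    unfolding coord_def sum_subtractf[symmetric] by (intro sum.cong) auto
  also have "\<dots> = (\<Sum>C\<in>{A}. if i \<in> C then w C - w' C else 0)"
    using sA only by (intro sum.mono_neutral_right) (auto simp: D_def)
  also have "\<dots> = w A - w' A" using i by simp
  finally show False using eq[of i] i(1) sA A(1) by (auto simp: D_def)
qed

text \<open>The smallest positive value becomes the weight of the set \<open>P\<close> of all
  positive coordinates. After subtracting it on \<open>P\<close>, fewer coordinates are positive,
  and the remaining chain lies strictly inside \<open>P\<close>.\<close>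

lemma coord_surj:
  assumes "\<And>i. i < k \<Longrightarrow> x i \<ge> 0"
  shows "\<exists>w. chainfun k w \<and> (\<forall>A. w A \<noteq> 0 \<longrightarrow> A \<subseteq> {i. i < k \<and> x i > 0}) \<and> (\<forall>i<k. coord k w i = x i)"
  using assms
proof (induction "card {i. i < k \<and> x i > 0}" arbitrary: x rule: less_induct)
  case less
  define P where "P = {i. i < k \<and> x i > 0}"
  have fP: "finite P" by (simp add: P_def)
  have x0: "x i = 0" if "i < k" "i \<notin> P" for i using less.prems[OF that(1)] that by (simp add: P_def)
  show ?case
  proof (cases "P = {}")
    case True
    have "chainfun k (\<lambda>_. 0)" by (simp add: chainfun_def)
    moreover have "coord k (\<lambda>_. 0) i = x i" if "i < k" for i using x0[OF that] True
      by (simp add: coord_def)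
    ultimately show ?thesis by (intro exI[of _ "\<lambda>_. 0"]) auto
  next
    case False
    define c where "c = Min (x ` P)"
    have "c \<in> x ` P" unfolding c_def using fP False by (intro Min_in) auto
    then obtain p where p: "p \<in> P" "x p = c" by blast
    have cmin: "c \<le> x i" if "i \<in> P" for i using that fP by (simp add: c_def)
    have c0: "c > 0" using p by (auto simp: P_def)
    define x' where "x' i = (if i \<in> P then x i - c else x i)" for i
    have x'nn: "x' i \<ge> 0" if "i < k" for i using cmin less.prems[OF that] by (simp add: x'_def)
    have sub: "{i. i < k \<and> x' i > 0} \<subseteq> P - {p}"
    proof
      fix i assume i: "i \<in> {i. i < k \<and> x' i > 0}"
      have "i \<in> P"
      proof (rule ccontr)
        assume "i \<notin> P"
        then show False using i x0[of i] by (simp add: x'_def)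
      qed
      moreover have "i \<noteq> p" using i p by (auto simp: x'_def)
      ultimately show "i \<in> P - {p}" by blast
    qed
    then have "card {i. i < k \<and> x' i > 0} \<le> card (P - {p})" using fP by (intro card_mono) auto
    also have "\<dots> < card P" using fP p(1) by (intro card_Diff1_less)
    finally have lt: "card {i. i < k \<and> x' i > 0} < card {i. i < k \<and> x i > 0}" by (simp add: P_def)
    obtain w where w: "chainfun k w" "\<And>A. w A \<noteq> 0 \<Longrightarrow> A \<subseteq> {i. i < k \<and> x' i > 0}"
      "\<And>i. i < k \<Longrightarrow> coord k w i = x' i"
      using less.hyps[OF lt x'nn] by blast
    have wP: "A \<subset> P" if "w A \<noteq> 0" for A using w(2)[OF that] sub p(1) by blast
    then have wP0: "w P = 0" by blast
    define v where "v = w(P := c)"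
    have Pk: "P \<subseteq> {..<k}" by (auto simp: P_def)
    have "chainfun k v"
      unfolding chainfun_def
    proof (intro conjI allI impI)
      show "v A \<ge> 0" for A using chainfunD(1)[OF w(1)] c0 by (simp add: v_def)
      show "A \<subseteq> {..<k}" "A \<noteq> {}" if "v A \<noteq> 0" for A
        using chainfunD(2,3)[OF w(1), of A] that Pk False by (auto simp: v_def split: if_splits)
      show "A \<subseteq> B \<or> B \<subseteq> A" if "v A \<noteq> 0" "v B \<noteq> 0" for A B
        using chainfunD(4)[OF w(1), of A B] wP[of A] wP[of B] that
          by (auto simp: v_def split: if_splits)
    qed
    moreover have "A \<subseteq> {i. i < k \<and> x i > 0}" if "v A \<noteq> 0" for A
      using that wP[of A] unfolding P_def[symmetric] by (auto simp: v_def split: if_splits)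
    moreover have "coord k v i = x i" if "i < k" for i
    proof -
      have "coord k v i = (\<Sum>A\<in>Pow {..<k}. (if i \<in> A then w A else 0) + (if A =
        P then (if i \<in> P then c else 0) else 0))"
        unfolding coord_def v_def using wP0 by (intro sum.cong) auto
      also have "\<dots> = coord k w i + (if i \<in> P then c else 0)"
        unfolding sum.distrib coord_def using Pk by simp
      finally show ?thesis using w(3)[OF that] by (simp add: x'_def)
    qed
    ultimately show ?thesis by blast
  qed
qed

lemma coord_bounds:
  assumes w: "chainfun k w"
  shows "0 \<le> coord k w i" "coord k w i \<le> (\<Sum>A\<in>Pow {..<k}. w A)"
  using chainfunD(1)[OF w] unfolding coord_def by (auto intro!: sum_nonneg sum_mono)

text \<open>Elements of the smallest set of the chain lie in all its sets and collect the total
  weight. If the full set carries no weight, elements outside the largest set of the chain collect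
  nothing.\<close>

lemma coord_extremes:
  assumes w: "chainfun k w" and nz: "w A0 \<noteq> 0"
  shows "\<exists>i<k. coord k w i = (\<Sum>A\<in>Pow {..<k}. w A)" "w {..<k} = 0 \<Longrightarrow> \<exists>i<k. coord k w i = 0"
proof -
  note c = chainfunD[OF w]
  define D where "D = {A. w A \<noteq> 0}"
  have "D \<subseteq> Pow {..<k}" using c(2) by (auto simp: D_def)
  then have fD: "finite D" and neD: "D \<noteq> {}" using nz by (auto simp: D_def intro: finite_subset)
  have fin: "finite A" if "A \<in> D" for A using that c(2)[of A] finite_subset[of A "{..<k}"]
    by (simp add: D_def)
  have ch: "A \<subseteq> B \<or> B \<subseteq> A" if "A \<in> D" "B \<in> D" for A B using c(4) that by (simp add: D_def)
  have "Min (card ` D) \<in> card ` D" "Max (card ` D) \<in> card ` D" using fD neD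
    by (auto intro!: Min_in Max_in)
  then obtain A B where A: "A \<in> D" "card A = Min (card ` D)"
    and B: "B \<in> D" "card B = Max (card ` D)" by force
  have Amin: "A \<subseteq> C" if "C \<in> D" for C
  proof -
    have "card A \<le> card C" using that fD A(2) by simp
    then show ?thesis using ch[OF that A(1)] card_seteq[OF fin[OF A(1)], of C] by blast
  qed
  have Bmax: "C \<subseteq> B" if "C \<in> D" for C
  proof -
    have "card C \<le> card B" using that fD B(2) by simp
    then show ?thesis using ch[OF that B(1)] card_seteq[OF fin[OF that], of B] by blast
  qed
  obtain i where i: "i \<in> A" using c(3)[of A] A by (auto simp: D_def)
  have "coord k w i = (\<Sum>A\<in>Pow {..<k}. w A)"
    unfolding coord_def using Amin i by (intro sum.cong) (auto simp: D_def)
  then show "\<exists>i<k. coord k w i = (\<Sum>A\<in>Pow {..<k}. w A)" using i c(2)[of A] A by (auto simp: D_def)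
  assume "w {..<k} = 0"
  then have "B \<noteq> {..<k}" using B by (auto simp: D_def)
  moreover have "B \<subseteq> {..<k}" using B c(2)[of B] by (simp add: D_def)
  ultimately obtain j where j: "j < k" "j \<notin> B" by auto
  have "coord k w j = 0"
    unfolding coord_def using Bmax j by (intro sum.neutral) (auto simp: D_def)
  then show "\<exists>i<k. coord k w i = 0" using j by blast
qed

lemma realization_boolean:
  "w \<in> realization (proper_part (brel k) {} {..<k}) \<longleftrightarrow>
     chainfun k w \<and> w {..<k} = 0 \<and> (\<Sum>A\<in>Pow {..<k}. w A) = 1"
proof -
  let ?p = "proper_part (brel k) {} {..<k}"
  have F: "Field ?p = Pow {..<k} - {{}, {..<k}}"
    using Field_proper_part[OF finite_poset_brel] Field_brel by metis
  have fF: "finite (Field ?p)" unfolding F by simp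
  have rel: "(A, B) \<in> ?p \<longleftrightarrow> A \<subseteq> B \<and> A \<in> Field ?p \<and> B \<in> Field ?p" for A B
    unfolding F by (auto simp: proper_part_def brel_def Field_brel[unfolded brel_def])
  have s: "(\<Sum>A\<in>Field ?p. w A) = (\<Sum>A\<in>Pow {..<k}. w A)" if "\<And>A. w A \<noteq> 0 \<Longrightarrow> A \<in> Field ?p"
    using that unfolding F by (intro sum.mono_neutral_left) auto
  show ?thesis
  proof
    assume "w \<in> realization ?p"
    then have w: "\<And>v. w v \<ge> 0" "\<And>u v. w u \<noteq> 0 \<Longrightarrow> w v \<noteq> 0 \<Longrightarrow> (u, v) \<in> ?p \<or> (v, u) \<in> ?p"
      "(\<Sum>A\<in>Field ?p. w A) = 1" unfolding realization_iff[OF fF] by blast+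
    have wF: "A \<in> Field ?p" if "w A \<noteq> 0" for A using w(2)[OF that that] rel by blast
    have "chainfun k w" unfolding chainfun_def
    proof (intro conjI allI impI)
      show "0 \<le> w A" for A using w(1) .
      show "A \<subseteq> {..<k}" "A \<noteq> {}" if "w A \<noteq> 0" for A using wF[OF that] unfolding F by auto
      show "A \<subseteq> B \<or> B \<subseteq> A" if "w A \<noteq> 0" "w B \<noteq> 0" for A B using w(2)[OF that] rel by blast
    qed
    moreover have "w {..<k} = 0" using wF[of "{..<k}"] unfolding F by auto
    ultimately show "chainfun k w \<and> w {..<k} = 0 \<and> (\<Sum>A\<in>Pow {..<k}. w A) = 1" using s[OF wF] w(3)
      by simp
  next
    assume a: "chainfun k w \<and> w {..<k} = 0 \<and> (\<Sum>A\<in>Pow {..<k}. w A) = 1"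
    then have cf: "chainfun k w" by simp
    note c = chainfunD[OF cf]
    have wF: "A \<in> Field ?p" if "w A \<noteq> 0" for A
    proof -
      have "A \<noteq> {..<k}" using a that by auto
      then show ?thesis unfolding F using c(2,3)[OF that] by simp
    qed
    show "w \<in> realization ?p" unfolding realization_iff[OF fF]
    proof (intro conjI allI impI)
      show "0 \<le> w A" for A using c(1) .
      show "(A, B) \<in> ?p \<or> (B, A) \<in> ?p" if "w A \<noteq> 0" "w B \<noteq> 0" for A B
        using c(4)[OF that] wF[OF that(1)] wF[OF that(2)] rel by blast
      show "(\<Sum>A\<in>Field ?p. w A) = 1" using s[OF wF] a by simp
    qed
  qed
qed

lemma compact_realization:
  assumes r: "finite (Field r)"
  shows "compact (realization r)"
proof -
  have coord: "continuous_on UNIV (\<lambda>w::'a \<Rightarrow> real. w v)" for v by simp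
  have "closed (realization r)"
  proof -
    have "realization r = {w. (\<forall>v. w v \<ge> 0) \<and> (\<forall>u v. (u, v) \<in> r \<or> (v, u) \<in> r \<or> w u * w v = 0) \<and>
      (\<Sum>v\<in>Field r. w v) = 1}"
      by (intro set_eqI) (auto simp: realization_iff[OF r])
    moreover have "closed {w::'a \<Rightarrow> real. \<forall>v. w v \<ge> 0}"
      by (intro closed_Collect_all closed_Collect_le continuous_on_const coord)
    moreover have "closed {w::'a \<Rightarrow> real. (u, v) \<in> r \<or> (v, u) \<in> r \<or> w u * w v = 0}" for u v
    proof (cases "(u, v) \<in> r \<or> (v, u) \<in> r")
      case True
      then have "{w::'a \<Rightarrow> real. (u, v) \<in> r \<or> (v, u) \<in> r \<or> w u * w v = 0} = UNIV" by blast
      then show ?thesis by simp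
    next
      case False
      then have eq: "{w::'a \<Rightarrow> real. (u, v) \<in> r \<or> (v, u) \<in> r \<or> w u * w v = 0} = {w. w u * w v = 0}"
        by blast
      show ?thesis unfolding eq
        by (intro closed_Collect_eq continuous_on_mult continuous_on_const coord)
    qed
    then have "closed {w::'a \<Rightarrow> real. \<forall>u v. (u, v) \<in> r \<or> (v, u) \<in> r \<or> w u * w v = 0}"
      by (intro closed_Collect_all)
    moreover have "closed {w::'a \<Rightarrow> real. (\<Sum>v\<in>Field r. w v) = 1}"
      by (intro closed_Collect_eq continuous_on_sum continuous_on_const coord)
    ultimately show ?thesis by (simp only: closed_Collect_conj)
  qed
  moreover have "compact (PiE UNIV (\<lambda>_::'a. {0..1::real}))"
    using compactin_PiE[of "\<lambda>_::'a. euclideanreal" UNIV "\<lambda>_. {0..1}"]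
    by (simp add: euclidean_product_topology)
  moreover have "realization r \<subseteq> PiE UNIV (\<lambda>_::'a. {0..1::real})"
  proof
    fix w assume w: "w \<in> realization r"
    have "w v \<le> 1" for v
    proof (cases "v \<in> Field r")
      case True
      then have "w v \<le> (\<Sum>v\<in>Field r. w v)" using r w unfolding realization_iff[OF r]
        by (intro member_le_sum) auto
      then show ?thesis using w unfolding realization_iff[OF r] by simp
    next
      case False
      then have "w v = 0" using w unfolding realization_iff[OF r] Field_def by blast
      then show ?thesis by simp
    qed
    then show "w \<in> PiE UNIV (\<lambda>_::'a. {0..1::real})" using w unfolding realization_iff[OF r] by auto
  qed
  ultimately show ?thesis using compact_Int_closed by (metis inf.absorb_iff2)
qed

text \<open>Subtracting the last coordinate passes to vectors modulo constants; the result is scaled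
  to norm 1. Modulo constants, each ray meets the set given by \<open>unit_range\<close> below
  exactly once.\<close>

definition radial :: "nat \<Rightarrow> (nat \<Rightarrow> real) \<Rightarrow> nat \<Rightarrow> real" where
  "radial l x i = (if i < l then (x i - x l) / sqrt (\<Sum>j<l. (x j - x l)\<^sup>2) else 0)"

definition unit_range :: "nat \<Rightarrow> (nat \<Rightarrow> real) \<Rightarrow> bool" where
  "unit_range l x \<longleftrightarrow> (\<forall>i\<le>l. 0 \<le> x i \<and> x i \<le> 1) \<and> (\<exists>i\<le>l. x i = 0) \<and> (\<exists>i\<le>l. x i = 1)"

lemma unit_range_norm:
  assumes "unit_range l x"
  shows "(\<Sum>j<l. (x j - x l)\<^sup>2) > 0"
proof -
  obtain i i' where i: "i \<le> l" "x i = 0" "i' \<le> l" "x i' = 1" using assms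
    by (auto simp: unit_range_def)
  obtain j where j: "j < l" "x j - x l \<noteq> 0"
  proof (cases "x l = 0")
    case True
    then have "i' < l" using i by (metis le_neq_implies_less zero_neq_one)
    then show ?thesis using that[of i'] i True by simp
  next
    case False
    then have "i < l" using i by (metis le_neq_implies_less)
    then show ?thesis using that[of i] i False by simp
  qed
  have "0 < (x j - x l)\<^sup>2" using j by simp
  also have "\<dots> \<le> (\<Sum>j<l. (x j - x l)\<^sup>2)" using j by (intro member_le_sum) auto
  finally show ?thesis .
qed

text \<open>Equal images mean that all differences of coordinates agree up to a positive factor
  \<open>s\<close>. In both vectors the largest difference is 1, so \<open>s = 1\<close>; comparing
  minima removes the remaining constant.\<close>

lemma radial_inj:
  assumes x: "unit_range l x" and y: "unit_range l y" and eq: "radial l x = radial l y"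
    and i: "i \<le> l"
  shows "x i = y i"
proof -
  define a where "a = sqrt (\<Sum>j<l. (x j - x l)\<^sup>2)"
  define b where "b = sqrt (\<Sum>j<l. (y j - y l)\<^sup>2)"
  have ab: "a > 0" "b > 0" using unit_range_norm[OF x] unit_range_norm[OF y]
    by (auto simp: a_def b_def)
  have q: "(x j - x l) / a = (y j - y l) / b" if "j \<le> l" for j
  proof (cases "j = l")
    case False
    then show ?thesis using fun_cong[OF eq, of j] that by (simp add: radial_def a_def b_def)
  qed simp
  define s where "s = a / b"
  have s: "s > 0" using ab by (simp add: s_def)
  have ds: "x j - x l = s * (y j - y l)" if "j \<le> l" for j
    using q[OF that] ab by (simp add: s_def field_simps)
  have d: "x j - x m = s * (y j - y m)" if "j \<le> l" "m \<le> l" for j m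
    using ds[OF that(1)] ds[OF that(2)] by (simp add: algebra_simps)
  obtain p p' where p: "p \<le> l" "x p = 0" "p' \<le> l" "x p' = 1" using x by (auto simp: unit_range_def)
  obtain r r' where r: "r \<le> l" "y r = 0" "r' \<le> l" "y r' = 1" using y by (auto simp: unit_range_def)
  have bx: "0 \<le> x j" "x j \<le> 1" and b_y: "0 \<le> y j" "y j \<le> 1" if "j \<le> l" for j
    using x y that by (auto simp: unit_range_def)
  have "1 = s * (y p' - y p)" using d[OF p(3,1)] p by simp
  also have "\<dots> \<le> s * 1" using s b_y[OF p(1)] b_y[OF p(3)] by (intro mult_left_mono) auto
  finally have "s \<ge> 1" by simp
  moreover have "s = x r' - x r" using d[OF r(3,1)] r by simp
  then have "s \<le> 1" using bx[OF r(1)] bx[OF r(3)] by linarith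
  ultimately have s1: "s = 1" by simp
  have "0 - y p = x r - 0" using d[OF r(1) p(1)] p r s1 by simp
  then have "y p = 0" using bx[OF r(1)] b_y[OF p(1)] by linarith
  then show ?thesis using d[OF i p(1)] p s1 by simp
qed

lemma radial_sphere:
  assumes "unit_range l x"
  shows "(\<Sum>i<l. (radial l x i)\<^sup>2) = 1"
proof -
  have "(\<Sum>i<l. (radial l x i)\<^sup>2) = (\<Sum>i<l. (x i - x l)\<^sup>2 / (\<Sum>j<l. (x j - x l)\<^sup>2))"
    using unit_range_norm[OF assms] by (intro sum.cong) (auto simp: radial_def power_divide)
  also have "\<dots> = 1" using unit_range_norm[OF assms] by (simp add: sum_divide_distrib[symmetric])
  finally show ?thesis .
qed

text \<open>The preimage is \<open>y\<close> normalized affinely to minimum 0 and maximum 1, both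
  taken over the indices up to \<open>l\<close>, where \<open>y l = 0\<close>.\<close>

lemma radial_surj:
  assumes y: "(\<Sum>i<l. (y i)\<^sup>2) = 1" "\<And>i. i \<ge> l \<Longrightarrow> y i = 0"
  obtains x where "unit_range l x" "radial l x = y"
proof -
  define m where "m = Min (y ` {..l})"
  define M where "M = Max (y ` {..l})"
  have bd: "m \<le> y i" "y i \<le> M" if "i \<le> l" for i using that by (auto simp: m_def M_def)
  have "m \<in> y ` {..l}" "M \<in> y ` {..l}" unfolding m_def M_def by (auto intro!: Min_in Max_in)
  then obtain p q where p: "p \<le> l" "y p = m" and q: "q \<le> l" "y q = M" by auto
  have "\<exists>i<l. y i \<noteq> 0"
  proof (rule ccontr)
    assume "\<not> ?thesis"
    then have "(\<Sum>i<l. (y i)\<^sup>2) = 0" by (intro sum.neutral) auto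
    then show False using y(1) by simp
  qed
  then obtain i where i: "i < l" "y i \<noteq> 0" by blast
  have lt: "m < M" using bd[of i] bd[of l] i y(2)[of l] by auto
  define x where "x i = (y i - m) / (M - m)" for i
  have "unit_range l x" unfolding unit_range_def
  proof (intro conjI allI impI)
    show "0 \<le> x i" "x i \<le> 1" if "i \<le> l" for i using bd[OF that] lt by (auto simp: x_def)
    show "\<exists>i\<le>l. x i = 0" using p by (intro exI[of _ p]) (simp add: x_def)
    show "\<exists>i\<le>l. x i = 1" using q lt by (intro exI[of _ q]) (simp add: x_def)
  qed
  moreover have "radial l x = y"
  proof
    fix i
    have xd: "x j - x l = y j / (M - m)" for j using y(2)[of l]
      by (simp add: x_def diff_divide_distrib)
    have "(\<Sum>j<l. (x j - x l)\<^sup>2) = (\<Sum>j<l. (y j)\<^sup>2) / (M - m)\<^sup>2"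
      by (simp add: xd power_divide sum_divide_distrib)
    then have "sqrt (\<Sum>j<l. (x j - x l)\<^sup>2) = 1 / (M - m)" using y(1) lt
      by (simp add: real_sqrt_divide)
    then show "radial l x i = y i" using y(2)[of i] lt by (simp add: radial_def xd)
  qed
  ultimately show ?thesis using that by blast
qed

lemma coord_unit_range:
  assumes "w \<in> realization (proper_part (brel (Suc l)) {} {..<Suc l})"
  shows "unit_range l (coord (Suc l) w)"
proof -
  have w: "chainfun (Suc l) w" "w {..<Suc l} = 0" "(\<Sum>A\<in>Pow {..<Suc l}. w A) = 1" using assms
    unfolding realization_boolean by auto
  have "\<exists>A. w A \<noteq> 0"
  proof (rule ccontr)
    assume "\<not> ?thesis"
    then have "(\<Sum>A\<in>Pow {..<Suc l}. w A) = 0" by (intro sum.neutral) auto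
    then show False using w(3) by simp
  qed
  then obtain A0 where "w A0 \<noteq> 0" by blast
  then show ?thesis
    using coord_extremes[OF w(1)] w(2,3) coord_bounds[OF w(1)]
      by (auto simp: unit_range_def less_Suc_eq_le)
qed

lemma unit_range_coord:
  assumes x: "unit_range l x"
  obtains w where "w \<in> realization (proper_part (brel (Suc l)) {} {..<Suc l})"
    "\<And>i. i \<le> l \<Longrightarrow> coord (Suc l) w i = x i"
proof -
  have "x i \<ge> 0" if "i < Suc l" for i using x that by (auto simp: unit_range_def)
  then obtain w where w: "chainfun (Suc l) w" "\<And>A. w A \<noteq> 0 \<Longrightarrow> A \<subseteq> {i. i < Suc l \<and> x i > 0}"
    "\<And>i. i < Suc l \<Longrightarrow> coord (Suc l) w i = x i" using coord_surj[of "Suc l" x] by blast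
  have c: "coord (Suc l) w i = x i" if "i \<le> l" for i using w(3) that by simp
  obtain p q where p: "p \<le> l" "x p = 0" and q: "q \<le> l" "x q = 1" using x
    by (auto simp: unit_range_def)
  have top: "w {..<Suc l} = 0"
  proof (rule ccontr)
    assume "w {..<Suc l} \<noteq> 0"
    then have "p \<in> {i. i < Suc l \<and> x i > 0}" using w(2) p(1)
      by (meson lessThan_iff less_Suc_eq_le subsetD)
    then show False using p(2) by simp
  qed
  have "\<exists>A. w A \<noteq> 0"
  proof (rule ccontr)
    assume "\<not> ?thesis"
    then have "coord (Suc l) w q = 0" unfolding coord_def by (intro sum.neutral) auto
    then show False using c[OF q(1)] q(2) by simp
  qed
  then obtain A0 where A0: "w A0 \<noteq> 0" by blast
  obtain i where i: "i < Suc l" "coord (Suc l) w i = (\<Sum>A\<in>Pow {..<Suc l}. w A)"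
    using coord_extremes(1)[OF w(1) A0] by blast
  moreover have "x i \<le> 1" using x i(1) by (simp add: unit_range_def)
  ultimately have "(\<Sum>A\<in>Pow {..<Suc l}. w A) \<le> 1" using c[of i] by simp
  moreover have "(\<Sum>A\<in>Pow {..<Suc l}. w A) \<ge> 1" using coord_bounds(2)[OF w(1), of q] c[OF q(1)] q(2)
    by simp
  ultimately have "w \<in> realization (proper_part (brel (Suc l)) {} {..<Suc l})"
    unfolding realization_boolean using w(1) top by simp
  then show ?thesis using that c by blast
qed

text \<open>For \<open>k\<close> at most 1 both spaces are empty. Otherwise they are homeomorphic,
  by a continuous bijection from a compact onto a Hausdorff space.\<close>

lemma boolean_sphere:
  "geometric_realization (order_complex (proper_part (brel k) {} {..<k})) homotopy_equivalent_space
     sphere_space (int k - 2)"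
proof (cases "k \<ge> 2")
  case False
  let ?p = "proper_part (brel k) {} {..<k}"
  have "realization ?p = {}"
  proof (rule ccontr)
    assume "realization ?p \<noteq> {}"
    then obtain w where w: "chainfun k w" "w {..<k} = 0" "(\<Sum>A\<in>Pow {..<k}. w A) = 1"
      unfolding ex_in_conv[symmetric] realization_boolean by blast
    have "w A = 0" for A
    proof (rule ccontr)
      assume a: "w A \<noteq> 0"
      then have "A \<subseteq> {..<k}" "A \<noteq> {}" using chainfunD[OF w(1)] by blast+
      moreover have "k = 0 \<or> k = 1" using False by linarith
      ultimately have "A = {..<k}" by (auto simp: lessThan_Suc)
      then show False using a w(2) by simp
    qed
    then show False using w(3) by simp
  qed
  then have "geometric_realization (order_complex ?p) = trivial_topology"
    unfolding geometric_realization_top_of_set by simp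
  moreover have "sphere_space (int k - 2) = trivial_topology" using False
    by (simp add: sphere_space_def)
  ultimately show ?thesis
    using homeomorphic_imp_homotopy_equivalent_space homeomorphic_empty_space_eq by metis
next
  case True
  \<comment> \<open>\<open>l\<close> is the index of the last coordinate and also the number of
    coordinates of the sphere, whose dimension is therefore \<open>l - 1\<close>.\<close>
  define l where "l = k - 1"
  have l: "k = Suc l" "l \<ge> 1" "nat (int k - 2) = l - 1" using True by (auto simp: l_def)
  let ?p = "proper_part (brel k) {} {..<k}"
  define Y where "Y = {y::nat \<Rightarrow> real. (\<Sum>i<l. (y i)\<^sup>2) = 1 \<and> (\<forall>i\<ge>l. y i = 0)}"
  have "{..l - 1} = {..<l}" "(\<forall>i>l - 1. y i = 0) \<longleftrightarrow> (\<forall>i\<ge>l. y i = 0)" for y :: "nat \<Rightarrow> real"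
    using l(2) by (auto simp: Suc_le_eq[symmetric])
  then have sp: "sphere_space (int k - 2) = top_of_set Y"
    using True unfolding sphere_space_def l(3) nsphere Y_def
      by (simp add: euclidean_product_topology)
  define F where "F w = radial l (coord k w)" for w
  have ur: "unit_range l (coord k w)" if "w \<in> realization ?p" for w
    using coord_unit_range[of w l] that l(1) by simp
  have fF: "finite (Field ?p)" using finite_poset_proper_part[OF finite_poset_brel]
    by (simp add: finite_poset_def)
  have cc: "continuous_on (realization ?p) (\<lambda>w. coord k w i)" for i
  proof -
    have "continuous_on (realization ?p) (\<lambda>w. if i \<in> A then w A else 0)" for A
      using continuous_on_subset[OF continuous_on_product_coordinates[of A] subset_UNIV]
        by (cases "i \<in> A") auto
    then show ?thesis unfolding coord_def by (intro continuous_on_sum)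
  qed
  have "homeomorphic_map (top_of_set (realization ?p)) (top_of_set Y) F"
  proof (rule continuous_imp_homeomorphic_map)
    have "continuous_on (realization ?p) F"
    proof (rule continuous_on_coordinatewise_then_product)
      fix i
      show "continuous_on (realization ?p) (\<lambda>w. F w i)"
      proof (cases "i < l")
        case True
        have "sqrt (\<Sum>j<l. (coord k w j - coord k w l)\<^sup>2) \<noteq> 0" if "w \<in> realization ?p" for w
          using unit_range_norm[OF ur[OF that]] by simp
        then have "continuous_on (realization ?p) (\<lambda>w. (coord k w i - coord k w l) / sqrt (\<Sum>j<l. (coord k w j - coord k w l)\<^sup>2))"
          by (intro continuous_intros cc) auto
        then show ?thesis using True by (simp add: F_def radial_def)
      next
        case False
        then show ?thesis by (simp add: F_def radial_def)
      qed
    qed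
    moreover have "F w \<in> Y" if "w \<in> realization ?p" for w
      using radial_sphere[OF ur[OF that]] by (simp add: F_def Y_def radial_def)
    ultimately show "continuous_map (top_of_set (realization ?p)) (top_of_set Y) F" by auto
    show "compact_space (top_of_set (realization ?p))" using compact_realization[OF fF]
      by (simp add: compact_space_subtopology)
    have "Hausdorff_space (powertop_real (UNIV :: nat set))"
      unfolding Hausdorff_space_product_topology by simp
    then show "Hausdorff_space (top_of_set Y)"
      unfolding euclidean_product_topology by (rule Hausdorff_space_subtopology)
    show "inj_on F (topspace (top_of_set (realization ?p)))"
    proof (rule inj_onI)
      fix w w' assume w: "w \<in> topspace (top_of_set (realization ?p))" "w' \<in> topspace (top_of_set (realization ?p))" and eq: "F w = F w'"
      then have w: "w \<in> realization ?p" "w' \<in> realization ?p" by auto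
      show "w = w'"
      proof (rule coord_inj[of k])
        show "chainfun k w" "chainfun k w'" using w unfolding realization_boolean by auto
        show "coord k w i = coord k w' i" if "i < k" for i
          using radial_inj[OF ur[OF w(1)] ur[OF w(2)] eq[unfolded F_def], of i] that l(1) by simp
      qed
    qed
    show "F ` topspace (top_of_set (realization ?p)) = topspace (top_of_set Y)"
    proof (intro equalityI subsetI)
      fix y assume "y \<in> F ` topspace (top_of_set (realization ?p))"
      then show "y \<in> topspace (top_of_set Y)" using \<open>\<And>w. w \<in> realization ?p \<Longrightarrow> F w \<in> Y\<close> by auto
    next
      fix y assume "y \<in> topspace (top_of_set Y)"
      then have y: "(\<Sum>i<l. (y i)\<^sup>2) = 1" "\<And>i. i \<ge> l \<Longrightarrow> y i = 0" by (auto simp: Y_def)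
      obtain x where x: "unit_range l x" "radial l x = y" using radial_surj[OF y] by blast
      obtain w where w: "w \<in> realization ?p" "\<And>i. i \<le> l \<Longrightarrow> coord k w i = x i"
        using unit_range_coord[OF x(1)] l(1) by metis
      have "F w i = radial l x i" for i unfolding F_def radial_def using w(2) by simp
      then have "F w = y" using x(2) by (simp add: fun_eq_iff)
      then show "y \<in> F ` topspace (top_of_set (realization ?p))" using w(1) by auto
    qed
  qed
  then show ?thesis unfolding geometric_realization_top_of_set sp
    by (intro homeomorphic_imp_homotopy_equivalent_space homeomorphic_map_imp_homeomorphic_space)
qed

subsection \<open>Homotopy type of the two orders on sets of maximal simplices\<close>

definition flip_order :: "nat \<Rightarrow> nat \<Rightarrow> nat set set rel" where
  "flip_order n d = {(M, M'). triang n d M \<and> triang n d M' \<and> (M, M') \<in> (flips n d)\<^sup>*}"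

definition height_order :: "nat \<Rightarrow> nat \<Rightarrow> nat set set rel" where
  "height_order n d = {(M, M'). triang n d M \<and> triang n d M' \<and> below d M M'}"

lemma flip_order_subset_height_order: "flip_order n d \<subseteq> height_order n d"
  unfolding flip_order_def height_order_def using flips_star_below by blast

lemma below_refl: "triang n d M \<Longrightarrow> below d M M"
  using triang_noncross by (auto simp: below_def)

lemma Field_M: "Field (flip_order n d) = {M. triang n d M}" "Field (height_order n d) =
  {M. triang n d M}"
  unfolding flip_order_def height_order_def Field_def using below_refl by blast+

lemma finite_poset_height_order: "finite_poset (height_order n d)"
  unfolding finite_poset_def Field_M
proof (intro conjI ballI)
  show "finite {M. triang n d M}"
    by (rule finite_subset[of _ "Pow (Pow {1..n})"]) (auto simp: triang_def)
  show "(M, M) \<in> height_order n d" if "M \<in> {M. triang n d M}" for M using that below_refl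
    by (auto simp: height_order_def)
  show "trans (height_order n d)" unfolding height_order_def trans_def using below_trans by blast
  show "antisym (height_order n d)" unfolding height_order_def antisym_def using below_antisym
    by blast
qed

lemma finite_poset_flip_order: "finite_poset (flip_order n d)"
  unfolding finite_poset_def
proof (intro conjI ballI)
  show "finite (Field (flip_order n d))" using finite_poset_height_order[of n d]
    by (simp add: finite_poset_def Field_M)
  show "(M, M) \<in> flip_order n d" if "M \<in> Field (flip_order n d)" for M using that unfolding Field_M
    by (simp add: flip_order_def)
  show "trans (flip_order n d)"
  proof (rule transI)
    fix x y z assume "(x, y) \<in> flip_order n d" "(y, z) \<in> flip_order n d"
    then show "(x, z) \<in> flip_order n d" unfolding flip_order_def by (auto intro: rtrancl_trans)
  qed
  have "antisym (height_order n d)" using finite_poset_height_order by (simp add: finite_poset_def)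
  then show "antisym (flip_order n d)" by (rule antisym_subset[OF flip_order_subset_height_order])
qed

lemma flips_deletion:
  assumes "(M, M') \<in> flips (Suc m) d"  and m: "m \<ge> Suc d"
  shows "(deletion m M, deletion m M') \<in> (flips m d)\<^sup>*"
proof -
  obtain R where M: "triang (Suc m) d M"
    and R: "R \<subseteq> {1..Suc m}" "card R = d + 2" "gale True R d \<subseteq> M"
    and M': "M' = flip True d R M" using assms(1) by (auto simp: flips_def)
  show ?thesis
  proof (cases "has_both m R")
    case True
    then have "m \<in> R" "Suc m \<in> R" by (auto simp: has_both_def)
    then have "deletion m M' = deletion m M" unfolding M'
      using deletion_flip_has_both(1)[OF R(1,2) _ _ R(3)] by blast
    then show ?thesis by simp
  next
    case False
    have "collapse m ` R \<subseteq> {1..m}" using R(1) m by (auto simp: collapse_def le_Suc_eq)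
    moreover have "card (collapse m ` R) = d + 2"
      using strict_mono_on_imp_inj_on[OF strict_mono_on_collapse[OF False]] R(2)
        by (simp add: card_image)
    ultimately have "(deletion m M, deletion m M') \<in> flips m d"
      unfolding flips_def M'
        using deletion_flip_other[OF M R(1,2) False R(3)] triang_deletion[OF M m] by blast
    then show ?thesis by blast
  qed
qed

lemma rtrancl_map:
  assumes "\<And>x y. (x, y) \<in> r \<Longrightarrow> (f x, f y) \<in> s\<^sup>*" "(x, y) \<in> r\<^sup>*"
  shows "(f x, f y) \<in> s\<^sup>*"
  using assms(2) by (induction rule: rtrancl_induct) (auto intro: assms(1) rtrancl_trans)

lemma flips_lower_lift:
  assumes "(Q, Q') \<in> flips m d" and m: "m \<ge> Suc d"
  shows "(lower_lift m d Q, lower_lift m d Q') \<in> flips (Suc m) d"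
proof -
  obtain R where Q: "triang m d Q" and R: "R \<subseteq> {1..m}" "card R = d + 2" "gale True R d \<subseteq> Q"
    and Q': "Q' = flip True d R Q" using assms(1) by (auto simp: flips_def)
  have "R \<subseteq> {1..Suc m}" using R(1) by auto
  then show ?thesis unfolding flips_def Q'
    using lower_lift_flip(1)[OF R(1)] lower_lift_flip(2)[OF R(1,3)] R(2) triang_lower_lift(1)[OF Q m] by blast
qed

lemma flips_upper_lift:
  assumes "(Q, Q') \<in> flips m d" and m: "m \<ge> Suc d"
  shows "(upper_lift m d Q, upper_lift m d Q') \<in> flips (Suc m) d"
proof -
  obtain R where Q: "triang m d Q" and R: "R \<subseteq> {1..m}" "card R = d + 2" "gale True R d \<subseteq> Q"
    and Q': "Q' = flip True d R Q" using assms(1) by (auto simp: flips_def)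
  have "card (expand m ` R) = d + 2"
    using strict_mono_on_imp_inj_on[OF strict_mono_on_expand[OF R(1)]] R(2)
      by (simp add: card_image)
  then show ?thesis unfolding flips_def Q'
    using upper_lift_flip[OF Q R] expand_subset[OF R(1)] triang_upper_lift(1)[OF Q m] by blast
qed

lemma triang_trivial: "triang (Suc d) d M \<longleftrightarrow> M = {{1..Suc d}}"
proof -
  have *: "M \<subseteq> {{1..Suc d}}" if "triang (Suc d) d M" for M
  proof
    fix S assume "S \<in> M"
    then have "S \<subseteq> {1..Suc d}" "card S = card {1..Suc d}" using triD[OF that] by simp_all
    then show "S \<in> {{1..Suc d}}" using card_subset_eq[of "{1..Suc d}" S] by simp
  qed
  have ne: "M \<noteq> {}" if "triang (Suc d) d M" for M
  proof -
    have "nonneg {1..Suc d} (\<lambda>_. 0)" by (simp add: nonneg_def supp_def)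
    then show ?thesis using triang_cover[OF that] by blast
  qed
  have uniq: "M = {{1..Suc d}}" if "triang (Suc d) d M" for M using *[OF that] ne[OF that] by blast
  have "triang (Suc d) d (gale True {1..Suc d} d)" by (rule triang_gale) simp
  then show ?thesis using uniq by metis
qed

lemma gale_trivial: "gale b {1..Suc d} d = {{1..Suc d}}"
  using triang_gale[of d "Suc d" b] triang_trivial by simp

text \<open>The induction step for both orders: heights enter only through the inclusion of
  \<open>P\<close> in \<open>height_order\<close>, for the colour, and flips only through paths
  inside fibres.\<close>

lemma boolean_type_step:
  assumes d: "d \<ge> 1" and m: "m \<ge> Suc d"
    and P: "finite_poset P" "Field P = {M. triang (Suc m) d M}" "P \<subseteq> height_order (Suc m) d"
    and Q: "finite_poset Q" "Field Q = {M. triang m d M}"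
    and f: "mono_map P Q (deletion m)" and i: "mono_map Q P (lower_lift m d)"
      and j: "mono_map Q P (upper_lift m d)"
    and v: "\<And>M M'. triang (Suc m) d M \<Longrightarrow> triang (Suc m) d M' \<Longrightarrow> (M, M') \<in> (fibre_flips m d)\<^sup>* \<Longrightarrow>
      (M, M') \<in> P"
    and k: "boolean_type Q (gale True {1..m} d) (gale False {1..m} d) k"
  shows "boolean_type P (gale True {1..Suc m} d) (gale False {1..Suc m} d) (Suc k)"
proof -
  have "boolean_type P (lower_lift m d (gale True {1..m} d)) (upper_lift m d (gale False {1..m} d)) (Suc k)"
  proof (rule boolean_type_suspension[OF P(1) Q(1) _ _ f i j, where R = "red_colour m d"])
    show "gale True {1..m} d \<in> Field Q" "gale False {1..m} d \<in> Field Q" unfolding Q(2)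
      using triang_gale[OF m] by simp_all
    fix q assume "q \<in> Field Q"
    then have q: "triang m d q" unfolding Q(2) by simp
    show "deletion m (lower_lift m d q) = q" "deletion m (upper_lift m d q) = q"
      using triang_lower_lift(3)[OF q m] triang_upper_lift(3)[OF q m] .
    show "(lower_lift m d q, upper_lift m d q) \<in> P"
      using v[OF triang_lower_lift(1)[OF q m] triang_upper_lift(1)[OF q m] triang_upper_lift(4)[OF q m]] .
    show "\<not> red_colour m d (lower_lift m d q)" "red_colour m d (upper_lift m d q)"
      using not_red_colour_lower_lift[OF q m] red_colour_upper_lift[OF d m] .
  next
    fix x y assume "(x, y) \<in> P" "red_colour m d x"
    then show "red_colour m d y" using P(3) red_colour_mono[OF _ _ _ _ m] unfolding height_order_def
      by blast
  next
    fix x assume "x \<in> Field P"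
    then have x: "triang (Suc m) d x" unfolding P(2) by simp
    note dx = triang_deletion[OF x m]
    show "(lower_lift m d (deletion m x), x) \<in> P"
      using v[OF triang_lower_lift(1)[OF dx m] x lower_lift_down[OF x m]] .
    show "(x, upper_lift m d (deletion m x)) \<in> P"
      using v[OF x triang_upper_lift(1)[OF dx m] upper_lift_expand[OF x m]] .
    show "x = lower_lift m d (gale True {1..m} d)" if "deletion m x = gale True {1..m} d"
      "\<not> red_colour m d x"
      using fibre_bot[OF x m that] lower_lift_bot(1)[OF m] by simp
    show "x = upper_lift m d (gale False {1..m} d)"
      if "deletion m x = gale False {1..m} d" "red_colour m d x"
      using fibre_top[OF x m that] upper_lift_top(1)[OF m] by simp
  qed (rule k)
  then show ?thesis unfolding lower_lift_bot(1)[OF m] upper_lift_top(1)[OF m] .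
qed

lemma boolean_type_flip_order:
  assumes d: "d \<ge> 1" and n: "n \<ge> Suc d"
  shows "boolean_type (flip_order n d) (gale True {1..n} d) (gale False {1..n} d) (n - Suc d)"
  using n
proof (induction n rule: dec_induct)
  case base
  have "flip_order (Suc d) d = {({{1..Suc d}}, {{1..Suc d}})}"
    unfolding flip_order_def triang_trivial by auto
  then show ?case unfolding gale_trivial using boolean_type_trivial by simp
next
  case (step m)
  have m: "m \<ge> Suc d" using step by simp
  have m1: "m \<ge> 1" using m by simp
  have "boolean_type (flip_order (Suc m) d) (gale True {1..Suc m} d) (gale False {1..Suc m} d) (Suc (m - Suc d))"
  proof (rule boolean_type_step[OF d m finite_poset_flip_order Field_M(1) flip_order_subset_height_order finite_poset_flip_order Field_M(1) _ _ _ _ step(3)])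
    show "mono_map (flip_order (Suc m) d) (flip_order m d) (deletion m)"
      unfolding mono_map_def flip_order_def
      using rtrancl_map[of "flips (Suc m) d" "deletion m" "flips m d", OF flips_deletion[OF _ m]] triang_deletion[OF _ m] by simp
    show "mono_map (flip_order m d) (flip_order (Suc m) d) (lower_lift m d)"
      unfolding mono_map_def flip_order_def
      using rtrancl_map[of "flips m d" "lower_lift m d" "flips (Suc m) d", OF r_into_rtrancl[OF flips_lower_lift[OF _ m]]] triang_lower_lift(1)[OF _ m] by simp
    show "mono_map (flip_order m d) (flip_order (Suc m) d) (upper_lift m d)"
      unfolding mono_map_def flip_order_def
      using rtrancl_map[of "flips m d" "upper_lift m d" "flips (Suc m) d", OF r_into_rtrancl[OF flips_upper_lift[OF _ m]]] triang_upper_lift(1)[OF _ m] by simp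
    show "(M, M') \<in> flip_order (Suc m) d" if "triang (Suc m) d M" "triang (Suc m) d M'"
      "(M, M') \<in> (fibre_flips m d)\<^sup>*" for M M'
      using that rtrancl_mono[OF fibre_flips_flips] unfolding flip_order_def by blast
  qed
  moreover have "Suc m - Suc d = Suc (m - Suc d)" using m by linarith
  ultimately show ?case by (simp only:)
qed

lemma boolean_type_height_order:
  assumes d: "d \<ge> 1" and n: "n \<ge> Suc d"
  shows "boolean_type (height_order n d) (gale True {1..n} d) (gale False {1..n} d) (n - Suc d)"
  using n
proof (induction n rule: dec_induct)
  case base
  have "height_order (Suc d) d = {({{1..Suc d}}, {{1..Suc d}})}"
    using below_refl[of "Suc d" d "{{1..Suc d}}"] unfolding height_order_def triang_trivial by auto
  then show ?case unfolding gale_trivial using boolean_type_trivial by simp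
next
  case (step m)
  have m: "m \<ge> Suc d" using step by simp
  have m1: "m \<ge> 1" using m by simp
  have "boolean_type (height_order (Suc m) d) (gale True {1..Suc m} d) (gale False {1..Suc m} d) (Suc (m - Suc d))"
  proof (rule boolean_type_step[OF d m finite_poset_height_order Field_M(2) order_refl finite_poset_height_order Field_M(2) _ _ _ _ step(3)])
    show "mono_map (height_order (Suc m) d) (height_order m d) (deletion m)"
      unfolding mono_map_def height_order_def using below_deletion triang_deletion[OF _ m] by simp
    show "mono_map (height_order m d) (height_order (Suc m) d) (lower_lift m d)"
      unfolding mono_map_def height_order_def
        using below_lower_lift[OF _ _ _ m1] triang_lower_lift(1)[OF _ m] by simp
    show "mono_map (height_order m d) (height_order (Suc m) d) (upper_lift m d)"
      unfolding mono_map_def height_order_def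
        using below_upper_lift[OF _ _ _ m1] triang_upper_lift(1)[OF _ m] by simp
    show "(M, M') \<in> height_order (Suc m) d" if "triang (Suc m) d M" "triang (Suc m) d M'"
      "(M, M') \<in> (fibre_flips m d)\<^sup>*" for M M'
      using that rtrancl_mono[OF fibre_flips_flips] flips_star_below unfolding height_order_def
        by blast
  qed
  moreover have "Suc m - Suc d = Suc (m - Suc d)" using m by linarith
  ultimately show ?case by (simp only:)
qed

subsection \<open>Points of cyclic polytopes\<close>

definition moment_comb :: "nat \<Rightarrow> (nat \<Rightarrow> real) \<Rightarrow> nat \<Rightarrow> real" where
  "moment_comb k a = (\<lambda>j. if j < k then moment_ev a (monom 1 (Suc j)) else 0)"

lemma sum_fun_at: "(\<Sum>i\<in>A. f i) (j::nat) = (\<Sum>i\<in>A. (f i j :: real))"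
  by (induction A rule: infinite_finite_induct) (auto simp: plus_fun_def zero_fun_def)

lemma moment_point_inj: "k \<ge> 1 \<Longrightarrow> inj (moment_point k)"
proof (rule injI)
  fix x y assume "k \<ge> 1" "moment_point k x = moment_point k y"
  then have "moment_point k x 0 = moment_point k y 0" by simp
  then show "x = y" using \<open>k \<ge> 1\<close> by (simp add: moment_point_def)
qed

lemma moment_comb_eq_sum:
  assumes "finite S" "supp a \<subseteq> S"
  shows "moment_comb k a = (\<Sum>i\<in>S. a i *\<^sub>R moment_point k i)"
proof
  fix j
  show "moment_comb k a j = (\<Sum>i\<in>S. a i *\<^sub>R moment_point k i) j"
    unfolding sum_fun_at moment_comb_def moment_ev_superset[OF assms]
    by (simp add: scaleR_fun_def moment_point_def poly_monom)
qed

lemma moment_ev_1: "finite S \<Longrightarrow> supp a \<subseteq> S \<Longrightarrow> moment_ev a 1 = (\<Sum>i\<in>S. a i)"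
  by (simp add: moment_ev_superset)

lemma moment_comb_linear:
  assumes "finite (supp a)" "finite (supp b)"
  shows "moment_comb k (\<lambda>i. x * a i + y * b i) = x *\<^sub>R moment_comb k a + y *\<^sub>R moment_comb k b"
  by (auto simp: moment_comb_def moment_ev_linear[OF assms] scaleR_fun_def plus_fun_def fun_eq_iff)

lemma moment_comb_indic: "moment_comb k (indic {i}) = moment_point k i"
  by (auto simp: moment_comb_def moment_ev_def indic_def moment_point_def poly_monom fun_eq_iff)

lemma moment_ev_indic: "moment_ev (indic {i}) q = poly q (real i)"
  by (simp add: moment_ev_def indic_def)

lemma moment_ev_coeffs:
  assumes "degree q \<le> N"
  shows "moment_ev c q = (\<Sum>i\<le>N. coeff q i * moment_ev c (monom 1 i))"
proof -
  have "poly q x = (\<Sum>i\<le>N. coeff q i * x ^ i)" for x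
    unfolding poly_altdef using assms by (intro sum.mono_neutral_left) (auto simp: coeff_eq_0)
  then have "moment_ev c q = (\<Sum>x\<in>supp c. \<Sum>i\<le>N. coeff q i * (c x * poly (monom 1 i) (real x)))"
    unfolding moment_ev_def by (simp add: poly_monom sum_distrib_left mult_ac)
  also have "\<dots> = (\<Sum>i\<le>N. coeff q i * moment_ev c (monom 1 i))"
    by (subst sum.swap) (simp add: moment_ev_def sum_distrib_left)
  finally show ?thesis .
qed

lemma same_moments_iff_moment_comb:
  "same_moments k a b \<longleftrightarrow> moment_ev a 1 = moment_ev b 1 \<and> moment_comb k a = moment_comb k b"
proof
  assume e: "same_moments k a b"
  then have "moment_ev a (monom 1 (Suc j)) = moment_ev b (monom 1 (Suc j))" if "j < k" for j
    using that by (simp add: same_moments_def degree_monom_eq)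
  then show "moment_ev a 1 = moment_ev b 1 \<and> moment_comb k a = moment_comb k b" using e
    by (auto simp: moment_comb_def same_moments_def fun_eq_iff)
next
  assume e: "moment_ev a 1 = moment_ev b 1 \<and> moment_comb k a = moment_comb k b"
  have m: "moment_ev a (monom 1 i) = moment_ev b (monom 1 i)" if "i \<le> k" for i
  proof (cases i)
    case 0
    then show ?thesis using e by (simp add: monom_0 pCons_one)
  next
    case (Suc j)
    have "moment_comb k a j = moment_comb k b j" using e by simp
    then show ?thesis using that Suc by (simp add: moment_comb_def)
  qed
  show "same_moments k a b" unfolding same_moments_def
  proof (intro allI impI)
    fix q :: "real poly" assume "degree q \<le> k"
    then show "moment_ev a q = moment_ev b q" unfolding moment_ev_coeffs[OF \<open>degree q \<le> k\<close>] using m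
      by (intro sum.cong) auto
  qed
qed

lemma cyc_iff:
  assumes S: "finite S" and k: "k \<ge> 1"
  shows "x \<in> cyc S k \<longleftrightarrow> (\<exists>a. nonneg S a \<and> moment_ev a 1 = 1 \<and> x = moment_comb k a)"
proof -
  have inj: "inj_on (moment_point k) S" using moment_point_inj[OF k] by (rule inj_on_subset) simp
  have re: "sum u (moment_point k ` S) = (\<Sum>i\<in>S. u (moment_point k i))"
      "(\<Sum>x\<in>moment_point k ` S. u x *\<^sub>R x) = (\<Sum>i\<in>S. u (moment_point k i) *\<^sub>R moment_point k i)" for u
    using sum.reindex[OF inj] by (simp_all add: o_def)
  have hull: "x \<in> cyc S k \<longleftrightarrow> (\<exists>u. (\<forall>i\<in>S. 0 \<le> u (moment_point k i)) \<and> (\<Sum>i\<in>S. u (moment_point k i)) =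
    1 \<and>
      (\<Sum>i\<in>S. u (moment_point k i) *\<^sub>R moment_point k i) = x)"
    unfolding cyc_def convex_hull_finite[OF finite_imageI[OF S]] re by simp
  show ?thesis unfolding hull
  proof
    assume "\<exists>u. (\<forall>i\<in>S. 0 \<le> u (moment_point k i)) \<and> (\<Sum>i\<in>S. u (moment_point k i)) = 1 \<and>
      (\<Sum>i\<in>S. u (moment_point k i) *\<^sub>R moment_point k i) = x"
    then obtain u where u: "\<forall>i\<in>S. 0 \<le> u (moment_point k i)" "(\<Sum>i\<in>S. u (moment_point k i)) = 1"
      "(\<Sum>i\<in>S. u (moment_point k i) *\<^sub>R moment_point k i) = x" by blast
    define a where "a i = (if i \<in> S then u (moment_point k i) else 0)" for i
    have sa: "supp a \<subseteq> S" by (auto simp: supp_def a_def)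
    have "nonneg S a" using u(1) sa by (auto simp: nonneg_def a_def)
    moreover have "moment_ev a 1 = 1" unfolding moment_ev_1[OF S sa] using u(2) by (simp add: a_def)
    moreover have "x = moment_comb k a" unfolding moment_comb_eq_sum[OF S sa] using u(3)
      by (simp add: a_def)
    ultimately show "\<exists>a. nonneg S a \<and> moment_ev a 1 = 1 \<and> x = moment_comb k a" by blast
  next
    assume "\<exists>a. nonneg S a \<and> moment_ev a 1 = 1 \<and> x = moment_comb k a"
    then obtain a where a: "nonneg S a" "moment_ev a 1 = 1" "x = moment_comb k a" by blast
    have sa: "supp a \<subseteq> S" using a(1) by (simp add: nonneg_def)
    define u where "u p = a (inv_into S (moment_point k) p)" for p
    have ui: "u (moment_point k i) = a i" if "i \<in> S" for i using inv_into_f_f[OF inj that]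
      by (simp add: u_def)
    have "\<forall>i\<in>S. 0 \<le> u (moment_point k i)" using ui a(1) by (simp add: nonneg_def)
    moreover have "(\<Sum>i\<in>S. u (moment_point k i)) = 1" using a(2) ui unfolding moment_ev_1[OF S sa]
      by simp
    moreover have "(\<Sum>i\<in>S. u (moment_point k i) *\<^sub>R moment_point k i) = x"
      unfolding a(3) moment_comb_eq_sum[OF S sa] using ui by simp
    ultimately show "\<exists>u. (\<forall>i\<in>S. 0 \<le> u (moment_point k i)) \<and> (\<Sum>i\<in>S. u (moment_point k i)) = 1 \<and>
      (\<Sum>i\<in>S. u (moment_point k i) *\<^sub>R moment_point k i) = x" by blast
  qed
qed

text \<open>Up to \<open>d + 1\<close> labels independence is
  \<open>same_moments_supp_unique\<close>; beyond that, \<open>circ\<close> of \<open>d + 2\<close>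
  of the labels is an explicit dependence.\<close>

lemma simplex_labels_iff:
  assumes d: "d \<ge> 1"
  shows "simplex_labels n d S \<longleftrightarrow> S \<subseteq> {1..n} \<and> card S \<le> Suc d"
proof -
  have "affine_dependent (moment_point d ` S) \<longleftrightarrow> \<not> card S \<le> Suc d" if Sn: "S \<subseteq> {1..n}"
  proof -
    have S: "finite S" using Sn finite_subset by blast
    have inj: "inj_on (moment_point d) S" using moment_point_inj[OF d] by (rule inj_on_subset) simp
    have re: "sum u (moment_point d ` S) = (\<Sum>i\<in>S. u (moment_point d i))"
        "(\<Sum>x\<in>moment_point d ` S. u x *\<^sub>R x) = (\<Sum>i\<in>S. u (moment_point d i) *\<^sub>R moment_point d i)"
          for u
      using sum.reindex[OF inj] by (simp_all add: o_def)
    have e0: "moment_ev (\<lambda>_. 0) q = 0" "moment_comb d (\<lambda>_. 0) = 0" for q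
      by (auto simp: moment_ev_def supp_def moment_comb_def zero_fun_def)
    show ?thesis unfolding affine_dependent_explicit_finite[OF finite_imageI[OF S]] re
    proof
      assume "\<exists>u. (\<Sum>i\<in>S. u (moment_point d i)) = 0 \<and> (\<exists>v\<in>moment_point d ` S. u v \<noteq> 0) \<and>
        (\<Sum>i\<in>S. u (moment_point d i) *\<^sub>R moment_point d i) = 0"
      then obtain u v where u: "(\<Sum>i\<in>S. u (moment_point d i)) = 0" "v \<in> S" "u (moment_point d v) \<noteq> 0"
        "(\<Sum>i\<in>S. u (moment_point d i) *\<^sub>R moment_point d i) = 0" by blast
      define a where "a i = (if i \<in> S then u (moment_point d i) else 0)" for i
      have sa: "supp a \<subseteq> S" by (auto simp: supp_def a_def)
      have "moment_ev a 1 = 0" unfolding moment_ev_1[OF S sa] using u(1) by (simp add: a_def)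
      moreover have "moment_comb d a = 0" unfolding moment_comb_eq_sum[OF S sa] using u(4)
        by (simp add: a_def)
      ultimately have eq: "same_moments d a (\<lambda>_. 0)" unfolding same_moments_iff_moment_comb e0
        by simp
      show "\<not> card S \<le> Suc d"
      proof
        assume "card S \<le> Suc d"
        then have "a = (\<lambda>_. 0)" using same_moments_supp_unique[OF S _ sa _ eq]
          by (simp add: supp_def)
        then have "a v = 0" by simp
        then show False using u(2,3) by (simp add: a_def)
      qed
    next
      assume "\<not> card S \<le> Suc d"
      then obtain Z where Z: "Z \<subseteq> S" "card Z = d + 2" "finite Z"
        using obtain_subset_with_card_n[of "d + 2" S] by auto
      define a where "a = circ Z"
      have sa: "supp a \<subseteq> S" using supp_circ[OF Z(3)] Z(1) by (simp add: a_def)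
      have "same_moments d (\<lambda>_. 0) (\<lambda>i. 0 + 1 * circ Z i)" using Z
        by (intro same_moments_add_circ) (auto simp: supp_def)
      then have "same_moments d (\<lambda>_. 0) a" by (simp add: a_def)
      then have a: "moment_ev a 1 = 0" "moment_comb d a = 0"
        unfolding same_moments_iff_moment_comb e0 by simp_all
      define u where "u p = a (inv_into S (moment_point d) p)" for p
      have ui: "u (moment_point d i) = a i" if "i \<in> S" for i using inv_into_f_f[OF inj that]
        by (simp add: u_def)
      obtain z where z: "z \<in> Z" using Z(2) by fastforce
      have "a z \<noteq> 0" using supp_circ[OF Z(3)] z unfolding a_def supp_def by blast
      then have "\<exists>v\<in>moment_point d ` S. u v \<noteq> 0" using z Z(1) ui
        by (intro bexI[of _ "moment_point d z"]) auto
      moreover have "(\<Sum>i\<in>S. u (moment_point d i)) = 0" using a(1) ui unfolding moment_ev_1[OF S sa]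
        by simp
      moreover have "(\<Sum>i\<in>S. u (moment_point d i) *\<^sub>R moment_point d i) = 0"
        using a(2) ui unfolding moment_comb_eq_sum[OF S sa] by simp
      ultimately show "\<exists>u. (\<Sum>i\<in>S. u (moment_point d i)) = 0 \<and> (\<exists>v\<in>moment_point d ` S. u v \<noteq> 0) \<and>
        (\<Sum>i\<in>S. u (moment_point d i) *\<^sub>R moment_point d i) = 0" by blast
    qed
  qed
  then show ?thesis unfolding simplex_labels_def by blast
qed

section \<open>Faces and admissibility of simplices\<close>

lemma nonneg_convex:
  assumes "nonneg S a" "nonneg S b" "0 \<le> u" "u \<le> (1::real)"
  shows "nonneg S (\<lambda>i. (1 - u) * a i + u * b i)"
  unfolding nonneg_def
proof (intro conjI allI)
  show "0 \<le> (1 - u) * a i + u * b i" for i using assms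
    by (auto simp: nonneg_def intro!: add_nonneg_nonneg mult_nonneg_nonneg)
  show "supp (\<lambda>i. (1 - u) * a i + u * b i) \<subseteq> S"
  proof
    fix i assume "i \<in> supp (\<lambda>i. (1 - u) * a i + u * b i)"
    then have "a i \<noteq> 0 \<or> b i \<noteq> 0" by (auto simp: supp_def)
    then show "i \<in> S" using assms(1,2) by (auto simp: nonneg_def supp_def)
  qed
qed

lemma moment_comb_unique:
  assumes "finite S" "card S \<le> Suc d" "nonneg S a" "nonneg S b" "moment_ev a 1 =
    moment_ev b 1" "moment_comb d a = moment_comb d b"
  shows "a = b"
  using same_moments_supp_unique[OF assms(1,2)] assms(3-6)
    unfolding same_moments_iff_moment_comb nonneg_def by blast

text \<open>Barycentric coordinates in a simplex are unique, so those of a point between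
  \<open>x\<close> and \<open>y\<close> are a weighted mean of theirs; where the mean vanishes, both
  do.\<close>

lemma cyc_face:
  assumes d: "d \<ge> 1" and S: "finite S" "card S \<le> Suc d" and F: "F \<subseteq> S"
  shows "cyc F d face_of cyc S d"
  unfolding face_of_def
proof (intro conjI ballI impI)
  have fF: "finite F" using F S(1) finite_subset by blast
  show "cyc F d \<subseteq> cyc S d" unfolding cyc_def using F by (intro hull_mono) auto
  show "convex (cyc F d)" by (simp add: cyc_def)
  fix x y z assume xyz: "x \<in> cyc S d" "y \<in> cyc S d" "z \<in> cyc F d" "z \<in> open_segment x y"
  obtain a where a: "nonneg S a" "moment_ev a 1 = 1" "x = moment_comb d a"
    using xyz(1) cyc_iff[OF S(1) d] by blast
  obtain b where b: "nonneg S b" "moment_ev b 1 = 1" "y = moment_comb d b"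
    using xyz(2) cyc_iff[OF S(1) d] by blast
  obtain c where c: "nonneg F c" "moment_ev c 1 = 1" "z = moment_comb d c"
    using xyz(3) cyc_iff[OF fF d] by blast
  obtain u where u: "0 < u" "u < 1" "z = (1 - u) *\<^sub>R x + u *\<^sub>R y" using xyz(4)
    by (auto simp: in_segment)
  have fin: "finite (supp a)" "finite (supp b)" using nonneg_finite a(1) b(1) S(1) by blast+
  define e where "e = (\<lambda>i. (1 - u) * a i + u * b i)"
  have e: "nonneg S e" using nonneg_convex[OF a(1) b(1)] u by (simp add: e_def)
  have "moment_ev e 1 = 1" unfolding e_def using moment_ev_linear(1)[OF fin] a(2) b(2) by simp
  moreover have "moment_comb d e = z" unfolding e_def
    using moment_comb_linear[OF fin] a(3) b(3) u(3) by simp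
  ultimately have "e = c" using moment_comb_unique[OF S e nonneg_mono[OF c(1) F]] c(2,3) by simp
  then have z: "e i = 0" if "i \<notin> F" for i using c(1) that by (auto simp: nonneg_def supp_def)
  have nn0: "a i \<ge> 0" "b i \<ge> 0" for i using a(1) b(1) by (auto simp: nonneg_def)
  have ab: "a i = 0 \<and> b i = 0" if "i \<notin> F" for i
  proof -
    have "(1 - u) * a i \<ge> 0" "u * b i \<ge> 0" "(1 - u) * a i + u * b i = 0"
      using nn0[of i] u z[OF that] by (auto simp: e_def)
    then have "(1 - u) * a i = 0" "u * b i = 0" by linarith+
    then show ?thesis using u by simp
  qed
  have "nonneg F a" "nonneg F b" using a(1) b(1) ab by (auto simp: nonneg_def supp_def)
  then show "x \<in> cyc F d" "y \<in> cyc F d" unfolding cyc_iff[OF fF d] using a b by blast+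
qed

lemma cyc_Int:
  assumes d: "d \<ge> 1" and S: "finite S" "finite S'" and nc: "\<not> over d S S'" "\<not> over d S' S"
  shows "cyc S d \<inter> cyc S' d = cyc (S \<inter> S') d"
proof
  show "cyc S d \<inter> cyc S' d \<subseteq> cyc (S \<inter> S') d"
  proof
    fix x assume x: "x \<in> cyc S d \<inter> cyc S' d"
    obtain a where a: "nonneg S a" "moment_ev a 1 = 1" "x = moment_comb d a"
      using x cyc_iff[OF S(1) d] by blast
    obtain b where b: "nonneg S' b" "moment_ev b 1 = 1" "x = moment_comb d b"
      using x cyc_iff[OF S(2) d] by blast
    have "same_moments d a b" unfolding same_moments_iff_moment_comb using a b by simp
    then have "a = b" using noncross_eq[OF a(1) b(1) S _ nc] by blast
    then have "nonneg (S \<inter> S') a" using a(1) b(1) by (auto simp: nonneg_def)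
    then show "x \<in> cyc (S \<inter> S') d" using cyc_iff[of "S \<inter> S'" d x] S d a by blast
  qed
  show "cyc (S \<inter> S') d \<subseteq> cyc S d \<inter> cyc S' d" unfolding cyc_def
    using hull_mono[of "moment_point d ` (S \<inter> S')" "moment_point d ` S" convex]
      hull_mono[of "moment_point d ` (S \<inter> S')" "moment_point d ` S'" convex] by blast
qed

text \<open>Removes one label from the support: subtract the weight at \<open>i\<close> and rescale
  the rest to total 1. The coefficients do not depend on \<open>k\<close>, so the splitting is
  compatible with lifting to dimension \<open>d + 1\<close>.\<close>

lemma split_vertex:
  assumes S: "finite S" and a: "nonneg S a" "moment_ev a 1 = 1" and i: "a i \<noteq> 0"
  obtains "a = indic {i}"
    | y where "nonneg S y" "moment_ev y 1 = 1" "supp y = supp a - {i}" "0 < a i" "a i < 1"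
      "\<And>k. moment_comb k a = (1 - a i) *\<^sub>R moment_comb k y + a i *\<^sub>R moment_point k i"
proof -
  have ai: "a i > 0" "i \<in> S" using a(1) i by (auto simp: nonneg_def supp_def less_le)
  have sa: "supp a \<subseteq> S" and an: "\<And>j. a j \<ge> 0" using a(1) by (auto simp: nonneg_def)
  have fa: "finite (supp a)" using sa S finite_subset by blast
  define r where "r = (\<lambda>j. 1 * a j + (- a i) * indic {i} j)"
  have rn: "r j \<ge> 0" "r i = 0" for j using an[of j] by (auto simp: r_def indic_def)
  have sr: "supp r = supp a - {i}" by (auto simp: supp_def r_def indic_def)
  then have sr': "supp r \<subseteq> S" using sa by blast
  have r1: "moment_ev r 1 = 1 - a i"
    unfolding r_def using moment_ev_linear(1)[OF fa, of "indic {i}" 1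
      "- a i" 1] a(2) moment_ev_indic[of i 1] by simp
  have "(\<Sum>j\<in>S. r j) \<ge> 0" using rn by (intro sum_nonneg)
  then have ai1: "a i \<le> 1" using r1 moment_ev_1[OF S sr'] by simp
  show ?thesis
  proof (cases "a i = 1")
    case True
    then have "(\<Sum>j\<in>S. r j) = 0" using r1 moment_ev_1[OF S sr'] by simp
    then have "r j = 0" if "j \<in> S" for j using sum_nonneg_eq_0_iff[OF S, of r] rn that by blast
    then have "r j = 0" for j using sr' by (cases "j \<in> S") (auto simp: supp_def)
    then have "a = indic {i}" using True by (auto simp: r_def fun_eq_iff)
    then show ?thesis using that(1) by blast
  next
    case False
    then have lt: "a i < 1" using ai1 by simp
    define y where "y = (\<lambda>j. (1 / (1 - a i)) * r j)"
    have sy: "supp y = supp r" using lt by (auto simp: y_def supp_def)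
    have ny: "nonneg S y" using rn sr' lt sy by (auto simp: nonneg_def y_def)
    have fy: "finite (supp y)" using nonneg_finite[OF ny S] .
    have "moment_ev y 1 = (1 / (1 - a i)) * moment_ev r 1"
      using moment_ev_linear(1)[of r "\<lambda>_. 0" "1 / (1 - a i)" 0 1] finite_subset[OF sr' S]
        by (simp add: y_def supp_def)
    then have y1: "moment_ev y 1 = 1" using r1 lt by simp
    have "a = (\<lambda>j. (1 - a i) * y j + a i * indic {i} j)" using lt by (auto simp: y_def r_def)
    then have "moment_comb k a = (1 - a i) *\<^sub>R moment_comb k y + a i *\<^sub>R moment_comb k (indic {i})"
      for k
      using moment_comb_linear[OF fy, of "indic {i}" k "1 - a i" "a i"] by simp
    then show ?thesis using that(2)[OF ny y1 _ ai(1) lt] sr sy unfolding moment_comb_indic by simp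
  qed
qed

lemma face_contains_vertices:
  assumes d: "d \<ge> 1" and S: "finite S" and a: "nonneg S a" "moment_ev a 1 = 1" "moment_comb d a \<in> G"
    and G: "G face_of cyc S d"
    and i: "a i \<noteq> 0"
  shows "moment_point d i \<in> G"
  using split_vertex[OF S a(1,2) i]
proof cases
  case 1
  then show ?thesis using a(3) moment_comb_indic by simp
next
  case (2 y)
  have "i \<in> S" using a(1) i by (auto simp: nonneg_def supp_def)
  then have mi: "moment_point d i \<in> cyc S d" unfolding cyc_iff[OF S d]
    using nonneg_mono[OF nonneg_indic[of "{i}"]] moment_comb_indic[of d i] moment_ev_indic[of i 1]
      by (intro exI[of _ "indic {i}"]) auto
  have yc: "moment_comb d y \<in> cyc S d" unfolding cyc_iff[OF S d] using 2(1,2) by blast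
  show ?thesis
  proof (cases "moment_comb d y = moment_point d i")
    case True
    then have "moment_comb d a = moment_point d i" using 2(6)[of d]
      by (simp add: scaleR_left_distrib[symmetric])
    then show ?thesis using a(3) by simp
  next
    case False
    then have "moment_comb d a \<in> open_segment (moment_comb d y) (moment_point d i)"
      using 2 by (auto simp: in_segment)
    then show ?thesis using face_ofD[OF G _ yc mi a(3)] by blast
  qed
qed

text \<open>A vertex of \<open>S\<close> in the common face is an extreme point of that face, hence
  of the other hull, and extreme points of a convex hull are among its generators.\<close>

lemma vertex_in_simplex:
  assumes d: "d \<ge> 1" and S: "finite S" "card S \<le> Suc d"
    and G: "G face_of cyc S d" "G face_of cyc S' d"
    and s: "s \<in> S" "moment_point d s \<in> G"
  shows "s \<in> S'"
proof -
  have "cyc {s} d = {moment_point d s}" by (simp add: cyc_def)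
  then have "{moment_point d s} face_of cyc S d" using cyc_face[OF d S, of "{s}"] s(1) by simp
  then have "{moment_point d s} face_of G"
    using face_of_subset[of _ "cyc S d" G] s(2) G(1) face_of_imp_subset by blast
  then have "{moment_point d s} face_of cyc S' d" using face_of_trans G(2) by blast
  then have "moment_point d s extreme_point_of convex hull (moment_point d ` S')"
    unfolding face_of_singleton cyc_def .
  then have "moment_point d s \<in> moment_point d ` S'" by (rule extreme_point_of_convex_hull)
  then show ?thesis using moment_point_inj[OF d] by (auto simp: inj_def)
qed

text \<open>If the simplices alternate on \<open>Z\<close>, the Radon point lies in their common
  face. That face then contains the vertices of the odd half, which makes them vertices of
  \<open>S\<close>, so all \<open>d + 2\<close> labels of \<open>Z\<close> lie in
  \<open>S\<close>.\<close>

lemma admissible_iff: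
  assumes d: "d \<ge> 1" and S: "finite S" "card S \<le> Suc d" and S': "finite S'" "card S' \<le> Suc d"
  shows "admissible d S S' \<longleftrightarrow> \<not> over d S S' \<and> \<not> over d S' S"
proof
  assume "\<not> over d S S' \<and> \<not> over d S' S"
  then show "admissible d S S'" unfolding admissible_def
    using cyc_Int[OF d S(1) S'(1)] cyc_face[OF d S, of "S \<inter> S'"] cyc_face[OF d S', of "S \<inter> S'"]
      by simp
next
  have main: "\<not> over d S S'" if S: "finite S" "card S \<le> Suc d" and S': "finite S'" "card S' \<le> Suc d"
    and ad: "admissible d S S'" for S S'
  proof
    assume "over d S S'"
    then obtain Z where Z: "finite Z" "card Z = d + 2"
      "\<And>z. z \<in> Z \<Longrightarrow> if even (above Z z) then z \<in> S else z \<in> S'" by (auto simp: over_def)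
    define G where "G = cyc S d \<inter> cyc S' d"
    have G: "G face_of cyc S d" "G face_of cyc S' d" using ad by (auto simp: admissible_def G_def)
    note h = circ_halves[OF Z(1)]
    have p: "nonneg S (circ_pos Z)" "nonneg S' (circ_neg Z)"
      by (rule nonneg_mono[OF h(1)], use Z(3) in \<open>auto split: if_splits\<close>)
        (rule nonneg_mono[OF h(2)], use Z(3) in \<open>auto split: if_splits\<close>)
    define c where "c = moment_ev (circ_pos Z) 1"
    have e: "moment_ev (circ_neg Z) 1 = c" "moment_comb d (circ_pos Z) = moment_comb d (circ_neg Z)"
      using circuit_halves(1)[OF Z(1,2)] unfolding same_moments_iff_moment_comb c_def by simp_all
    obtain z0 where z0: "z0 \<in> Z" "even (above Z z0) = True"
      using circuit_parity_ex[OF Z(1,2), of True] by blast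
    have fp: "finite (supp (circ_pos Z))" "finite (supp (circ_neg Z))"
      using p S(1) S'(1) nonneg_finite by blast+
    have "c > 0"
    proof -
      have "c = (\<Sum>i\<in>supp (circ_pos Z). circ_pos Z i)" using moment_ev_1[OF fp(1)]
        by (simp add: c_def)
      also have "\<dots> > 0"
      proof (rule sum_pos[OF fp(1)])
        show "supp (circ_pos Z) \<noteq> {}" using h(3) z0 by auto
        show "circ_pos Z i > 0" if "i \<in> supp (circ_pos Z)" for i
          using that p(1) by (auto simp: nonneg_def supp_def less_le)
      qed
      finally show ?thesis .
    qed
    \<comment> \<open>The half of the circuit, rescaled to total weight 1. The summand with
      coefficient 0 gives the two-term shape of \<open>moment_ev_linear\<close>.\<close>
    define a where "a = (\<lambda>i. 1 / c * circ_pos Z i + 0 * circ_pos Z i)"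
    define b where "b = (\<lambda>i. 1 / c * circ_neg Z i + 0 * circ_neg Z i)"
    have ab: "nonneg S a" "nonneg S' b" using p \<open>c > 0\<close>
      by (auto simp: nonneg_def a_def b_def supp_def)
    have ab1: "moment_ev a 1 = 1" "moment_ev b 1 = 1" "moment_comb d a = moment_comb d b"
      unfolding a_def b_def moment_ev_linear(1)[OF fp(1) fp(1)] moment_ev_linear(1)[OF fp(2) fp(2)]
        moment_comb_linear[OF fp(1) fp(1)] moment_comb_linear[OF fp(2) fp(2)]
      using e \<open>c > 0\<close> by (simp_all add: c_def[symmetric])
    have "moment_comb d a \<in> cyc S d" unfolding cyc_iff[OF S(1) d] using ab(1) ab1(1) by blast
    moreover have "moment_comb d b \<in> cyc S' d" unfolding cyc_iff[OF S'(1) d] using ab(2) ab1(2)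
      by blast
    ultimately have xG: "moment_comb d b \<in> G" unfolding G_def using ab1(3) by simp
    have "z \<in> S" if z: "z \<in> Z" for z
    proof (cases "even (above Z z)")
      case True
      then show ?thesis using Z(3)[OF z] by simp
    next
      case False
      then have "z \<in> supp (circ_neg Z)" using h(4) z by simp
      then have "b z \<noteq> 0" using \<open>c > 0\<close> by (simp add: b_def supp_def)
      then have "moment_point d z \<in> G"
        by (rule face_contains_vertices[OF d S'(1) ab(2) ab1(2) xG G(2)])
      moreover have "z \<in> S'" using Z(3)[OF z] False by simp
      ultimately show ?thesis using vertex_in_simplex[OF d S' G(2,1)] by blast
    qed
    then have "card Z \<le> card S" using S(1) by (intro card_mono) auto
    then show False using S(2) Z(2) by simp
  qed
  assume ad: "admissible d S S'"
  then have "admissible d S' S" by (simp add: admissible_def Int_commute)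
  then show "\<not> over d S S' \<and> \<not> over d S' S" using main[OF S S' ad] main[OF S' S] by blast
qed

subsection \<open>Facets and triangulations of cyclic polytopes\<close>

text \<open>On the moment curve the supporting hyperplane is a polynomial of degree at most
  \<open>d + 1\<close> that vanishes at the \<open>d + 1\<close> labels of \<open>F\<close>, hence
  it is \<open>- c d\<close> times \<open>vanish_poly F\<close>. The sign of \<open>c d\<close>
  fixes the parity.\<close>

lemma outer_normal_gale:
  assumes V: "finite V" and o: "outer_normal V (Suc d) F c" and s: "if b then c d < 0 else c d > 0"
  shows "F \<in> gale b V d"
proof -
  obtain e where F: "F \<subseteq> V" "card F = Suc d" and e: "\<forall>x\<in>cyc V (Suc d). (\<Sum>j<Suc d. c j * x j) \<le> e"
    and Fe: "cyc F (Suc d) = cyc V (Suc d) \<inter> {x. (\<Sum>j<Suc d. c j * x j) = e}"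
    using o by (auto simp: outer_normal_def)
  have fF: "finite F" using F(1) V finite_subset by blast
  define q where "q = [:e:] - (\<Sum>j<Suc d. monom (c j) (Suc j))"
  have pq: "poly q (real v) = e - (\<Sum>j<Suc d. c j * moment_point (Suc d) v j)" for v
    by (simp add: q_def poly_sum poly_monom moment_point_def del: sum.lessThan_Suc)
  have mp: "moment_point (Suc d) v \<in> cyc S (Suc d)" if "v \<in> S" for v S
    unfolding cyc_def using that by (intro hull_inc) simp
  have qV: "poly q (real v) \<ge> 0" if "v \<in> V" for v using e mp[OF that] unfolding pq by auto
  have qF: "poly q (real v) = 0" if "v \<in> F" for v
    using mp[OF that] unfolding Fe pq by simp
  define r where "r = q - smult (- c d) (vanish_poly F)"
  have "degree r \<le> d"
  proof (rule degree_le, intro allI impI)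
    fix i assume i: "d < i"
    have cs: "coeff (\<Sum>j<Suc d. monom (c j) (Suc j)) i = (if i = Suc d then c d else 0)"
    proof -
      have "coeff (\<Sum>j<Suc d. monom (c j) (Suc j)) i = (\<Sum>j<Suc d. if Suc j = i then c j else 0)"
        by (simp only: coeff_sum coeff_monom)
      also have "\<dots> = (\<Sum>j<Suc d. if j = d \<and> i = Suc d then c d else 0)" using i
        by (intro sum.cong) auto
      also have "\<dots> = (if i = Suc d then c d else 0)" by simp
      finally show ?thesis .
    qed
    have cv: "coeff (vanish_poly F) i = (if i = Suc d then 1 else 0)"
      using vanish_poly_props(2,3)[OF fF] F(2) i coeff_eq_0[of "vanish_poly F" i] by auto
    have c0: "coeff [:e:] i = 0" using i by (cases i) auto
    show "coeff r i = 0" unfolding r_def q_def coeff_diff coeff_smult cs cv c0 by simp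
  qed
  moreover have "poly r (real v) = 0" if "v \<in> F" for v
    using qF[OF that] vanish_poly_zero[OF fF that] by (simp add: r_def)
  ultimately have "r = 0" using lagrange[OF fF F(2), of r] by simp
  then have "q = smult (- c d) (vanish_poly F)" by (simp add: r_def)
  then have qv: "poly q (real v) = - c d * poly (vanish_poly F) (real v)" for v by simp
  have "even (above F v) = b" if v: "v \<in> V - F" for v
  proof -
    have "- c d * poly (vanish_poly F) (real v) \<ge> 0" using qV[of v] v unfolding qv by simp
    then have "if b then poly (vanish_poly F) (real v) \<ge> 0 else poly (vanish_poly F) (real v) \<le> 0"
      using s by (auto simp: zero_le_mult_iff mult_le_0_iff split: if_splits)
    then show ?thesis using vanish_poly_sgn[OF fF, of v] v by (auto split: if_splits)
  qed
  then show ?thesis using F by (auto simp: gale_def)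
qed

text \<open>The normal is read off from the coefficients of \<open>vanish_poly F\<close>, up to the
  sign \<open>s\<close> that makes this polynomial non-negative on \<open>V\<close>.\<close>

lemma gale_outer_normal:
  assumes V: "finite V" and F: "F \<in> gale b V d"
  shows "\<exists>c. outer_normal V (Suc d) F c \<and> (if b then c d < 0 else c d > 0)"
proof -
  define s :: real where "s = (if b then 1 else -1)"
  have Fp: "F \<subseteq> V" "card F = Suc d" "\<And>v. v \<in> V - F \<Longrightarrow> even (above F v) = b" using F
    by (auto simp: gale_def)
  have fF: "finite F" using Fp(1) V finite_subset by blast
  note vp = vanish_poly_props(2,3)[OF fF]
  define c where "c j = - s * coeff (vanish_poly F) (Suc j)" for j
  define e where "e = s * coeff (vanish_poly F) 0"
  have pos: "s * poly (vanish_poly F) (real v) > 0" if "v \<in> V - F" for v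
    using vanish_poly_sgn[OF fF, of v] Fp(3)[OF that] that by (cases b) (auto simp: s_def)
  have val: "(\<Sum>j<Suc d. c j * moment_comb (Suc d) a j) = e - s * moment_ev a (vanish_poly F)"
    if "moment_ev a 1 = 1" for a
  proof -
    have "moment_ev a (vanish_poly F) =
      (\<Sum>i\<le>Suc d. coeff (vanish_poly F) i * moment_ev a (monom 1 i))"
      using vp(1) Fp(2) by (intro moment_ev_coeffs) simp
    also have "\<dots> =
      coeff (vanish_poly F) 0 + (\<Sum>j\<le>d. coeff (vanish_poly F) (Suc j) * moment_ev a (monom 1 (Suc j)))"
      unfolding sum.atMost_Suc_shift using that by (simp add: monom_0 pCons_one)
    finally have "s * moment_ev a (vanish_poly F) =
      e + (\<Sum>j<Suc d. s * coeff (vanish_poly F) (Suc j) * moment_ev a (monom 1 (Suc j)))"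
      by (simp add: e_def distrib_left sum_distrib_left lessThan_Suc_atMost mult.assoc del: sum.lessThan_Suc)
    moreover have
      "(\<Sum>j<Suc d. c j * moment_comb (Suc d) a j) =
      - (\<Sum>j<Suc d. s * coeff (vanish_poly F) (Suc j) * moment_ev a (monom 1 (Suc j)))"
      unfolding sum_negf[symmetric] by (intro sum.cong) (auto simp: c_def moment_comb_def)
    ultimately show ?thesis by simp
  qed
  have evp: "s * moment_ev a (vanish_poly F) = (\<Sum>i\<in>V. a i * (s * poly (vanish_poly F) (real i)))"
    if "nonneg V a" for a
    using that V by (subst moment_ev_superset[of V]) (auto simp: nonneg_def sum_distrib_left mult_ac)
  have tn: "a i * (s * poly (vanish_poly F) (real i)) \<ge> 0" if "nonneg V a" "i \<in> V" for a i
  proof (cases "i \<in> F")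
    case True
    then show ?thesis using vanish_poly_zero[OF fF] by simp
  next
    case False
    then show ?thesis using pos[of i] that by (auto simp: nonneg_def less_imp_le)
  qed
  have "outer_normal V (Suc d) F c"
    unfolding outer_normal_def
  proof (intro conjI exI[of _ e] ballI)
    show "F \<subseteq> V" "card F = Suc d" using Fp by auto
    show "(\<Sum>j<Suc d. c j * x j) \<le> e" if x: "x \<in> cyc V (Suc d)" for x
    proof -
      obtain a where a: "nonneg V a" "moment_ev a 1 = 1" "x = moment_comb (Suc d) a"
        using x cyc_iff[OF V, of "Suc d"] by auto
      have "s * moment_ev a (vanish_poly F) \<ge> 0" unfolding evp[OF a(1)] using tn[OF a(1)]
        by (intro sum_nonneg)
      then show ?thesis unfolding a(3) val[OF a(2)] by simp
    qed
    show "cyc F (Suc d) = cyc V (Suc d) \<inter> {x. (\<Sum>j<Suc d. c j * x j) = e}"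
    proof (intro equalityI subsetI)
      fix x assume "x \<in> cyc F (Suc d)"
      then obtain a where a: "nonneg F a" "moment_ev a 1 = 1" "x = moment_comb (Suc d) a"
        using cyc_iff[OF fF, of "Suc d"] by auto
      have aV: "nonneg V a" using nonneg_mono[OF a(1) Fp(1)] .
      have "moment_ev a (vanish_poly F) = 0"
        unfolding moment_ev_def using a(1) vanish_poly_zero[OF fF]
          by (intro sum.neutral) (auto simp: nonneg_def)
      moreover have "x \<in> cyc V (Suc d)" using cyc_iff[OF V, of "Suc d" x] aV a by auto
      ultimately show "x \<in> cyc V (Suc d) \<inter> {x. (\<Sum>j<Suc d. c j * x j) = e}"
        using val[OF a(2)] a(3) by simp
    next
      fix x assume x: "x \<in> cyc V (Suc d) \<inter> {x. (\<Sum>j<Suc d. c j * x j) = e}"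
      then obtain a where a: "nonneg V a" "moment_ev a 1 = 1" "x = moment_comb (Suc d) a"
        using cyc_iff[OF V, of "Suc d"] by auto
      have "s * moment_ev a (vanish_poly F) = 0" using x val[OF a(2)] a(3) by simp
      then have z: "\<forall>i\<in>V. a i * (s * poly (vanish_poly F) (real i)) = 0"
        unfolding evp[OF a(1)] using tn[OF a(1)] V by (subst (asm) sum_nonneg_eq_0_iff) auto
      have "supp a \<subseteq> F"
      proof
        fix i assume i: "i \<in> supp a"
        then have iV: "i \<in> V" and "a i \<noteq> 0" using a(1) by (auto simp: nonneg_def supp_def)
        then have "a i * (s * poly (vanish_poly F) (real i)) = 0" using z by blast
        then have "s * poly (vanish_poly F) (real i) = 0" using \<open>a i \<noteq> 0\<close> by simp
        then show "i \<in> F" using pos[of i] iV by (cases "i \<in> F") auto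
      qed
      then have "nonneg F a" using a(1) by (simp add: nonneg_def)
      then show "x \<in> cyc F (Suc d)" using cyc_iff[OF fF, of "Suc d" x] a by auto
    qed
  qed
  moreover have "c d = - s" using vp Fp(2) by (simp add: c_def)
  ultimately show ?thesis by (intro exI[of _ c]) (simp add: s_def)
qed

lemma lower_facets_gale: "finite V \<Longrightarrow> lower_facets V (Suc d) = gale True V d"
  using outer_normal_gale[of V d _ _ True] gale_outer_normal[of V _ True d]
    by (auto simp: lower_facets_def)

lemma upper_facets_gale: "finite V \<Longrightarrow> upper_facets V (Suc d) = gale False V d"
  using outer_normal_gale[of V d _ _ False] gale_outer_normal[of V _ False d]
    by (auto simp: upper_facets_def)

section \<open>Complexes and their maximal simplices\<close>

lemma complex_of_mem:
  assumes M: "\<And>S. S \<in> M \<Longrightarrow> finite S \<and> card S = k" and F: "F \<in> complex_of M" "card F = k"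
  shows "F \<in> M"
proof -
  obtain S where S: "S \<in> M" "F \<subseteq> S" using F(1) by (auto simp: complex_of_def)
  have "finite S" "card F = card S" using M[OF S(1)] F(2) by simp_all
  then have "F = S" using S(2) by (intro card_subset_eq)
  then show ?thesis using S(1) by simp
qed

lemma maximal_complex_of:
  assumes M: "\<And>S. S \<in> M \<Longrightarrow> finite S \<and> card S = k"
  shows "maximal_simplices (complex_of M) = M"
proof (intro equalityI subsetI)
  fix S assume "S \<in> maximal_simplices (complex_of M)"
  then have S: "S \<in> complex_of M" "\<forall>S'\<in>complex_of M. S \<subseteq> S' \<longrightarrow> S' = S"
    by (simp_all add: maximal_simplices_def)
  then obtain S' where S': "S' \<in> M" "S \<subseteq> S'" unfolding complex_of_def by blast
  then have "S' \<in> complex_of M" unfolding complex_of_def by blast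
  then have "S' = S" using S(2) S'(2) by blast
  then show "S \<in> M" using S'(1) by simp
next
  fix S assume S: "S \<in> M"
  have max: "S' = S" if "S' \<in> complex_of M" "S \<subseteq> S'" for S'
  proof -
    obtain S'' where S'': "S'' \<in> M" "S' \<subseteq> S''" using \<open>S' \<in> complex_of M\<close>
      by (auto simp: complex_of_def)
    have "S \<subseteq> S''" using that(2) S''(2) by (rule order_trans)
    moreover have "finite S''" "card S = card S''" using M[OF S''(1)] M[OF S] by simp_all
    ultimately have "S = S''" by (intro card_subset_eq)
    then show ?thesis using that(2) S''(2) by blast
  qed
  have "S \<in> complex_of M" using S unfolding complex_of_def by blast
  then show "S \<in> maximal_simplices (complex_of M)" unfolding maximal_simplices_def using max
    by blast
qed

lemma triang_simplices: "triang n d M \<Longrightarrow> S \<in> M \<Longrightarrow> finite S \<and> card S = Suc d"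
  by (intro conjI) (rule triD(3), assumption+, rule triD(2))

lemma complex_of_inj: "inj_on complex_of {M. triang n d M}"
proof (rule inj_onI)
  fix M M' assume a: "M \<in> {M. triang n d M}" "M' \<in> {M. triang n d M}" "complex_of M = complex_of M'"
  then have t: "triang n d M" "triang n d M'" by simp_all
  have "maximal_simplices (complex_of M) = M" "maximal_simplices (complex_of M') = M'"
    by (rule maximal_complex_of[OF triang_simplices[OF t(1)]], assumption,
        rule maximal_complex_of[OF triang_simplices[OF t(2)]], assumption)
  then show "M = M'" unfolding a(3) by (rule trans[OF sym])
qed

lemma complex_of_triang:
  assumes d: "d \<ge> 1" and M: "triang n d M"
  shows "complex_of M \<in> triangulations n d"
proof -
  have sub: "\<exists>S'\<in>M. S \<subseteq> S'" if "S \<in> complex_of M" for S using that by (auto simp: complex_of_def)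
  have pr: "S \<subseteq> {1..n}" "finite S" "card S \<le> Suc d" if S: "S \<in> complex_of M" for S
  proof -
    obtain S' where S': "S' \<in> M" "S \<subseteq> S'" using sub[OF S] by blast
    note t = triD[OF M S'(1)]
    show "S \<subseteq> {1..n}" "finite S" "card S \<le> Suc d"
      using t S'(2) finite_subset[OF S'(2) t(3)] card_mono[OF t(3) S'(2)] by auto
  qed
  have nc: "\<not> over d S S'" if S: "S \<in> complex_of M" "S' \<in> complex_of M" for S S'
    using sub[OF S(1)] sub[OF S(2)] triang_noncross[OF M] over_mono by metis
  show ?thesis unfolding triangulations_def mem_Collect_eq
  proof (intro conjI ballI allI impI)
    show "simplex_labels n d S" if "S \<in> complex_of M" for S
      using pr[OF that] simplex_labels_iff[OF d] by blast
    show "F \<in> complex_of M" if "S \<in> complex_of M" "F \<subseteq> S" for S F using that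
      by (auto simp: complex_of_def)
    show "admissible d S S'" if "S \<in> complex_of M" "S' \<in> complex_of M" for S S'
      using admissible_iff[OF d pr(2,3)[OF that(1)] pr(2,3)[OF that(2)]] nc that by blast
    show "(\<Union>S\<in>complex_of M. cyc S d) = cyclic_polytope n d"
    proof (intro equalityI subsetI)
      fix x assume "x \<in> (\<Union>S\<in>complex_of M. cyc S d)"
      then obtain S where S: "S \<in> complex_of M" "x \<in> cyc S d" by blast
      have "cyc S d \<subseteq> cyclic_polytope n d" unfolding cyc_def using pr(1)[OF S(1)]
        by (intro hull_mono image_mono)
      then show "x \<in> cyclic_polytope n d" using S(2) by blast
    next
      fix x assume "x \<in> cyclic_polytope n d"
      then obtain a where a: "nonneg {1..n} a" "moment_ev a 1 = 1" "x = moment_comb d a"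
        using cyc_iff[OF _ d, of "{1..n}" x] by auto
      obtain S b where S: "S \<in> M" "nonneg S b" "same_moments d a b" using triang_cover[OF M a(1)]
        by blast
      then have "x \<in> cyc S d" using cyc_iff[OF triD(3)[OF M S(1)] d, of x] a
        unfolding same_moments_iff_moment_comb by metis
      moreover have "S \<in> complex_of M" using S(1) by (auto simp: complex_of_def)
      ultimately show "x \<in> (\<Union>S\<in>complex_of M. cyc S d)" by blast
    qed
  qed
qed

text \<open>The main point is that the complex is pure. From a simplex with too few vertices,
  \<open>grow\<close> in the direction of a label outside leads to a strictly larger one, until
  \<open>d + 1\<close> vertices are reached.\<close>

lemma triangulation_triang:
  assumes d: "d \<ge> 1" and n: "n \<ge> Suc d" and T: "T \<in> triangulations n d"
  shows "\<exists>M. triang n d M \<and> T = complex_of M"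
proof -
  have TT: "\<forall>S\<in>T. simplex_labels n d S" "\<forall>S\<in>T. \<forall>F. F \<subseteq> S \<longrightarrow> F \<in> T" "\<forall>S\<in>T. \<forall>S'\<in>T. admissible d S S'"
    and un: "(\<Union>S\<in>T. cyc S d) = cyclic_polytope n d"
    using T unfolding triangulations_def mem_Collect_eq by - (elim conjE, assumption)+
  have sl: "simplex_labels n d S" if "S \<in> T" for S using TT(1) that by (rule bspec)
  have down: "F \<in> T" if "S \<in> T" "F \<subseteq> S" for S F using TT(2) that by simp
  have adm: "admissible d S S'" if "S \<in> T" "S' \<in> T" for S S' using TT(3) that by simp
  have Sn: "S \<subseteq> {1..n}" "card S \<le> Suc d" if "S \<in> T" for S using sl[OF that]
    unfolding simplex_labels_iff[OF d] by simp_all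
  have Sf: "finite S" if "S \<in> T" for S using Sn(1)[OF that] finite_subset by blast
  have nc: "\<not> over d S S'" if "S \<in> T" "S' \<in> T" for S S'
    using admissible_iff[OF d Sf[OF that(1)] Sn(2)[OF that(1)] Sf[OF that(2)] Sn(2)[OF that(2)]] adm[OF that] by blast
  have "T \<subseteq> Pow {1..n}" using Sn(1) by blast
  then have fT: "finite T" by (rule finite_subset) simp
  have neT: "T \<noteq> {}"
  proof -
    have "moment_point d 1 \<in> cyclic_polytope n d" unfolding cyc_def using n by (intro hull_inc) auto
    then show ?thesis unfolding un[symmetric] by blast
  qed
  have cov: "covers n d T" unfolding covers_def
  proof (intro allI impI)
    fix a assume a: "nonneg {1..n} a"
    have sa: "supp a \<subseteq> {1..n}" and an: "\<And>i. a i \<ge> 0" using a by (auto simp: nonneg_def)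
    have fa: "finite (supp a)" using sa finite_subset by blast
    define c where "c = moment_ev a 1"
    have cs: "c = (\<Sum>i\<in>{1..n}. a i)" unfolding c_def using moment_ev_1[OF _ sa] by simp
    show "\<exists>S\<in>T. \<exists>b. nonneg S b \<and> same_moments d a b"
    \<comment> \<open>Coverage passes from the polytope to its cone by rescaling; the apex, of total
      weight 0, is treated separately.\<close>
    proof (cases "c = 0")
      case True
      then have "\<forall>i\<in>{1..n}. a i = 0" unfolding cs using an by (subst (asm) sum_nonneg_eq_0_iff) auto
      then have "supp a = {}" using sa by (auto simp: supp_def)
      then have "nonneg S a" for S using an by (simp add: nonneg_def)
      then show ?thesis using neT same_moments_refl by blast
    next
      case False
      then have c: "c > 0" unfolding cs using an by (simp add: less_le sum_nonneg)
      define a' where "a' = (\<lambda>i. 1 / c * a i + 0 * a i)"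
      have "nonneg {1..n} a'" using a c by (auto simp: nonneg_def a'_def supp_def)
      moreover have "moment_ev a' 1 = 1" unfolding a'_def moment_ev_linear(1)[OF fa fa] using c
        by (simp add: c_def[symmetric])
      ultimately have "moment_comb d a' \<in> cyclic_polytope n d" using cyc_iff[OF _ d, of
        "{1..n}" "moment_comb d a'"] by auto
      then obtain S where S: "S \<in> T" "moment_comb d a' \<in> cyc S d" unfolding un[symmetric] by blast
      obtain b' where b': "nonneg S b'" "moment_ev b' 1 = 1" "moment_comb d a' = moment_comb d b'"
        using S(2) cyc_iff[OF Sf[OF S(1)] d] by blast
      have fb: "finite (supp b')" using nonneg_finite[OF b'(1) Sf[OF S(1)]] .
      have e': "same_moments d a' b'" unfolding same_moments_iff_moment_comb
        using b' \<open>moment_ev a' 1 = 1\<close> by simp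
      define b where "b = (\<lambda>i. c * b' i + 0 * b' i)"
      have "nonneg S b" using b'(1) c by (auto simp: nonneg_def b_def supp_def)
      moreover have "same_moments d a b" unfolding same_moments_def
      proof (intro allI impI)
        fix q :: "real poly" assume "degree q \<le> d"
        then have "moment_ev a' q = moment_ev b' q" using e' by (simp add: same_moments_def)
        then have "1 / c * moment_ev a q = moment_ev b' q"
          unfolding a'_def moment_ev_linear(1)[OF fa fa] by simp
        then show "moment_ev a q = moment_ev b q" unfolding b_def moment_ev_linear(1)[OF fb fb]
          using c by (simp add: field_simps)
      qed
      ultimately show ?thesis using S(1) by blast
    qed
  qed
  have bigger: "\<exists>S'\<in>T. S \<subset> S'" if S: "S \<in> T" "card S \<le> d" for S
  proof -
    have "\<not> {1..n} \<subseteq> S" using card_mono[OF Sf[OF S(1)], of "{1..n}"] S(2) n by auto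
    then obtain v where v: "v \<in> {1..n}" "v \<notin> S" by blast
    have "\<exists>S'\<in>T. S \<subseteq> S' \<and> (\<exists>t>0. \<exists>b. nonneg S' b \<and>
      same_moments d (\<lambda>i. indic S i + t * indic {v} i) b)"
      by (rule grow[OF fT _ nc cov S(1) order_refl Sn(1)[OF S(1)] v(1)]) (use Sf Sn in auto)
    then obtain S' t b
      where S': "S' \<in> T" "S \<subseteq> S'" "t > 0" "nonneg S' b" "same_moments d (\<lambda>i. indic S i + t * indic {v} i) b" by blast
    \<comment> \<open>The moved point has positive weight at \<open>v\<close>, and weights on the at
      most \<open>d + 1\<close> labels of \<open>insert v S\<close> are unique.\<close>
    have "S' \<noteq> S"
    proof
      assume "S' = S"
      then have b: "supp b \<subseteq> insert v S" "b v = 0" using S'(4) v(2)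
        by (auto simp: nonneg_def supp_def)
      have "card (insert v S) \<le> Suc d" using S(2) v(2) Sf[OF S(1)] by simp
      then have "(\<lambda>i. indic S i + t * indic {v} i) = b"
      proof (rule same_moments_supp_unique[rotated, OF _ _ b(1) S'(5)])
        show "supp (\<lambda>i. indic S i + t * indic {v} i) \<subseteq> insert v S"
          by (auto simp: supp_def indic_def)
      qed (use Sf[OF S(1)] in simp)
      then have "indic S v + t * indic {v} v = 0" using b(2) by metis
      then show False using v(2) S'(3) by (simp add: indic_def)
    qed
    then show ?thesis using S' by blast
  qed
  define M where "M = {S\<in>T. card S = Suc d}"
  have ext: "\<exists>S'\<in>M. S \<subseteq> S'" if "S \<in> T" for S
    using that
  proof (induction "Suc d - card S" arbitrary: S rule: less_induct)
    case less
    show ?case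
    proof (cases "card S = Suc d")
      case True
      then show ?thesis using less.prems by (auto simp: M_def)
    next
      case False
      then have "card S \<le> d" using Sn(2)[OF less.prems] by simp
      then obtain S' where S': "S' \<in> T" "S \<subset> S'" using bigger less.prems by blast
      then have "card S < card S'" using Sf psubset_card_mono by blast
      then have "Suc d - card S' < Suc d - card S" using Sn(2)[OF S'(1)] by simp
      then obtain S'' where "S'' \<in> M" "S' \<subseteq> S''" using less.hyps S'(1) by blast
      then show ?thesis using S'(2) by blast
    qed
  qed
  have "triang n d M" unfolding triang_def covers_def
  proof (intro conjI ballI allI impI)
    show "S \<subseteq> {1..n}" "card S = Suc d" if "S \<in> M" for S using that Sn by (auto simp: M_def)
    show "\<not> over d S S'" if "S \<in> M" "S' \<in> M" for S S' using that nc by (simp add: M_def)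
    fix a assume "nonneg {1..n} a"
    then obtain S b where S: "S \<in> T" "nonneg S b" "same_moments d a b" using cov
      unfolding covers_def by blast
    then show "\<exists>S\<in>M. \<exists>b. nonneg S b \<and> same_moments d a b" using ext[OF S(1)] nonneg_mono by blast
  qed
  moreover have "T = complex_of M" using ext down unfolding complex_of_def M_def by blast
  ultimately show ?thesis by blast
qed

lemma bot_top_complex:
  "bot_triangulation n d = complex_of (gale True {1..n} d)" "top_triangulation n d =
    complex_of (gale False {1..n} d)"
  unfolding bot_triangulation_def top_triangulation_def
    by (simp_all add: lower_facets_gale upper_facets_gale)

text \<open>Lower facets of \<open>R\<close> have full dimension, so lying in the complex and being
  one of its maximal simplices is the same for them.\<close>

lemma increasing_flips_eq:
  assumes d: "d \<ge> 1" and n: "n \<ge> Suc d"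
  shows "(complex_of M, T) \<in> increasing_flips n d \<and> triang n d M \<longleftrightarrow> (\<exists>M'. T = complex_of M' \<and>
    (M, M') \<in> flips n d)"
proof -
  have fR: "finite R" if "R \<subseteq> {1..n}" for R using that finite_subset by blast
  have sub: "gale True R d \<subseteq> complex_of M \<longleftrightarrow> gale True R d \<subseteq> M" if M: "triang n d M" for R
  proof
    assume a: "gale True R d \<subseteq> complex_of M"
    show "gale True R d \<subseteq> M"
    proof
      fix F assume "F \<in> gale True R d"
      then have "F \<in> complex_of M" "card F = Suc d" using a by (auto simp: gale_def)
      then show "F \<in> M" by - (rule complex_of_mem[OF triang_simplices[OF M]])
    qed
  next
    assume "gale True R d \<subseteq> M"
    then show "gale True R d \<subseteq> complex_of M" by (auto simp: complex_of_def)
  qed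
  have mx: "maximal_simplices (complex_of M) = M" if "triang n d M"
    using maximal_complex_of[OF triang_simplices[OF that]] .
  show ?thesis
  proof
    assume a: "(complex_of M, T) \<in> increasing_flips n d \<and> triang n d M"
    then have M: "triang n d M" by simp
    obtain R where R: "R \<subseteq> {1..n}" "card R = d + 2" "lower_facets R (d + 1) \<subseteq> complex_of M"
      "T = complex_of ((maximal_simplices (complex_of M) - lower_facets R (d + 1)) \<union>
        upper_facets R (d + 1))"
      using a by (auto simp: increasing_flips_def)
    have "T = complex_of (flip True d R M)"
      using R(4) fR[OF R(1)] unfolding mx[OF M]
        by (simp add: lower_facets_gale upper_facets_gale flip_def)
    moreover have "gale True R d \<subseteq> M" using R(3) fR[OF R(1)] sub[OF M]
      by (simp add: lower_facets_gale)
    ultimately show "\<exists>M'. T = complex_of M' \<and> (M, M') \<in> flips n d" unfolding flips_def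
      using M R(1,2) by blast
  next
    assume "\<exists>M'. T = complex_of M' \<and> (M, M') \<in> flips n d"
    then obtain M' where M': "T = complex_of M'" "(M, M') \<in> flips n d" by blast
    then obtain R where M: "triang n d M"
      and R: "R \<subseteq> {1..n}" "card R = d + 2" "gale True R d \<subseteq> M" "M' = flip True d R M"
      unfolding flips_def by blast
    have t': "triang n d M'" using flips_triang M'(2) by blast
    have "(complex_of M, T) \<in> increasing_flips n d"
      unfolding increasing_flips_def mem_Collect_eq prod.case
    proof (intro conjI exI[of _ R])
      show "complex_of M \<in> triangulations n d" "T \<in> triangulations n d"
        using complex_of_triang[OF d] M t' M'(1) by auto
      show "R \<subseteq> {1..n}" "card R = d + 2" using R by auto
      show "lower_facets R (d + 1) \<subseteq> complex_of M" using sub[OF M] R(3) fR[OF R(1)]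
        by (simp add: lower_facets_gale)
      show "T = complex_of ((maximal_simplices (complex_of M) - lower_facets R (d + 1)) \<union>
        upper_facets R (d + 1))"
        unfolding mx[OF M] M'(1) R(4) using fR[OF R(1)]
          by (simp add: lower_facets_gale upper_facets_gale flip_def)
    qed
    then show "(complex_of M, T) \<in> increasing_flips n d \<and> triang n d M" using M by simp
  qed
qed

lemma HST1_eq:
  assumes d: "d \<ge> 1" and n: "n \<ge> Suc d"
  shows "HST1 n d = {(complex_of M, complex_of M') | M M'. (M, M') \<in> flip_order n d}"
proof -
  have fwd: "\<exists>M'. T = complex_of M' \<and> (M, M') \<in> (flips n d)\<^sup>*" if
    "(complex_of M, T) \<in> (increasing_flips n d)\<^sup>*" and M: "triang n d M" for M T
    using that(1)
  proof (induction rule: rtrancl_induct)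
    case base
    then show ?case by blast
  next
    case (step T T')
    then obtain M' where M': "T = complex_of M'" "(M, M') \<in> (flips n d)\<^sup>*" by blast
    have "triang n d M'" using flips_star_triang[OF M'(2) M] .
    then obtain M'' where "T' = complex_of M''" "(M', M'') \<in> flips n d"
      using increasing_flips_eq[OF d n, of M' T'] step(2) M'(1) by blast
    then show ?case using rtrancl_into_rtrancl[OF M'(2)] by blast
  qed
  have bwd: "(complex_of M, complex_of M') \<in> (increasing_flips n d)\<^sup>*" if "(M, M') \<in> (flips n d)\<^sup>*"
    for M M'
    using that
  proof (induction rule: rtrancl_induct)
    case (step M' M'')
    have "(complex_of M', complex_of M'') \<in> increasing_flips n d"
      using increasing_flips_eq[OF d n, of M' "complex_of M''"] step(2) by blast
    then show ?case using step(3) by simp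
  qed simp
  show ?thesis
  proof (intro equalityI subsetI)
    fix p assume "p \<in> HST1 n d"
    then obtain T T' where p: "p = (T, T')"
      "(T, T') \<in> (increasing_flips n d)\<^sup>*" "T \<in> triangulations n d"
      by (auto simp: HST1_def)
    then obtain M where M: "triang n d M" "T = complex_of M" using triangulation_triang[OF d n]
      by blast
    then obtain M' where M': "T' = complex_of M'" "(M, M') \<in> (flips n d)\<^sup>*" using fwd[of M T'] p(2)
      by blast
    have "(M, M') \<in> flip_order n d" unfolding flip_order_def using M M' flips_star_triang by blast
    then show "p \<in> {(complex_of M, complex_of M') | M M'. (M, M') \<in> flip_order n d}" using p(1) M M'
      by blast
  next
    fix p assume "p \<in> {(complex_of M, complex_of M') | M M'. (M, M') \<in> flip_order n d}"
    then obtain M M' where p: "p = (complex_of M, complex_of M')" "triang n d M" "triang n d M'"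
      "(M, M') \<in> (flips n d)\<^sup>*"
      by (auto simp: flip_order_def)
    then show "p \<in> HST1 n d" unfolding HST1_def using bwd complex_of_triang[OF d] by simp
  qed
qed

subsection \<open>Characteristic sections\<close>

definition barycentric :: "nat \<Rightarrow> nat set set \<Rightarrow> (nat \<Rightarrow> real) \<Rightarrow> nat \<Rightarrow> real" where
  "barycentric d M x = (THE a. \<exists>S\<in>M. nonneg S a \<and> moment_ev a 1 = 1 \<and> x = moment_comb d a)"

lemma barycentric_moment_comb:
  assumes M: "triang n d M" and S: "S \<in> M" and a: "nonneg S a" "moment_ev a 1 = 1"
  shows "barycentric d M (moment_comb d a) = a"
  unfolding barycentric_def
proof (rule the_equality)
  show "\<exists>S\<in>M. nonneg S a \<and> moment_ev a 1 = 1 \<and> moment_comb d a = moment_comb d a" using S a by blast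
  fix b assume "\<exists>S\<in>M. nonneg S b \<and> moment_ev b 1 = 1 \<and> moment_comb d a = moment_comb d b"
  then obtain S'
    where S': "S' \<in> M" "nonneg S' b" "moment_ev b 1 = 1" "moment_comb d a = moment_comb d b"
    by blast
  then have "same_moments d b a" unfolding same_moments_iff_moment_comb using a by simp
  then show "b = a" using triang_eq[OF M S'(1) S S'(2) a(1)] by blast
qed

lemma polytope_point:
  assumes d: "d \<ge> 1" and M: "triang n d M" and x: "x \<in> cyclic_polytope n d"
  obtains S a where "S \<in> M" "nonneg S a" "moment_ev a 1 = 1" "x = moment_comb d a"
proof -
  obtain a where a: "nonneg {1..n} a" "moment_ev a 1 = 1" "x = moment_comb d a"
    using x cyc_iff[OF _ d, of "{1..n}" x] by auto
  obtain S b where "S \<in> M" "nonneg S b" "same_moments d a b" using triang_cover[OF M a(1)] by blast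
  then show ?thesis using that[of S b] a unfolding same_moments_iff_moment_comb by simp
qed

text \<open>The section is linear along segments by definition; splitting off one vertex at a time
  extends this to all convex combinations of vertices.\<close>

lemma section_on_simplex:
  assumes d: "d \<ge> 1" and S: "finite S" "S \<in> T" and down: "\<And>i. i \<in> S \<Longrightarrow> {i} \<in> T"
    and f: "is_characteristic_section n d T f" and a: "nonneg S a" "moment_ev a 1 = 1"
  shows "f (moment_comb d a) = moment_comb (Suc d) a"
  using a
proof (induction "card (supp a)" arbitrary: a rule: less_induct)
  case less
  note a = less.prems
  have sa: "supp a \<subseteq> S" using a(1) by (simp add: nonneg_def)
  have fa: "finite (supp a)" using sa S(1) finite_subset by blast
  have vert: "f (moment_point d i) = moment_point (Suc d) i" if "i \<in> S" for i
    using f down[OF that] by (simp add: is_characteristic_section_def)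
  have "supp a \<noteq> {}" using a(2) by (auto simp: moment_ev_def)
  then obtain i where i: "a i \<noteq> 0" by (auto simp: supp_def)
  then have iS: "i \<in> S" using sa by (auto simp: supp_def)
  show ?case using split_vertex[OF S(1) a i]
  proof cases
    case 1
    then show ?thesis using vert[OF iS] moment_comb_indic by simp
  next
    case (2 y)
    have "card (supp y) < card (supp a)" unfolding 2(3)
      using fa i by (intro card_Diff1_less) (auto simp: supp_def)
    then have ih: "f (moment_comb d y) = moment_comb (Suc d) y" using less.hyps 2(1,2) by blast
    have "moment_comb d y \<in> cyc S d" unfolding cyc_iff[OF S(1) d] using 2(1,2) by blast
    moreover have "moment_point d i \<in> cyc S d" unfolding cyc_def using iS by (intro hull_inc) simp
    moreover have "a i \<in> {0..1}" using 2(4,5) by simp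
    ultimately have "f ((1 - a i) *\<^sub>R moment_comb d y + a i *\<^sub>R moment_point d i)
        = (1 - a i) *\<^sub>R f (moment_comb d y) + a i *\<^sub>R f (moment_point d i)"
      using f S(2) unfolding is_characteristic_section_def by blast
    then show ?thesis unfolding 2(6)[of d, symmetric] ih vert[OF iS] 2(6)[of "Suc d", symmetric] .
  qed
qed

lemma characteristic_section_eq:
  assumes d: "d \<ge> 1" and M: "triang n d M"
  shows "characteristic_section n d (complex_of M) =
    restrict (\<lambda>x. moment_comb (Suc d) (barycentric d M x)) (cyclic_polytope n d)"
  unfolding characteristic_section_def
proof (rule the_equality)
  define g where "g = restrict (\<lambda>x. moment_comb (Suc d) (barycentric d M x)) (cyclic_polytope n d)"
  have inC: "moment_comb k a \<in> cyclic_polytope n k"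
    if "S \<in> M" "nonneg S a" "moment_ev a 1 = 1" "k \<ge> 1" for S a k
  proof -
    have "nonneg {1..n} a" using nonneg_mono[OF that(2) triD(1)[OF M that(1)]] .
    then show ?thesis using cyc_iff[OF _ that(4), of "{1..n}" "moment_comb k a"] that(3) by auto
  qed
  have gc: "g (moment_comb d a) = moment_comb (Suc d) a" if "S \<in> M" "nonneg S a" "moment_ev a 1 = 1"
    for S a
    using inC[OF that d] barycentric_moment_comb[OF M that] by (simp add: g_def)
  show "is_characteristic_section n d (complex_of M) g"
    unfolding is_characteristic_section_def
  proof (intro conjI ballI allI impI)
    show "g \<in> cyclic_polytope n d \<rightarrow>\<^sub>E cyclic_polytope n (d + 1)"
    proof (rule PiE_I)
      fix x assume "x \<in> cyclic_polytope n d"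
      then obtain S a where S: "S \<in> M" "nonneg S a" "moment_ev a 1 = 1" "x = moment_comb d a"
        using polytope_point[OF d M] by blast
      then show "g x \<in> cyclic_polytope n (d + 1)" using gc[OF S(1-3)] inC[OF S(1-3), of "Suc d"]
        by simp
    qed (simp add: g_def)
    fix S x y and u :: real assume S: "S \<in> complex_of M" and xy: "x \<in> cyc S d" "y \<in> cyc S d"
      and u: "u \<in> {0..1}"
    obtain S0 where S0: "S0 \<in> M" "S \<subseteq> S0" using S by (auto simp: complex_of_def)
    have fS: "finite S" using S0(2) triD(3)[OF M S0(1)] finite_subset by blast
    obtain a where a: "nonneg S a" "moment_ev a 1 = 1" "x = moment_comb d a"
      using xy(1) cyc_iff[OF fS d] by blast
    obtain b where b: "nonneg S b" "moment_ev b 1 = 1" "y = moment_comb d b"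
      using xy(2) cyc_iff[OF fS d] by blast
    have fin: "finite (supp a)" "finite (supp b)" using nonneg_finite a(1) b(1) fS by blast+
    define e where "e = (\<lambda>i. (1 - u) * a i + u * b i)"
    have ne: "nonneg S0 e" unfolding e_def using nonneg_mono[OF nonneg_convex[OF a(1) b(1)] S0(2)] u
      by simp
    have e1: "moment_ev e 1 = 1" unfolding e_def moment_ev_linear(1)[OF fin] using a(2) b(2) by simp
    have ec: "moment_comb k e = (1 - u) *\<^sub>R moment_comb k a + u *\<^sub>R moment_comb k b" for k
      unfolding e_def moment_comb_linear[OF fin] ..
    have "g (moment_comb d e) = moment_comb (Suc d) e" using gc[OF S0(1) ne e1] .
    moreover have "g x = moment_comb (Suc d) a" "g y = moment_comb (Suc d) b"
      unfolding a(3) b(3)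
        using gc[OF S0(1) nonneg_mono[OF a(1) S0(2)] a(2)] gc[OF S0(1) nonneg_mono[OF b(1) S0(2)] b(2)] .
    ultimately show "g ((1 - u) *\<^sub>R x + u *\<^sub>R y) = (1 - u) *\<^sub>R g x + u *\<^sub>R g y"
      unfolding ec a(3) b(3) by simp
  next
    fix i assume "{i} \<in> complex_of M"
    then obtain S where S: "S \<in> M" "{i} \<subseteq> S" by (auto simp: complex_of_def)
    have "g (moment_comb d (indic {i})) = moment_comb (Suc d) (indic {i})"
      using gc[OF S(1) nonneg_mono[OF nonneg_indic S(2)]] moment_ev_indic[of i 1] by simp
    then show "g (moment_point d i) = moment_point (d + 1) i" unfolding moment_comb_indic by simp
  qed
  show "f = g" if f: "is_characteristic_section n d (complex_of M) f" for f
  proof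
    fix x
    show "f x = g x"
    proof (cases "x \<in> cyclic_polytope n d")
      case False
      then show ?thesis using f by (auto simp: is_characteristic_section_def g_def)
    next
      case True
      then obtain S a where S: "S \<in> M" "nonneg S a" "moment_ev a 1 = 1" "x = moment_comb d a"
        using polytope_point[OF d M] by blast
      have "S \<in> complex_of M" "\<And>i. i \<in> S \<Longrightarrow> {i} \<in> complex_of M" using S(1)
        by (auto simp: complex_of_def)
      then have "f x = moment_comb (Suc d) a"
        unfolding S(4) using section_on_simplex[OF d triD(3)[OF M S(1)] _ _ f S(2,3)] by blast
      then show ?thesis using gc[OF S(1-3)] S(4) by simp
    qed
  qed
qed

lemma characteristic_section_height:
  assumes d: "d \<ge> 1" and M: "triang n d M" and S: "S \<in> M" "nonneg S a" "moment_ev a 1 = 1"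
  shows "characteristic_section n d (complex_of M) (moment_comb d a) d =
    moment_ev a (monom 1 (Suc d))"
proof -
  have "nonneg {1..n} a" using nonneg_mono[OF S(2) triD(1)[OF M S(1)]] .
  then have "moment_comb d a \<in> cyclic_polytope n d" using cyc_iff[OF _ d, of
    "{1..n}" "moment_comb d a"] S(3) by auto
  then show ?thesis unfolding characteristic_section_eq[OF d M]
    using barycentric_moment_comb[OF M S] by (simp add: moment_comb_def)
qed

text \<open>Heights are moments of order \<open>d + 1\<close> of barycentric weights. One direction
  is \<open>below_height\<close>; for the other, a crossing is rescaled to a point of the polytope
  at which the heights are in the wrong order.\<close>

lemma section_le_iff:
  assumes d: "d \<ge> 1" and M: "triang n d M" and M': "triang n d M'"
  shows "(\<forall>x\<in>cyclic_polytope n d. characteristic_section n d (complex_of M) x d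
      \<le> characteristic_section n d (complex_of M') x d) \<longleftrightarrow> below d M M'"
proof
  assume le: "below d M M'"
  show "\<forall>x\<in>cyclic_polytope n d. characteristic_section n d (complex_of M) x d
      \<le> characteristic_section n d (complex_of M') x d"
  proof
    fix x assume x: "x \<in> cyclic_polytope n d"
    obtain S a where S: "S \<in> M" "nonneg S a" "moment_ev a 1 = 1" "x = moment_comb d a"
      using polytope_point[OF d M x] by blast
    obtain S' b where S': "S' \<in> M'" "nonneg S' b" "moment_ev b 1 = 1" "x = moment_comb d b"
      using polytope_point[OF d M' x] by blast
    have "same_moments d a b" unfolding same_moments_iff_moment_comb using S S' by simp
    then have "moment_ev a (monom 1 (Suc d)) \<le> moment_ev b (monom 1 (Suc d))"
      using below_height[OF le S(1) S'(1) S(2) S'(2) triD(3)[OF M S(1)] triD(3)[OF M' S'(1)]]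
        by blast
    then show "characteristic_section n d (complex_of M) x d \<le>
      characteristic_section n d (complex_of M') x d"
      using characteristic_section_height[OF d M S(1-3)] characteristic_section_height[OF d M' S'(1-3)] S(4) S'(4) by simp
  qed
next
  assume H: "\<forall>x\<in>cyclic_polytope n d. characteristic_section n d (complex_of M) x d
      \<le> characteristic_section n d (complex_of M') x d"
  show "below d M M'" unfolding below_def
  proof (intro ballI notI)
    fix S S' assume S: "S \<in> M" "S' \<in> M'" "over d S S'"
    obtain a b where ab: "nonneg S a" "nonneg S' b" "same_moments d a b" "moment_ev b (monom 1 (Suc d)) < moment_ev a (monom 1 (Suc d))"
      using over_circuit[OF S(3)] by blast
    have fS: "finite S" "finite S'" using triD(3) M M' S by blast+
    have fin: "finite (supp a)" "finite (supp b)" using nonneg_finite ab fS by blast+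
    have an: "a i \<ge> 0" and bn: "b i \<ge> 0" for i using ab by (auto simp: nonneg_def)
    define c where "c = moment_ev a 1"
    have cb: "moment_ev b 1 = c" using ab(3) unfolding same_moments_iff_moment_comb c_def by simp
    have zero: "moment_ev e (monom 1 (Suc d)) = 0" if "moment_ev e 1 = 0"
      "\<And>i. e i \<ge> 0" "finite (supp e)" for e
    proof -
      have "(\<Sum>i\<in>supp e. e i) = 0" using that(1) moment_ev_1[OF that(3) order_refl] by simp
      then have "\<forall>i\<in>supp e. e i = 0" using sum_nonneg_eq_0_iff[OF that(3), of e] that(2) by blast
      then show ?thesis unfolding moment_ev_def by (intro sum.neutral) simp
    qed
    have "c \<noteq> 0"
    proof
      assume "c = 0"
      then have "moment_ev a (monom 1 (Suc d)) = 0" "moment_ev b (monom 1 (Suc d)) = 0"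
        using zero[OF _ an fin(1)] zero[OF _ bn fin(2)] cb by (simp_all add: c_def)
      then show False using ab(4) by simp
    qed
    moreover have "c \<ge> 0" unfolding c_def moment_ev_1[OF fin(1) order_refl] using an
      by (intro sum_nonneg)
    ultimately have c: "c > 0" by simp
    define a' where "a' = (\<lambda>i. 1 / c * a i + 0 * a i)"
    define b' where "b' = (\<lambda>i. 1 / c * b i + 0 * b i)"
    have ev': "moment_ev a' q = 1 / c * moment_ev a q" "moment_ev b' q = 1 / c * moment_ev b q"
      for q
      unfolding a'_def b'_def moment_ev_linear(1)[OF fin(1) fin(1)] moment_ev_linear(1)[OF fin(2) fin(2)] by simp_all
    have n': "nonneg S a'" "nonneg S' b'" using ab(1,2) c
      by (auto simp: nonneg_def a'_def b'_def supp_def)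
    have one: "moment_ev a' 1 = 1" "moment_ev b' 1 = 1" using ev'[of 1] c cb
      by (simp_all add: c_def[symmetric])
    have "same_moments d a' b'" using ab(3) by (simp add: same_moments_def ev')
    then have eq: "moment_comb d a' = moment_comb d b'" unfolding same_moments_iff_moment_comb
      by simp
    have "nonneg {1..n} a'" using nonneg_mono[OF n'(1) triD(1)[OF M S(1)]] .
    then have "moment_comb d a' \<in> cyclic_polytope n d" using cyc_iff[OF _ d, of
      "{1..n}" "moment_comb d a'"] one(1) by auto
    then have "characteristic_section n d (complex_of M) (moment_comb d a') d \<le>
      characteristic_section n d (complex_of M') (moment_comb d a') d"
      using H by blast
    then have "moment_ev a' (monom 1 (Suc d)) \<le> moment_ev b' (monom 1 (Suc d))"
      unfolding characteristic_section_height[OF d M S(1) n'(1) one(1)]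
      unfolding eq characteristic_section_height[OF d M' S(2) n'(2) one(2)] .
    then show False using ab(4) c unfolding ev' by (simp add: divide_le_cancel)
  qed
qed

lemma HST2_eq:
  assumes d: "d \<ge> 1" and n: "n \<ge> Suc d"
  shows "HST2 n d = {(complex_of M, complex_of M') | M M'. (M, M') \<in> height_order n d}"
proof (intro equalityI subsetI)
  fix p assume "p \<in> HST2 n d"
  then obtain T T' where p: "p = (T, T')" "T \<in> triangulations n d" "T' \<in> triangulations n d"
    and le: "\<forall>x\<in>cyclic_polytope n d. characteristic_section n d T x d \<le>
      characteristic_section n d T' x d"
    unfolding HST2_def by blast
  obtain M where M: "triang n d M" "T = complex_of M" using triangulation_triang[OF d n p(2)]
    by blast
  obtain M' where M': "triang n d M'" "T' = complex_of M'" using triangulation_triang[OF d n p(3)]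
    by blast
  have "(M, M') \<in> height_order n d" unfolding height_order_def
    using le section_le_iff[OF d M(1) M'(1)] M M' by simp
  then show "p \<in> {(complex_of M, complex_of M') | M M'. (M, M') \<in> height_order n d}"
    using p(1) M(2) M'(2) by blast
next
  fix p assume "p \<in> {(complex_of M, complex_of M') | M M'. (M, M') \<in> height_order n d}"
  then obtain M M'
    where p: "p = (complex_of M, complex_of M')" "triang n d M" "triang n d M'" "below d M M'"
    by (auto simp: height_order_def)
  then show "p \<in> HST2 n d" unfolding HST2_def
    using section_le_iff[OF d p(2,3)] complex_of_triang[OF d] by simp
qed

lemma realization_iso:
  assumes r: "finite_poset r" and c: "inj_on c (Field r)"
    and s: "s = {(c x, c y) | x y. (x, y) \<in> r}"
    and bt: "b \<in> Field r" "t \<in> Field r"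
  shows "geometric_realization (order_complex (proper_part s (c b) (c t))) homotopy_equivalent_space
    geometric_realization (order_complex (proper_part r b t))"
proof -
  define g where "g = inv_into (Field r) c"
  have gc: "g (c x) = x" if "x \<in> Field r" for x using inv_into_f_f[OF c that] by (simp add: g_def)
  have rF: "x \<in> Field r" "y \<in> Field r" if "(x, y) \<in> r" for x y using that by (auto simp: Field_def)
  have rr: "(x, x) \<in> r" if "x \<in> Field r" for x using r that by (simp add: finite_poset_def)
  have sE: "\<exists>x y. u = c x \<and> v = c y \<and> (x, y) \<in> r" if "(u, v) \<in> s" for u v using that unfolding s
    by blast
  have sI: "(c x, c y) \<in> s" if "(x, y) \<in> r" for x y using that unfolding s by blast
  have Fs: "Field s = c ` Field r"
  proof (intro equalityI subsetI)
    fix u assume "u \<in> Field s"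
    then obtain v where "(u, v) \<in> s \<or> (v, u) \<in> s" by (auto simp: Field_def)
    then show "u \<in> c ` Field r" using sE rF by blast
  next
    fix u assume "u \<in> c ` Field r"
    then obtain x where "u = c x" "x \<in> Field r" by blast
    then show "u \<in> Field s" using FieldI1[OF sI[OF rr]] by simp
  qed
  have gs: "(g u, g v) \<in> r" if uv: "(u, v) \<in> s" for u v
  proof -
    obtain x y where xy: "u = c x" "v = c y" "(x, y) \<in> r" using sE[OF uv] by blast
    show ?thesis unfolding xy(1,2) gc[OF rF(1)[OF xy(3)]] gc[OF rF(2)[OF xy(3)]] by (rule xy(3))
  qed
  have cg: "c (g u) = u" if "u \<in> Field s" for u
    using f_inv_into_f[of u c "Field r"] that unfolding Fs g_def by blast
  have sF: "u \<in> Field s" "v \<in> Field s" if "(u, v) \<in> s" for u v using that by (auto simp: Field_def)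
  have pos: "finite_poset s"
    unfolding finite_poset_def
  proof (intro conjI ballI)
    show "finite (Field s)" unfolding Fs using r by (simp add: finite_poset_def)
    show "(u, u) \<in> s" if u: "u \<in> Field s" for u
    proof -
      obtain x where "u = c x" "x \<in> Field r" using u unfolding Fs by blast
      then show ?thesis using sI[OF rr] by simp
    qed
    show "trans s"
    proof (rule transI)
      fix u v w assume uv: "(u, v) \<in> s" "(v, w) \<in> s"
      have "trans r" using r by (simp add: finite_poset_def)
      then have "(g u, g w) \<in> r" using gs[OF uv(1)] gs[OF uv(2)] by (rule transD)
      then have "(c (g u), c (g w)) \<in> s" by (rule sI)
      then show "(u, w) \<in> s" unfolding cg[OF sF(1)[OF uv(1)]] cg[OF sF(2)[OF uv(2)]] .
    qed
    show "antisym s"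
    proof (rule antisymI)
      fix u v assume uv: "(u, v) \<in> s" "(v, u) \<in> s"
      have "antisym r" using r by (simp add: finite_poset_def)
      then have "g u = g v" using gs[OF uv(1)] gs[OF uv(2)] by (rule antisymD)
      then have "c (g u) = c (g v)" by simp
      then show "u = v" unfolding cg[OF sF(1)[OF uv(1)]] cg[OF sF(2)[OF uv(1)]] .
    qed
  qed
  have sg: "strict_map s (c b) (c t) r b t g"
    unfolding strict_map_def mono_map_def
  proof (intro conjI ballI allI impI)
    show "(g u, g v) \<in> r" if "(u, v) \<in> s" for u v using gs[OF that] .
    fix u assume u: "u \<in> Field s"
    show "u = c b" if "g u = b" using cg[OF u] unfolding that by (rule sym)
    show "u = c t" if "g u = t" using cg[OF u] unfolding that by (rule sym)
  qed
  have sc: "strict_map r b t s (c b) (c t) c"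
    unfolding strict_map_def mono_map_def using sI inj_onD[OF c] bt by blast
  show ?thesis
  proof (rule homotopy_equivalentI[OF finite_poset_proper_part[OF pos] finite_poset_proper_part[OF r]
        strict_map_proper[OF sg] strict_map_proper[OF sc]])
    show "push_homotopic (proper_part s (c b) (c t)) (c \<circ> g) id"
      by (rule push_homotopic_eq[OF finite_poset_proper_part[OF pos]])
        (use cg in \<open>auto simp: Field_proper_part[OF pos] mono_map_def\<close>)
    show "push_homotopic (proper_part r b t) (g \<circ> c) id"
      by (rule push_homotopic_eq[OF finite_poset_proper_part[OF r]])
        (use gc in \<open>auto simp: Field_proper_part[OF r] mono_map_def\<close>)
  qed
qed

lemma homotopy_sphere:
  assumes n: "n \<ge> Suc d" and r: "finite_poset r" "Field r = {M. triang n d M}"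
    and b: "boolean_type r (gale True {1..n} d) (gale False {1..n} d) (n - Suc d)"
    and s: "s = {(complex_of M, complex_of M') | M M'. (M, M') \<in> r}"
  shows "geometric_realization (order_complex (proper_part s (bot_triangulation n d) (top_triangulation n d)))
    homotopy_equivalent_space sphere_space (int n - int d - 3)"
proof -
  have k: "int (n - Suc d) - 2 = int n - int d - 3" using n by simp
  have 1: "geometric_realization (order_complex (proper_part s (complex_of (gale True {1..n} d)) (complex_of (gale False {1..n} d))))
      homotopy_equivalent_space geometric_realization (order_complex (proper_part r (gale True {1..n} d) (gale False {1..n} d)))"
  proof (rule realization_iso[OF r(1) _ s])
    show "inj_on complex_of (Field r)" unfolding r(2) by (rule complex_of_inj)
    show "gale True {1..n} d \<in> Field r" "gale False {1..n} d \<in> Field r" unfolding r(2)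
      using triang_gale[OF n] by simp_all
  qed
  show ?thesis unfolding bot_top_complex k[symmetric]
    by (rule homotopy_eqv_trans[OF 1 homotopy_eqv_trans[OF boolean_type_homotopy[OF r(1) b] boolean_sphere]])
qed

theorem theorem1p1:
  fixes n d :: nat
  assumes "d \<ge> 1" and "n > d + 1"
  shows "geometric_realization (order_complex
             (proper_part (HST1 n d) (bot_triangulation n d) (top_triangulation n d)))
           homotopy_equivalent_space sphere_space (int n - int d - 3)
       \<and> geometric_realization (order_complex
             (proper_part (HST2 n d) (bot_triangulation n d) (top_triangulation n d)))
           homotopy_equivalent_space sphere_space (int n - int d - 3)"
proof -
  have n: "n \<ge> Suc d" using assms(2) by simp
  show ?thesis
    by (intro conjI homotopy_sphere[OF n finite_poset_flip_order Field_M(1) boolean_type_flip_order[OF assms(1) n] HST1_eq[OF assms(1) n]]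
        homotopy_sphere[OF n finite_poset_height_order Field_M(2) boolean_type_height_order[OF assms(1) n] HST2_eq[OF assms(1) n]])
qed

end
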